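(* Let $0<\varepsilon<1$ and $0<\delta<1$, let $N_A=N_h$, and suppose that the optimal DOD map $s_*$ for the sample set $\mathcal P_2$ is $\hat L$-Lipschitz. Then there are $N_{s_2}=N_{s_2}(\delta,\varepsilon)$, a constant $c=c(\Theta,\Theta',T,L,\hat L,p,q,N')$, an architecture and a choice of neural network weights for that architecture, such that the DOD+DFNN approximate parameter-to-solution map $$(\mu,\nu,t)\mapsto\hat u^{\mu,\nu,t}=\mathbb V_{\mu,t}\cdot\phi_{N'}(\mu,\nu,t)$$ attains $$\mathbb P_\nu\big[\mathcal E_R^{\text{DOD+DFNN}}<\varepsilon\big]>1-\delta.$$ Further, the complexity of the underlying architecture is at most - $L_{\Phi_{\tilde{\mathbb V}}}=c\log(\varepsilon^{-1})$ layers and $\omega_{\Phi_{\tilde{\mathbb V}}}=c\,N_AN'\,\varepsilon^{-(p+1)}\log(\varepsilon^{-1})$ active weights for the inner DOD module $\Phi_{\tilde{\mathbb V}}$, - $L_{\Phi_{N'}}=c\log(\varepsilon^{-1})$ layers and $\omega_{\Phi_{N'}}=c\,N'\,\varepsilon^{-(p+q+1)}\log(\varepsilon^{-1})$ active weights for the deep feed-forward network $\Phi_{N'}$.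
   Context: **Setting.** Let $p,q\in\mathbb N$, $\Theta\subset\mathbb R^p$ and $\Theta'\subset\mathbb R^q$ compact, $T>0$, and natural numbers $N'<N_A\le N_h$. $\mathbb G\in\mathbb R^{N_h\times N_h}$ is symmetric positive definite, $\|u\|:=\sqrt{u^T\mathbb G u}$; $|\cdot|$ denotes the Euclidean norm of vectors and Lebesgue measure of sets. A matrix $W$ with $N_h$ rows is $\mathbb G$-orthonormal if $W^T\mathbb G W$ is the identity. For $(\mu,\nu,t)\in\Theta\times\Theta'\times[0,T]$, $u^{\mu,\nu,t}\in\mathbb R^{N_h}$ is the coefficient vector at time $t$ of the solution of a spatially discretized parametric parabolic PDE. **Assumptions.** (i) $m:=\operatorname{ess\,inf}\|u^{\mu,\nu,t}\|>0$, $M:=\operatorname{ess\,sup}\|u^{\mu,\nu,t}\|<\infty$, and $(\mu,\nu,t)\mapsto u^{\mu,\nu,t}$ is Lipschitz with constant $L>0$. (ii) Training parameters are i.i.d. (uniformly distributed) samples, $N_{s_1}$ in $\Theta$ and $N_{s_2}$ in $\Theta'$, $N_s=N_{s_1}N_{s_2}\ge2$; times lie on the uniform grid $\{\Delta t,\dots,N_t\Delta t\}$, $\Delta t=T/N_t$, $N_t\ge2$; $N_{\text{data}}=N_sN_t$. $\mathcal P_2$ is the set of $\Theta'$-samples and $\mathbb P_\nu$ the probability with respect to them; weights may depend on the sample. **Neural networks.** A network is $\Phi=((A_1,b_1),\dots,(A_L,b_L))$ with $A_l\in\mathbb R^{N_l\times\sum_{k<l}N_k}$, $b_l\in\mathbb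 R^{N_l}$ (skip connections allowed); its realization $R_\rho(\Phi)$ with ReLU activation $\rho$ is $x_l=\rho(A_l[x_0;\dots;x_{l-1}]+b_l)$, $l<L$, $x_L=A_L[x_0;\dots;x_{L-1}]+b_L$. An architecture prescribes which entries may be nonzero; weights are real values for those entries. $L_\Phi$ is the number of layers, $\omega_\Phi$ the number of nonzero entries (active weights). **DOD.** $\mathbb A\in\mathbb R^{N_h\times N_A}$ is the $\mathbb G$-orthonormal POD matrix of the snapshots (columns: leading $N_A$ $\mathbb G$-orthonormal eigenvectors of $\frac{|\Theta\times\Theta'\times[0,T]|}{N_{\text{data}}}UU^T\mathbb G$, $U$ the matrix of all snapshots). The inner DOD module is $\Phi_{\tilde{\mathbb V}}=\mathrm{ORTH}\circ\mathrm{STACK}\circ P(R_1\odot\mathsf s,\dots,R_{N'}\odot\mathsf s)$, with $\mathsf s$ a feed-forward network architecture $\mathbb R^{p+1}\to\mathbb R^l$, $R_i$ feed-forward network architectures $\mathbb R^l\to\mathbb R^{N_A}$, $\odot$ concatenation, $P$ parallelization, $\mathrm{STACK}$ the stacking into an $N_A\times N'$ matrix, $\mathrm{ORTH}$ a span-preserving orthonormalization of columns (e.g. QR). The DOD matrix is $\mathbb V_{\mu,t}:=\mathbb A\cdot R_\rho(\Phi_{\tilde{\mathbb V}}(\theta_{\mathrm{DOD}}))(\mu,t)\in\mathbb R^{N_h\times N'}$. **DOD+DFNN.** $\phi_{N'}:=R_\rho(\Phi_{N'}(\theta_{\mathrm{DF}})):\mathbb R^{p+q+1}\to\mathbb R^{N'}$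 is the realization of a deep feed-forward network. **Relative error.** $\mathcal E_R:=\Big(\int_{\Theta\times\Theta'\times[0,T]}\frac{\|u^{\mu,\nu,t}-\hat u^{\mu,\nu,t}\|^2}{\|u^{\mu,\nu,t}\|^2}d(\mu,\nu,t)\Big)^{1/2}$. **Choice of $N'$.** Let $\sigma(\mu,t)_1^2\ge\sigma(\mu,t)_2^2\ge\cdots$ be the eigenvalues of $\frac{|\Theta'|}{N_{s_2}}\sum_{\nu\in\mathcal P_2}(\mathbb A^T\mathbb G u^{\mu,\nu,t})(\mathbb A^T\mathbb G u^{\mu,\nu,t})^T$. $N'$ is the smallest $k_0\in\mathbb N$ with $\sup_{(\mu,t)\in\Theta\times[0,T]}\sum_{k>k_0}\sigma(\mu,t)_k^2\le\frac{m^2}{16|\Theta\times[0,T]|}\varepsilon^2$. **Optimal DOD for $\mathcal P_2$.** With $\hat J(\mu,t,\mathbb V):=\frac{|\Theta'|}{N_{s_2}}\sum_{\nu\in\mathcal P_2}\|u^{\mu,\nu,t}-\mathbb V\mathbb V^T\mathbb G u^{\mu,\nu,t}\|^2$, it is the map $s_*:\Theta\times[0,T]\to[-1,1]^{N_A\times N'}$ with $s_*(\mu,t)\in\operatorname{argmin}_{\tilde{\mathbb V}\in[-1,1]^{N_A\times N'}}\hat J(\mu,t,\mathbb A\tilde{\mathbb V})$ and $\mathbb A s_*(\mu,t)$ $\mathbb G$-orthonormal.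
   Formalization: The constant c may also depend on m = ess inf ‖u‖ (the claim fails without this), and it is uniform only for ε ≤ ε₀ with an arbitrary fixed ε₀ < 1 on which c may depend, since c·log(1/ε) → 0 as ε → 1 while a network has at least one layer. *)

theory Defs
  imports
    "HOL-Probability.Probability"
    "Jordan_Normal_Form.Char_Poly"
    "Jordan_Normal_Form.Gram_Schmidt"
begin

text \<open>
  The numbers N_h, N_A, N' and the layer widths are quantified inside the statement, so
  coefficient vectors and matrices are those of Jordan_Normal_Form (explicit dimensions).
  Parameter domains are subsets of \<^typ>\<open>real^'p\<close> and \<^typ>\<open>real^'q\<close>, i.e. p = CARD('p), q = CARD('q).
\<close>

unbundle no vec_syntax

definition spd :: "nat \<Rightarrow> real mat \<Rightarrow> bool" where
  "spd n G \<longleftrightarrow> G \<in> carrier_mat n n \<and> transpose_mat G = G \<and>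
     (\<forall>v \<in> carrier_vec n. v \<noteq> 0\<^sub>v n \<longrightarrow> 0 < scalar_prod v (G *\<^sub>v v))"

definition gnorm :: "real mat \<Rightarrow> real Matrix.vec \<Rightarrow> real" where
  "gnorm G v = sqrt (scalar_prod v (G *\<^sub>v v))"

definition g_orthonormal :: "real mat \<Rightarrow> real mat \<Rightarrow> bool" where
  "g_orthonormal G W \<longleftrightarrow> dim_row W = dim_row G \<and> transpose_mat W * G * W = 1\<^sub>m (dim_col W)"

definition frobenius_norm :: "real mat \<Rightarrow> real" where
  "frobenius_norm W = sqrt (\<Sum>i<dim_row W. \<Sum>j<dim_col W. (W $$ (i, j))\<^sup>2)"

definition essinf :: "'a measure \<Rightarrow> ('a \<Rightarrow> ereal) \<Rightarrow> ereal" where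
  "essinf M f = - esssup M (\<lambda>x. - f x)"

text \<open>Lipschitz continuity of the solution map is measured in the norm \<^const>\<open>gnorm\<close>; the metric on
  the parameter-time domain is the Euclidean one (the product metric).\<close>

definition solution_map ::
  "(real^'p) set \<Rightarrow> (real^'q) set \<Rightarrow> real \<Rightarrow> real \<Rightarrow> real \<Rightarrow> nat \<Rightarrow> real mat \<Rightarrow>
   ((real^'p) \<times> (real^'q) \<times> real \<Rightarrow> real Matrix.vec) \<Rightarrow> bool" where
  "solution_map \<Theta> \<Theta>' T L m Nh G u \<longleftrightarrow>
     spd Nh G \<and>
     (\<forall>x \<in> \<Theta> \<times> \<Theta>' \<times> {0..T}. u x \<in> carrier_vec Nh) \<and>
     essinf (restrict_space lborel (\<Theta> \<times> \<Theta>' \<times> {0..T})) (\<lambda>x. ereal (gnorm G (u x))) = ereal m \<and>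
     esssup (restrict_space lborel (\<Theta> \<times> \<Theta>' \<times> {0..T})) (\<lambda>x. ereal (gnorm G (u x))) < \<infinity> \<and>
     (\<forall>x \<in> \<Theta> \<times> \<Theta>' \<times> {0..T}. \<forall>y \<in> \<Theta> \<times> \<Theta>' \<times> {0..T}. gnorm G (u x - u y) \<le> L * dist x y)"

text \<open>If the integral is infinite, so is the error; this avoids the default value of the
  Bochner integral.\<close>

definition rel_error ::
  "(real^'p) set \<Rightarrow> (real^'q) set \<Rightarrow> real \<Rightarrow> real mat \<Rightarrow>
   ((real^'p) \<times> (real^'q) \<times> real \<Rightarrow> real Matrix.vec) \<Rightarrow>
   ((real^'p) \<times> (real^'q) \<times> real \<Rightarrow> real Matrix.vec) \<Rightarrow> ennreal" where
  "rel_error \<Theta> \<Theta>' T G u uh =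
     (let I = (\<integral>\<^sup>+ x \<in> \<Theta> \<times> \<Theta>' \<times> {0..T}.
                 ennreal ((gnorm G (u x - uh x))\<^sup>2 / (gnorm G (u x))\<^sup>2) \<partial>lborel)
      in if I = \<infinity> then \<infinity> else ennreal (sqrt (enn2real I)))"

text \<open>Samples in \<open>\<Theta>\<close> and \<open>\<Theta>'\<close> are families \<open>\<mu>s\<close>, \<open>\<nu>s\<close> indexed by \<open>{..<Ns1}\<close> and \<open>{..<Ns2}\<close>.\<close>

definition sample_measure :: "(real^'q) set \<Rightarrow> nat \<Rightarrow> (nat \<Rightarrow> real^'q) measure" where
  "sample_measure \<Theta>' n = (\<Pi>\<^sub>M j\<in>{..<n}. uniform_measure lborel \<Theta>')"

definition snapshot_mat ::
  "real \<Rightarrow> nat \<Rightarrow> ((real^'p) \<times> (real^'q) \<times> real \<Rightarrow> real Matrix.vec) \<Rightarrow>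
   nat \<Rightarrow> (nat \<Rightarrow> real^'p) \<Rightarrow> nat \<Rightarrow> (nat \<Rightarrow> real^'q) \<Rightarrow> nat \<Rightarrow> real mat" where
  "snapshot_mat T Nh u Ns1 \<mu>s Ns2 \<nu>s Nt =
     mat_of_cols Nh [u (\<mu>s i, \<nu>s j, real k * (T / real Nt)).
       i \<leftarrow> [0..<Ns1], j \<leftarrow> [0..<Ns2], k \<leftarrow> [1..<Suc Nt]]"

definition leading_eigenbasis :: "real mat \<Rightarrow> real mat \<Rightarrow> nat \<Rightarrow> nat \<Rightarrow> real mat \<Rightarrow> bool" where
  "leading_eigenbasis G K Nh NA A \<longleftrightarrow>
     (\<exists>E ev. E \<in> carrier_mat Nh Nh \<and> g_orthonormal G E \<and>
        (\<forall>j<Nh. eigenvector K (col E j) (ev j)) \<and>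
        (\<forall>i j. i \<le> j \<and> j < Nh \<longrightarrow> ev j \<le> ev i) \<and>
        A = mat_of_cols Nh (map (col E) [0..<NA]))"

definition is_POD ::
  "(real^'p) set \<Rightarrow> (real^'q) set \<Rightarrow> real \<Rightarrow> nat \<Rightarrow> real mat \<Rightarrow>
   ((real^'p) \<times> (real^'q) \<times> real \<Rightarrow> real Matrix.vec) \<Rightarrow>
   nat \<Rightarrow> (nat \<Rightarrow> real^'p) \<Rightarrow> nat \<Rightarrow> (nat \<Rightarrow> real^'q) \<Rightarrow> nat \<Rightarrow> nat \<Rightarrow> real mat \<Rightarrow> bool" where
  "is_POD \<Theta> \<Theta>' T Nh G u Ns1 \<mu>s Ns2 \<nu>s Nt NA A \<longleftrightarrow>
     (let U = snapshot_mat T Nh u Ns1 \<mu>s Ns2 \<nu>s Nt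
      in leading_eigenbasis G
           ((measure lborel (\<Theta> \<times> \<Theta>' \<times> {0..T}) / real (Ns1 * Ns2 * Nt)) \<cdot>\<^sub>m (U * transpose_mat U * G))
           Nh NA A)"

text \<open>Eigenvalues with multiplicity in decreasing order; used for real symmetric matrices, where the
  list exists and is unique.\<close>

definition sorted_eigenvalues :: "real mat \<Rightarrow> real list" where
  "sorted_eigenvalues C =
     (THE es. sorted (rev es) \<and> char_poly C = (\<Prod>e\<leftarrow>es. [:- e, 1:]))"

definition sample_correlation ::
  "(real^'q) set \<Rightarrow> real mat \<Rightarrow> ((real^'p) \<times> (real^'q) \<times> real \<Rightarrow> real Matrix.vec) \<Rightarrow>
   nat \<Rightarrow> (nat \<Rightarrow> real^'q) \<Rightarrow> real mat \<Rightarrow> (real^'p) \<times> real \<Rightarrow> real mat" where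
  "sample_correlation \<Theta>' G u Ns2 \<nu>s A = (\<lambda>(\<mu>, t).
     Matrix.mat (dim_col A) (dim_col A) (\<lambda>(i, k).
       measure lborel \<Theta>' / real Ns2 *
       (\<Sum>j<Ns2. let w = transpose_mat A * G *\<^sub>v u (\<mu>, \<nu>s j, t) in w $ i * w $ k)))"

text \<open>The list is indexed from 0, so \<open>drop k\<close> leaves the eigenvalues with (1-based) index greater
  than \<open>k\<close>.\<close>

definition reduced_dim ::
  "(real^'p) set \<Rightarrow> (real^'q) set \<Rightarrow> real \<Rightarrow> real mat \<Rightarrow>
   ((real^'p) \<times> (real^'q) \<times> real \<Rightarrow> real Matrix.vec) \<Rightarrow>
   nat \<Rightarrow> (nat \<Rightarrow> real^'q) \<Rightarrow> real mat \<Rightarrow> real \<Rightarrow> real \<Rightarrow> nat" where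
  "reduced_dim \<Theta> \<Theta>' T G u Ns2 \<nu>s A m \<epsilon> =
     (LEAST k. 1 \<le> k \<and> (\<forall>y \<in> \<Theta> \<times> {0..T}.
        sum_list (drop k (sorted_eigenvalues (sample_correlation \<Theta>' G u Ns2 \<nu>s A y)))
          \<le> m\<^sup>2 / (16 * measure lborel (\<Theta> \<times> {0..T})) * \<epsilon>\<^sup>2))"

definition J_hat ::
  "(real^'q) set \<Rightarrow> real mat \<Rightarrow> ((real^'p) \<times> (real^'q) \<times> real \<Rightarrow> real Matrix.vec) \<Rightarrow>
   nat \<Rightarrow> (nat \<Rightarrow> real^'q) \<Rightarrow> (real^'p) \<times> real \<Rightarrow> real mat \<Rightarrow> real" where
  "J_hat \<Theta>' G u Ns2 \<nu>s = (\<lambda>(\<mu>, t) V.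
     measure lborel \<Theta>' / real Ns2 *
     (\<Sum>j<Ns2. let v = u (\<mu>, \<nu>s j, t) in (gnorm G (v - V * transpose_mat V * G *\<^sub>v v))\<^sup>2))"

definition unit_box :: "nat \<Rightarrow> nat \<Rightarrow> real mat set" where
  "unit_box n k = {W \<in> carrier_mat n k. \<forall>i<n. \<forall>j<k. W $$ (i, j) \<in> {-1..1}}"

definition optimal_DOD ::
  "(real^'p) set \<Rightarrow> (real^'q) set \<Rightarrow> real \<Rightarrow> real mat \<Rightarrow>
   ((real^'p) \<times> (real^'q) \<times> real \<Rightarrow> real Matrix.vec) \<Rightarrow>
   nat \<Rightarrow> (nat \<Rightarrow> real^'q) \<Rightarrow> real mat \<Rightarrow> nat \<Rightarrow> ((real^'p) \<times> real \<Rightarrow> real mat) \<Rightarrow> bool" where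
  "optimal_DOD \<Theta> \<Theta>' T G u Ns2 \<nu>s A N' s \<longleftrightarrow> (\<forall>y \<in> \<Theta> \<times> {0..T}.
     is_arg_min (\<lambda>W. J_hat \<Theta>' G u Ns2 \<nu>s y (A * W)) (\<lambda>W. W \<in> unit_box (dim_col A) N') (s y) \<and>
     g_orthonormal G (A * s y))"

definition frobenius_lipschitz ::
  "real \<Rightarrow> 'a::metric_space set \<Rightarrow> ('a \<Rightarrow> real mat) \<Rightarrow> bool" where
  "frobenius_lipschitz Lh X s \<longleftrightarrow>
     (\<forall>x \<in> X. \<forall>y \<in> X. frobenius_norm (s x - s y) \<le> Lh * dist x y)"

text \<open>The first component of a layer acts on the concatenation of the network input and all previous
  layer outputs.  Networks are layer lists with real entries; architectures are layer lists with
  Boolean entries, \<^const>\<open>True\<close> marking the entries that may be nonzero.\<close>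

type_synonym 'e layers = "('e mat \<times> 'e Matrix.vec) list"
type_synonym network = "real layers"
type_synonym architecture = "bool layers"

fun well_shaped :: "nat \<Rightarrow> nat \<Rightarrow> 'e layers \<Rightarrow> bool" where
  "well_shaped d n [] = False"
| "well_shaped d n [(A, b)] = (A \<in> carrier_mat n d \<and> b \<in> carrier_vec n)"
| "well_shaped d n ((A, b) # l # ls) =
     (dim_col A = d \<and> dim_vec b = dim_row A \<and> well_shaped (d + dim_row A) n (l # ls))"

fun realize :: "network \<Rightarrow> real Matrix.vec \<Rightarrow> real Matrix.vec" where
  "realize [] z = z"
| "realize [(A, b)] z = A *\<^sub>v z + b"
| "realize ((A, b) # l # ls) z = realize (l # ls) (z @\<^sub>v map_vec (max 0) (A *\<^sub>v z + b))"

definition fits :: "architecture \<Rightarrow> network \<Rightarrow> bool" where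
  "fits a \<Phi> \<longleftrightarrow> list_all2 (\<lambda>(M, c) (A, b).
     A \<in> carrier_mat (dim_row M) (dim_col M) \<and> b \<in> carrier_vec (dim_vec c) \<and>
     (\<forall>i<dim_row M. \<forall>j<dim_col M. A $$ (i, j) \<noteq> 0 \<longrightarrow> M $$ (i, j)) \<and>
     (\<forall>i<dim_vec c. b $ i \<noteq> 0 \<longrightarrow> c $ i)) a \<Phi>"

definition active_weights :: "architecture \<Rightarrow> nat" where
  "active_weights a = (\<Sum>(M, c)\<leftarrow>a.
     card {(i, j). i < dim_row M \<and> j < dim_col M \<and> M $$ (i, j)} + card {i. i < dim_vec c \<and> c $ i})"

text \<open>Sparse concatenation (first \<open>\<Phi>2\<close>, then \<open>\<Phi>1\<close>): the output \<open>y\<close> of \<open>\<Phi>2\<close> is passed on through the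
  additional hidden layer \<open>(\<rho>(y), \<rho>(-y))\<close>, using \<open>y = \<rho>(y) - \<rho>(-y)\<close>.  The matrices of \<open>\<Phi>1\<close> get zero
  columns for the input and the hidden layers of \<open>\<Phi>2\<close>.  The parameters \<open>neg\<close>, \<open>z\<close> are negation and
  zero; for architectures they are \<^const>\<open>id\<close> and \<^const>\<open>False\<close>.\<close>

definition concatenate :: "('e \<Rightarrow> 'e) \<Rightarrow> 'e \<Rightarrow> 'e layers \<Rightarrow> 'e layers \<Rightarrow> 'e layers" where
  "concatenate neg z \<Phi>1 \<Phi>2 =
     (let A = fst (last \<Phi>2); b = snd (last \<Phi>2); D = dim_col A; n = dim_row A in
      butlast \<Phi>2 @
      [(Matrix.mat (2 * n) D (\<lambda>(i, j). if i < n then A $$ (i, j) else neg (A $$ (i - n, j))),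
        Matrix.vec (2 * n) (\<lambda>i. if i < n then b $ i else neg (b $ (i - n))))] @
      map (\<lambda>(B, c).
        (Matrix.mat (dim_row B) (D + n + dim_col B) (\<lambda>(i, j).
           if j < D then z
           else if j < D + n then B $$ (i, j - D)
           else if j < D + 2 * n then neg (B $$ (i, j - D - n))
           else B $$ (i, j - D - n)), c)) \<Phi>1)"

abbreviation net_concat :: "network \<Rightarrow> network \<Rightarrow> network" where
  "net_concat \<equiv> concatenate uminus 0"

abbreviation arch_concat :: "architecture \<Rightarrow> architecture \<Rightarrow> architecture" where
  "arch_concat \<equiv> concatenate id False"

text \<open>Coordinates of a point; the enumeration of the basis is arbitrary but fixed.\<close>

definition coords :: "'a::euclidean_space \<Rightarrow> real Matrix.vec" where
  "coords x = Matrix.vec DIM('a) (\<lambda>i. inner x (from_nat_into Basis i))"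

text \<open>Orthonormalization by Gram-Schmidt, i.e. the Q factor of the QR decomposition with positive
  diagonal.  A column that depends linearly on its predecessors becomes the zero column.\<close>

definition ORTH :: "real mat \<Rightarrow> real mat" where
  "ORTH W = mat_of_cols (dim_row W)
     (map (\<lambda>v. (1 / sqrt (scalar_prod v v)) \<cdot>\<^sub>v v) (gram_schmidt (dim_row W) (cols W)))"

definition STACK :: "nat \<Rightarrow> real Matrix.vec list \<Rightarrow> real mat" where
  "STACK n vs = mat_of_cols n vs"

text \<open>An inner DOD module is given by a seed \<open>S\<close> and roots \<open>R i\<close>, \<open>i < N'\<close>.  Its parallelized part is
  the list of branches \<open>R i\<close> after \<open>S\<close>: all branches read the same input and have the same number of
  layers, which is the number of layers of the parallelization; being block diagonal, the
  parallelization has as many active weights as its branches together (so the weights of the seed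
  are counted once per branch).\<close>

definition inner_branches :: "nat \<Rightarrow> architecture \<Rightarrow> (nat \<Rightarrow> architecture) \<Rightarrow> architecture list" where
  "inner_branches N' S R = map (\<lambda>i. arch_concat (R i) S) [0..<N']"

definition inner_architecture ::
  "nat \<Rightarrow> nat \<Rightarrow> nat \<Rightarrow> architecture \<Rightarrow> (nat \<Rightarrow> architecture) \<Rightarrow> bool" where
  "inner_architecture d NA N' S R \<longleftrightarrow>
     (\<exists>l. well_shaped d l S \<and> (\<forall>i<N'. well_shaped l NA (R i))) \<and>
     (\<forall>i<N'. \<forall>j<N'. length (R i) = length (R j))"

definition inner_layers :: "nat \<Rightarrow> architecture \<Rightarrow> (nat \<Rightarrow> architecture) \<Rightarrow> nat" where
  "inner_layers N' S R = Max (length ` set (inner_branches N' S R))"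

definition inner_weights :: "nat \<Rightarrow> architecture \<Rightarrow> (nat \<Rightarrow> architecture) \<Rightarrow> nat" where
  "inner_weights N' S R = sum_list (map active_weights (inner_branches N' S R))"

definition inner_DOD ::
  "nat \<Rightarrow> nat \<Rightarrow> network \<Rightarrow> (nat \<Rightarrow> network) \<Rightarrow> real Matrix.vec \<Rightarrow> real mat" where
  "inner_DOD NA N' S R y =
     ORTH (STACK NA (map (\<lambda>i. realize (net_concat (R i) S) y) [0..<N']))"

definition DOD_DFNN ::
  "real mat \<Rightarrow> nat \<Rightarrow> network \<Rightarrow> (nat \<Rightarrow> network) \<Rightarrow> network \<Rightarrow>
   (real^'p) \<times> (real^'q) \<times> real \<Rightarrow> real Matrix.vec" where
  "DOD_DFNN A N' S R F = (\<lambda>(\<mu>, \<nu>, t).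
     (A * inner_DOD (dim_col A) N' S R (coords (\<mu>, t))) *\<^sub>v realize F (coords (\<mu>, \<nu>, t)))"

end

theory Submission
  imports Defs "Jordan_Normal_Form.Schur_Decomposition"
begin

text \<open>
  The networks are piecewise constant up to a set of small measure. Cover \<open>\<Theta> \<times> [0,T]\<close> and
  \<open>\<Theta>'\<close>, each up to a remainder of tiny measure, by finitely many disjoint boxes of diameter
  at most \<open>\<eta> = c\<^sub>0 \<epsilon>\<close>. By a ReLU network with a bounded number of layers one obtains, for every
  box, a trapezoidal bump that is 1 on the box; the slopes cost nothing, so the bumps can be made
  so steep that their supports are disjoint. A linear output layer then produces any prescribed
  value on each box. There are \<open>O(\<epsilon>\<^sup>-\<^sup>d)\<close> boxes in dimension d, and each costs \<open>O(n)\<close> weights for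
  outputs in \<open>\<real>\<^sup>n\<close>; this is the claimed complexity, the factor \<open>log(1/\<epsilon>)\<close> being bounded below by
  \<open>log(1/\<epsilon>\<^sub>0) > 0\<close>.

  On the box with reference point \<open>y\<^sub>g\<close> the inner DOD module outputs the optimal matrix
  \<open>s(y\<^sub>g)\<close>. As \<open>N\<^sub>A = N\<^sub>h\<close>, the POD matrix is an isometry between the Euclidean norm of
  coefficients and the \<open>G\<close>-norm, so \<open>s(y\<^sub>g)\<close> has orthonormal columns; Gram-Schmidt therefore
  leaves it unchanged, even when it is multiplied by a positive bump value
  (\<open>inner_DOD_contraction\<close>). On the product of the boxes g and h the second network outputs
  \<open>s(y\<^sub>g)\<^sup>T\<close> applied to the coefficients of the solution at a reference point, so the
  reconstruction is the projection onto the columns of \<open>s(y\<^sub>g)\<close> of a nearby solution. Its error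
  at any point of the cell is at most \<open>3 L \<eta>\<close> plus the projection error at \<open>(y\<^sub>g, \<nu>\<^sub>j)\<close>, for
  every sample \<open>\<nu>\<^sub>j\<close> in the box h (\<open>cell_error\<close>).

  The mean over all samples of the squared projection errors at \<open>y\<^sub>g\<close>, times the volume of \<open>\<Theta>'\<close>,
  is the minimum of the DOD functional, and the spectral theorem bounds it by the tail of the eigenvalues
  (\<open>optimal_DOD_residual\<close>), which the choice of \<open>N'\<close> makes small. It remains to replace the
  sample mean by the integral over \<open>\<Theta>'\<close>. That only needs every box of the cover to contain
  almost its fair share of the samples, which holds with high probability by Hoeffding's
  inequality (\<open>frequencies_uniformly_large\<close>). This event concerns \<open>\<Theta>'\<close> and the boxes alone, so the
  number of samples depends neither on the dimension \<open>N\<^sub>h\<close> nor on the solution map. The lemma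
  \<open>error_integral_bound\<close> adds up the contributions of the cells.

  The POD matrix may depend on the sample in a non-measurable way, so the event that some natural
  choice of weights succeeds need not be measurable. Outside a measurable good event the weights
  are therefore chosen such that the error is large (\<open>DOD_DFNN_large_error_weights\<close>): then the event
  of success is exactly the good one.
\<close>

unbundle no inner_syntax

section \<open>Spectral theorem for real symmetric matrices\<close>

text \<open>The complex roots of the characteristic polynomial are eigenvalues of the complexified matrix,
  which is Hermitian, so they are real.\<close>
lemma char_poly_real_symmetric_splits:
  fixes C :: "real mat"
  assumes C: "C \<in> carrier_mat n n" and sym: "transpose_mat C = C"
  shows "\<exists>es. char_poly C = (\<Prod>e\<leftarrow>es. [:- e, 1:]) \<and> length es = n"
proof -
  define D where "D = map_mat complex_of_real C"
  have D: "D \<in> carrier_mat n n" using C by (simp add: D_def)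
  obtain as where cp: "char_poly D = (\<Prod>a\<leftarrow>as. [:- a, 1:])" and len: "length as = n"
    using char_poly_factorized[OF D] by blast
  have real: "a = complex_of_real (Re a)" if "a \<in> set as" for a
  proof -
    have "poly (char_poly D) a = 0"
      unfolding cp using that by (auto simp: poly_prod_list prod_list_zero_iff)
    then have "eigenvalue D a" using eigenvalue_root_char_poly[OF D] by simp
    then obtain z where z: "z \<in> carrier_vec n" "z \<noteq> 0\<^sub>v n" "D *\<^sub>v z = a \<cdot>\<^sub>v z"
      using D unfolding eigenvalue_def eigenvector_def by auto
    have symD: "transpose_mat D = D"
      unfolding D_def using sym by (metis map_mat_transpose)
    have conjD: "D *\<^sub>v conjugate z = conjugate (D *\<^sub>v z)"
    proof (rule eq_vecI)
      fix i assume "i < dim_vec (conjugate (D *\<^sub>v z))"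
      then have i: "i < n" using D by simp
      then show "(D *\<^sub>v conjugate z) $ i = conjugate (D *\<^sub>v z) $ i"
        using D z(1) C by (simp add: scalar_prod_def D_def cnj_sum)
    qed (use D in auto)
    have cz: "conjugate z \<in> carrier_vec n" using z by simp
    have "a * (z \<bullet> conjugate z) = (D *\<^sub>v z) \<bullet> conjugate z"
      using z cz by simp
    also have "\<dots> = z \<bullet> (D *\<^sub>v conjugate z)"
      using transpose_vec_mult_scalar[OF D cz z(1)] symD by simp
    also have "\<dots> = z \<bullet> (cnj a \<cdot>\<^sub>v conjugate z)"
      unfolding conjD z(3) using z by (simp add: conjugate_smult_vec)
    also have "\<dots> = cnj a * (z \<bullet> conjugate z)" using z cz by simp
    finally have "a = cnj a"
      using conjugate_square_eq_0_vec[OF z(1)] z(2) by auto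
    then have "Im a = - Im a" by (metis cnj.simps(2))
    then show ?thesis by (simp add: complex_eq_iff)
  qed
  define es where "es = map Re as"
  have "as = map complex_of_real es"
    unfolding es_def using real by (simp add: map_idI)
  then have "map_poly complex_of_real (char_poly C) = (\<Prod>e\<leftarrow>es. [:- complex_of_real e, 1:])"
    using cp of_real_hom.char_poly_hom[OF C, where 'a=complex] by (simp add: D_def o_def)
  also have "\<dots> = map_poly complex_of_real (\<Prod>e\<leftarrow>es. [:- e, 1:])"
  proof -
    interpret h: map_poly_comm_ring_hom complex_of_real ..
    show ?thesis by (simp add: h.hom_prod_list o_def)
  qed
  finally have "char_poly C = (\<Prod>e\<leftarrow>es. [:- e, 1:])"
    by (simp add: poly_eq_iff coeff_map_poly)
  then show ?thesis using len by (intro exI[of _ es]) (simp add: es_def)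
qed

lemma real_scalar_prod_self: "(v :: real Matrix.vec) \<bullet> v = (\<Sum>i<dim_vec v. (v $ i)\<^sup>2)"
  by (simp add: scalar_prod_def power2_eq_square lessThan_atLeast0)

text \<open>Complete v to a basis, orthogonalize by Gram-Schmidt, which keeps the first vector, and
  normalize.\<close>
lemma orthonormal_extension:
  fixes v :: "real Matrix.vec"
  assumes v: "v \<in> carrier_vec n" "v \<noteq> 0\<^sub>v n"
  shows "\<exists>W c. W \<in> carrier_mat n n \<and> transpose_mat W * W = 1\<^sub>m n \<and> col W 0 = c \<cdot>\<^sub>v v \<and> c \<noteq> 0"
proof -
  interpret cof_vec_space n "TYPE(real)" .
  define b where "b = basis_completion v"
  note b = basis_completion[OF v, folded b_def]
  define ws where "ws = gram_schmidt n b"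
  have n: "n \<noteq> 0" using v by auto
  obtain vs where bv: "b = v # vs" using b(6,7) n by (cases b) auto
  note g = gram_schmidt_result[OF b(2,4,5) refl, folded ws_def]
  have hd: "hd ws = v" using gram_schmidt_hd[OF v(1), of vs] unfolding ws_def bv .
  have len: "length ws = n" using g(4) b(6) by simp
  have wsc: "ws ! i \<in> carrier_vec n" if "i < n" for i using g(3) len that by auto
  define d where "d i = 1 / sqrt (ws ! i \<bullet> ws ! i)" for i
  define W where "W = mat_of_cols n (map (\<lambda>i. d i \<cdot>\<^sub>v ws ! i) [0..<n])"
  have W: "W \<in> carrier_mat n n" unfolding W_def using mat_of_cols_carrier(1)[of n "map (\<lambda>i. d i \<cdot>\<^sub>v ws ! i) [0..<n]"] by simp
  have colW: "col W i = d i \<cdot>\<^sub>v ws ! i" if "i < n" for i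
    unfolding W_def using that wsc by (subst col_mat_of_cols) auto
  have pos: "ws ! i \<bullet> ws ! i > 0" if "i < n" for i
  proof -
    have "ws ! i \<bullet> ws ! i \<noteq> 0"
      using corthogonalD[OF g(2), of i i] len that by simp
    moreover have "ws ! i \<bullet> ws ! i \<ge> 0" by (simp add: real_scalar_prod_self sum_nonneg)
    ultimately show ?thesis by simp
  qed
  have "transpose_mat W * W = 1\<^sub>m n"
  proof (rule eq_matI)
    fix i j assume "i < dim_row (1\<^sub>m n)" "j < dim_col (1\<^sub>m n)"
    then have i: "i < n" and j: "j < n" by auto
    have "(transpose_mat W * W) $$ (i, j) = d i * d j * (ws ! i \<bullet> ws ! j)"
      using W i j wsc[OF i] wsc[OF j] by (simp add: colW)
    also have "\<dots> = 1\<^sub>m n $$ (i, j)"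
    proof (cases "i = j")
      case True
      have "sqrt (ws ! i \<bullet> ws ! i) * sqrt (ws ! i \<bullet> ws ! i) = ws ! i \<bullet> ws ! i"
        using pos[OF i] by simp
      then show ?thesis using True pos[OF i] i by (simp add: d_def field_simps)
    next
      case False
      then have "ws ! i \<bullet> ws ! j = 0" using corthogonalD[OF g(2), of i j] len i j by simp
      then show ?thesis using False i j by simp
    qed
    finally show "(transpose_mat W * W) $$ (i, j) = 1\<^sub>m n $$ (i, j)" .
  qed (use W in auto)
  moreover have "col W 0 = d 0 \<cdot>\<^sub>v v"
    using colW[of 0] n hd len hd_conv_nth[of ws] by force
  moreover have "d 0 \<noteq> 0" using pos[of 0] n by (simp add: d_def)
  ultimately show ?thesis using W by blast
qed

lemma orthogonal_mat_right_inverse: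
  fixes W :: "real mat"
  assumes "W \<in> carrier_mat n n" "transpose_mat W * W = 1\<^sub>m n"
  shows "W * transpose_mat W = 1\<^sub>m n"
  using assms mat_mult_left_right_inverse[of "transpose_mat W" n W] by auto

text \<open>Induction on the list of eigenvalues. After an orthogonal change of basis whose first vector is
  an eigenvector, the matrix is block diagonal by symmetry, and the smaller block is a symmetric
  matrix whose characteristic polynomial has lost the first factor. The list is given in advance
  so that the eigenvectors come in the order of the list, here later the decreasing one.\<close>
lemma spectral_theorem_real_symmetric:
  fixes C :: "real mat"
  assumes "C \<in> carrier_mat n n" "transpose_mat C = C" "char_poly C = (\<Prod>e\<leftarrow>es. [:- e, 1:])"
    "length es = n"
  shows "\<exists>Q \<in> carrier_mat n n. transpose_mat Q * Q = 1\<^sub>m n \<and>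
           (\<forall>k<n. C *\<^sub>v col Q k = (es ! k) \<cdot>\<^sub>v col Q k)"
  using assms
proof (induction es arbitrary: n C)
  case Nil
  then show ?case by (intro bexI[of _ "1\<^sub>m 0"]) auto
next
  case (Cons e es n C)
  note C = Cons.prems(1) and sym = Cons.prems(2)
  obtain l where n: "n = Suc l" and l: "length es = l" using Cons.prems(4) by (cases n) auto
  have "eigenvalue C e"
    unfolding eigenvalue_root_char_poly[OF C] Cons.prems(3) by simp
  then obtain v where v: "v \<in> carrier_vec n" "v \<noteq> 0\<^sub>v n" "C *\<^sub>v v = e \<cdot>\<^sub>v v"
    using C unfolding eigenvalue_def eigenvector_def by auto
  obtain W c where W: "W \<in> carrier_mat n n" "transpose_mat W * W = 1\<^sub>m n" and W0: "col W 0 = c \<cdot>\<^sub>v v" "c \<noteq> 0"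
    using orthonormal_extension[OF v(1,2)] by blast
  note W' = orthogonal_mat_right_inverse[OF W]
  have tW: "transpose_mat W \<in> carrier_mat n n" using W by simp
  define D where "D = transpose_mat W * C * W"
  have D: "D \<in> carrier_mat n n" unfolding D_def using W C by auto
  have symD: "transpose_mat D = D"
    unfolding D_def using W C sym tW
    by (simp add: transpose_mult[of _ n n _ n] assoc_mult_mat[of _ n n _ n _ n])
  have sim: "similar_mat D C"
    unfolding similar_mat_def
    by (rule exI[of _ "transpose_mat W"], rule exI[of _ W], rule similar_mat_witI[of _ _ n])
       (use W W' C D in \<open>auto simp: D_def\<close>)
  have CW0: "C *\<^sub>v col W 0 = e \<cdot>\<^sub>v col W 0"
    unfolding W0 using v C by (simp add: mult_mat_vec[OF C v(1)] smult_smult_assoc mult.commute)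
  have col0: "D $$ (i, 0) = (if i = 0 then e else 0)" if i: "i < n" for i
  proof -
    have "D $$ (i, 0) = col W i \<bullet> (C *\<^sub>v col W 0)"
      unfolding D_def using W C i n
      by (simp add: assoc_mult_mat[of _ n n _ n _ n] col_mult2[of _ n n _ n] del: index_mult_mat_vec col_mult)
    also have "\<dots> = e * (col W i \<bullet> col W 0)"
      unfolding CW0 using W i n
      by (subst scalar_prod_smult_distrib[of _ n]) (auto intro: col_carrier_vec)
    also have "col W i \<bullet> col W 0 = (if i = 0 then 1 else 0)"
      using arg_cong[OF W(2), of "\<lambda>M. M $$ (i, 0)"] W(1) i n by simp
    finally show ?thesis by simp
  qed
  have row0: "D $$ (0, j) = (if j = 0 then e else 0)" if j: "j < n" for j
    using col0[OF j] arg_cong[OF symD, of "\<lambda>M. M $$ (j, 0)"] D j n by simp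
  define C3 where "C3 = Matrix.mat l l (\<lambda>(i, j). D $$ (Suc i, Suc j))"
  define A1 where "A1 = Matrix.mat 1 1 (\<lambda>_. e)"
  have C3: "C3 \<in> carrier_mat l l" and A1: "A1 \<in> carrier_mat 1 1" by (auto simp: C3_def A1_def)
  have block: "D = four_block_mat A1 (0\<^sub>m 1 l) (0\<^sub>m l 1) C3"
    by (rule eq_matI) (use D n col0 row0 in \<open>auto simp: A1_def C3_def\<close>)
  have symC3: "transpose_mat C3 = C3"
  proof (rule eq_matI)
    fix i j assume "i < dim_row C3" "j < dim_col C3"
    then have ij: "i < l" "j < l" using C3 by auto
    have "D $$ (Suc j, Suc i) = transpose_mat D $$ (Suc i, Suc j)" using D n ij by simp
    then show "transpose_mat C3 $$ (i, j) = C3 $$ (i, j)" using ij symD by (simp add: C3_def)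
  qed (use C3 in auto)
  have "[:- e, 1:] * char_poly C3 = char_poly D"
    unfolding block char_poly_four_block_zeros_col[OF A1 zero_carrier_mat C3]
    by (simp add: A1_def char_poly_defs det_def sign_def)
  also have "\<dots> = [:- e, 1:] * (\<Prod>e\<leftarrow>es. [:- e, 1:])"
    using char_poly_similar[OF sim] Cons.prems(3) by simp
  finally have "char_poly C3 = (\<Prod>e\<leftarrow>es. [:- e, 1:])"
    by (metis mult_cancel_left pCons_eq_0_iff zero_neq_one)
  from Cons.IH[OF C3 symC3 this l] obtain Q3 where Q3: "Q3 \<in> carrier_mat l l"
    "transpose_mat Q3 * Q3 = 1\<^sub>m l" "\<And>k. k < l \<Longrightarrow> C3 *\<^sub>v col Q3 k = es ! k \<cdot>\<^sub>v col Q3 k" by blast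
  define P where "P = four_block_mat (1\<^sub>m 1) (0\<^sub>m 1 l) (0\<^sub>m l 1) Q3"
  have P: "P \<in> carrier_mat n n" unfolding P_def n using four_block_carrier_mat[OF one_carrier_mat[of 1] Q3(1)] by simp
  have PP: "transpose_mat P * P = 1\<^sub>m n"
  proof -
    have "transpose_mat P = four_block_mat (1\<^sub>m 1) (0\<^sub>m 1 l) (0\<^sub>m l 1) (transpose_mat Q3)"
      unfolding P_def using Q3(1) by (subst transpose_four_block_mat[of _ 1 1 _ l _ l]) auto
    then have "transpose_mat P * P = four_block_mat (1\<^sub>m 1) (0\<^sub>m 1 l) (0\<^sub>m l 1) (1\<^sub>m l)"
      unfolding P_def using Q3(1,2) by (simp add: mult_four_block_mat[of _ 1 1 _ l _ l _ _ 1 _ l])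
    then show ?thesis by (simp add: n)
  qed
  have eigP: "D *\<^sub>v col P k = (e # es) ! k \<cdot>\<^sub>v col P k" if k: "k < n" for k
  proof -
    have colP: "col P k = (if k = 0 then unit_vec 1 0 @\<^sub>v 0\<^sub>v l else 0\<^sub>v 1 @\<^sub>v col Q3 (k - 1))"
      by (rule eq_vecI) (use k n Q3(1) in \<open>auto simp: P_def\<close>)
    have D_split: "D *\<^sub>v (a @\<^sub>v d) = (A1 *\<^sub>v a) @\<^sub>v (C3 *\<^sub>v d)"
      if "a \<in> carrier_vec 1" "d \<in> carrier_vec l" for a d
    proof -
      have "0\<^sub>m 1 l *\<^sub>v d = 0\<^sub>v 1" "0\<^sub>m l 1 *\<^sub>v a = 0\<^sub>v l"
        using that by (auto intro!: eq_vecI)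
      then show ?thesis
        unfolding block using that A1 C3
        by (subst four_block_mat_mult_vec[OF A1 _ _ C3 that]) auto
    qed
    show ?thesis
    proof (cases k)
      case 0
      have colk: "col P k = unit_vec 1 0 @\<^sub>v 0\<^sub>v l" using colP 0 by simp
      have "A1 *\<^sub>v unit_vec 1 0 = e \<cdot>\<^sub>v unit_vec 1 0" by (rule eq_vecI) (auto simp: A1_def)
      moreover have "C3 *\<^sub>v 0\<^sub>v l = 0\<^sub>v l" using C3 by (intro eq_vecI) auto
      ultimately have "D *\<^sub>v col P k = (e \<cdot>\<^sub>v unit_vec 1 0) @\<^sub>v 0\<^sub>v l"
        unfolding colk by (subst D_split) auto
      then show ?thesis unfolding colk by (auto intro!: eq_vecI simp: 0)
    next
      case (Suc j)
      then have j: "j < l" using k n by simp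
      have colk: "col P k = 0\<^sub>v 1 @\<^sub>v col Q3 j" using colP Suc by simp
      have "A1 *\<^sub>v 0\<^sub>v 1 = 0\<^sub>v 1" by (rule eq_vecI) (auto simp: A1_def scalar_prod_def)
      then have "D *\<^sub>v col P k = 0\<^sub>v 1 @\<^sub>v (es ! j \<cdot>\<^sub>v col Q3 j)"
        unfolding colk using Q3(1) j by (subst D_split) (auto simp: Q3(3))
      then show ?thesis unfolding colk using Q3(1) j by (auto intro!: eq_vecI simp: Suc)
    qed
  qed
  define Q where "Q = W * P"
  have Q: "Q \<in> carrier_mat n n" unfolding Q_def using W P by auto
  have "transpose_mat W * (W * P) = P"
    using assoc_mult_mat[OF tW W(1) P] P unfolding W(2) by simp
  then have QQ: "transpose_mat Q * Q = 1\<^sub>m n"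
    unfolding Q_def using W(1) P tW PP
    by (simp add: transpose_mult[of _ n n _ n] assoc_mult_mat[of _ n n _ n _ n])
  have "C *\<^sub>v col Q k = (e # es) ! k \<cdot>\<^sub>v col Q k" if k: "k < n" for k
  proof -
    have pk: "col P k \<in> carrier_vec n" using P k by auto
    have cq: "col Q k = W *\<^sub>v col P k" unfolding Q_def by (rule eq_vecI) (use W P k in auto)
    have WD: "W * D = C * W"
    proof -
      have "W * D = (W * transpose_mat W) * (C * W)"
        unfolding D_def using W C tW by (simp add: assoc_mult_mat[of _ n n _ n _ n])
      then show ?thesis unfolding W' using C W by simp
    qed
    have "C *\<^sub>v col Q k = (C * W) *\<^sub>v col P k" unfolding cq using C W pk by simp
    also have "\<dots> = W *\<^sub>v (D *\<^sub>v col P k)" unfolding WD[symmetric] using W D pk by simp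
    also have "\<dots> = (e # es) ! k \<cdot>\<^sub>v col Q k"
      unfolding eigP[OF k] cq using W pk by (simp add: mult_mat_vec[of _ n n])
    finally show ?thesis .
  qed
  then show ?case using Q QQ by blast
qed

text \<open>The factorization determines the multiset of the roots, hence the sorted list; this makes the
  definite description in \<open>sorted_eigenvalues\<close> meaningful.\<close>
lemma sorted_eigenvalues_real_symmetric:
  fixes C :: "real mat"
  assumes C: "C \<in> carrier_mat n n" "transpose_mat C = C"
  shows "char_poly C = (\<Prod>e\<leftarrow>sorted_eigenvalues C. [:- e, 1:])" "length (sorted_eigenvalues C) = n"
proof -
  obtain es where es: "char_poly C = (\<Prod>e\<leftarrow>es. [:- e, 1:])" "length es = n"
    using char_poly_real_symmetric_splits[OF C] by blast
  define fs where "fs = rev (sort es)"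
  have mset_eq: "mset gs = mset es" if "char_poly C = (\<Prod>e\<leftarrow>gs. [:- e, 1:])" for gs
  proof -
    have "proots (\<Prod>e\<leftarrow>gs. [:- e, 1:]) = mset gs" for gs :: "real list"
    proof (induction gs)
      case (Cons g gs)
      have "(\<Prod>e\<leftarrow>gs. [:- e, 1:]) \<noteq> (0 :: real poly)" by (auto simp: prod_list_zero_iff)
      then have "proots ([:- g, 1:] * (\<Prod>e\<leftarrow>gs. [:- e, 1:])) = proots [:- g, 1:] + mset gs"
        using Cons by (subst proots_mult) auto
      then show ?case by (simp add: proots_linear_factor del: mult_pCons_left)
    qed simp
    then show ?thesis using that es(1) by metis
  qed
  have prod_fs: "(\<Prod>e\<leftarrow>fs. [:- e, 1:]) = (\<Prod>e\<leftarrow>es. [:- e, 1:])"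
    by (simp add: fs_def prod_mset_prod_list[symmetric] flip: mset_map) (simp)
  have "sorted_eigenvalues C = fs"
    unfolding sorted_eigenvalues_def
  proof (rule the_equality)
    show "sorted (rev fs) \<and> char_poly C = (\<Prod>e\<leftarrow>fs. [:- e, 1:])"
      using prod_fs es by (simp add: fs_def)
  next
    fix gs assume gs: "sorted (rev gs) \<and> char_poly C = (\<Prod>e\<leftarrow>gs. [:- e, 1:])"
    then have "mset (rev gs) = mset es" using mset_eq by auto
    then have "rev gs = sort es" using gs by (metis properties_for_sort)
    then show "gs = fs" unfolding fs_def by (metis rev_rev_ident)
  qed
  then show "char_poly C = (\<Prod>e\<leftarrow>sorted_eigenvalues C. [:- e, 1:])" "length (sorted_eigenvalues C) = n"
    using es prod_fs by (auto simp: fs_def)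
qed

section \<open>Orthogonal projections, eigenvalue tails and Gram-Schmidt\<close>

definition vnorm :: "real Matrix.vec \<Rightarrow> real" where
  "vnorm v = sqrt (v \<bullet> v)"

lemma vnorm_L2_set: "vnorm v = L2_set (\<lambda>i. v $ i) {..<dim_vec v}"
  by (simp add: vnorm_def L2_set_def real_scalar_prod_self)

lemma vnorm_nonneg [simp]: "0 \<le> vnorm v"
  unfolding vnorm_L2_set by (rule L2_set_nonneg)

lemma vnorm_square: "(vnorm v)\<^sup>2 = v \<bullet> v"
  unfolding vnorm_def real_scalar_prod_self by (rule real_sqrt_pow2) (simp add: sum_nonneg)

lemma vnorm_zero [simp]: "vnorm (0\<^sub>v n) = 0"
  unfolding vnorm_L2_set by (simp add: L2_set_def)

lemma vnorm_smult: "vnorm (c \<cdot>\<^sub>v v) = \<bar>c\<bar> * vnorm v"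
  by (simp add: vnorm_def real_scalar_prod_self power_mult_distrib real_sqrt_mult
      flip: sum_distrib_left)

lemma vnorm_triangle:
  assumes "v \<in> carrier_vec n" "w \<in> carrier_vec n"
  shows "vnorm (v + w) \<le> vnorm v + vnorm w"
proof -
  have "vnorm (v + w) = L2_set (\<lambda>i. v $ i + w $ i) {..<n}"
    unfolding vnorm_L2_set using assms by (intro L2_set_cong) auto
  also have "\<dots> \<le> vnorm v + vnorm w"
    using L2_set_triangle_ineq[of "\<lambda>i. v $ i" "\<lambda>i. w $ i" "{..<n}"] assms by (simp add: vnorm_L2_set)
  finally show ?thesis .
qed

lemma vnorm_uminus: "vnorm (- v) = vnorm v"
  by (simp add: vnorm_def real_scalar_prod_self)

lemma vnorm_diff_triangle:
  assumes "v \<in> carrier_vec n" "w \<in> carrier_vec n"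
  shows "vnorm (v - w) \<le> vnorm v + vnorm w"
proof -
  have "v - w = v + - w" using assms by auto
  then show ?thesis using vnorm_triangle[of v n "- w"] assms by (simp add: vnorm_uminus)
qed

lemma vnorm_mult_isometry:
  fixes W :: "real mat"
  assumes W: "W \<in> carrier_mat n k" "transpose_mat W * W = 1\<^sub>m k" and c: "c \<in> carrier_vec k"
  shows "vnorm (W *\<^sub>v c) = vnorm c"
proof -
  have tW: "transpose_mat W \<in> carrier_mat k n" using W by simp
  have Wc: "W *\<^sub>v c \<in> carrier_vec n" using W c by simp
  have "(W *\<^sub>v c) \<bullet> (W *\<^sub>v c) = (transpose_mat W *\<^sub>v (W *\<^sub>v c)) \<bullet> c"
    using transpose_vec_mult_scalar[OF W(1) c Wc] by simp
  also have "transpose_mat W *\<^sub>v (W *\<^sub>v c) = (transpose_mat W * W) *\<^sub>v c"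
    using assoc_mult_mat_vec[OF tW W(1) c] by simp
  also have "\<dots> = c" unfolding W(2) using c by simp
  finally show ?thesis by (simp add: vnorm_def)
qed

text \<open>Pythagoras for the orthogonal projection \<open>W W\<^sup>T\<close>.\<close>
lemma vnorm_residual:
  fixes W :: "real mat"
  assumes W: "W \<in> carrier_mat n k" "transpose_mat W * W = 1\<^sub>m k" and w: "w \<in> carrier_vec n"
  shows "(vnorm (w - W *\<^sub>v (transpose_mat W *\<^sub>v w)))\<^sup>2 = (vnorm w)\<^sup>2 - (vnorm (transpose_mat W *\<^sub>v w))\<^sup>2"
proof -
  define c where "c = transpose_mat W *\<^sub>v w"
  have c: "c \<in> carrier_vec k" using W w by (simp add: c_def)
  define p where "p = W *\<^sub>v c"
  have p: "p \<in> carrier_vec n" using W c by (simp add: p_def)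
  have 1: "w \<bullet> p = c \<bullet> c"
    unfolding p_def c_def using transpose_vec_mult_scalar[OF W(1) _ w, of c] W w by (simp add: c_def)
  have 2: "p \<bullet> p = c \<bullet> c"
    using vnorm_mult_isometry[OF W c] vnorm_square by (metis p_def)
  have "(w - p) \<bullet> (w - p) = w \<bullet> w - w \<bullet> p - (p \<bullet> w - p \<bullet> p)"
    using w p by (simp add: minus_scalar_prod_distrib[of _ n] scalar_prod_minus_distrib[of _ n])
  also have "p \<bullet> w = w \<bullet> p" using comm_scalar_prod w p by blast
  finally show ?thesis unfolding vnorm_square p_def[symmetric] c_def[symmetric] using 1 2 by simp
qed

lemma vnorm_projection_le:
  fixes W :: "real mat"
  assumes "W \<in> carrier_mat n k" "transpose_mat W * W = 1\<^sub>m k" "w \<in> carrier_vec n"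
  shows "vnorm (transpose_mat W *\<^sub>v w) \<le> vnorm w"
    and "vnorm (w - W *\<^sub>v (transpose_mat W *\<^sub>v w)) \<le> vnorm w"
proof -
  have "(vnorm (transpose_mat W *\<^sub>v w))\<^sup>2 \<le> (vnorm w)\<^sup>2"
    using vnorm_residual[OF assms] zero_le_power2[of "vnorm (w - W *\<^sub>v (transpose_mat W *\<^sub>v w))"]
    by linarith
  then show "vnorm (transpose_mat W *\<^sub>v w) \<le> vnorm w" by (rule power2_le_imp_le) simp
  have "(vnorm (w - W *\<^sub>v (transpose_mat W *\<^sub>v w)))\<^sup>2 \<le> (vnorm w)\<^sup>2"
    using vnorm_residual[OF assms] zero_le_power2[of "vnorm (transpose_mat W *\<^sub>v w)"]
    by linarith
  then show "vnorm (w - W *\<^sub>v (transpose_mat W *\<^sub>v w)) \<le> vnorm w" by (rule power2_le_imp_le) simp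
qed

lemma scalar_prod_gram:
  fixes w :: "nat \<Rightarrow> real Matrix.vec" and \<kappa> :: real
  assumes w: "\<And>j. j < N \<Longrightarrow> w j \<in> carrier_vec n" and q: "q \<in> carrier_vec n"
  defines "C \<equiv> Matrix.mat n n (\<lambda>(i, k). \<kappa> * (\<Sum>j<N. w j $ i * w j $ k))"
  shows "q \<bullet> (C *\<^sub>v q) = \<kappa> * (\<Sum>j<N. (q \<bullet> w j)\<^sup>2)"
proof -
  have "q \<bullet> (C *\<^sub>v q) = (\<Sum>i<n. q $ i * (\<Sum>k<n. \<kappa> * (\<Sum>j<N. w j $ i * w j $ k) * q $ k))"
    using q by (simp add: scalar_prod_def C_def lessThan_atLeast0)
  also have "\<dots> = (\<Sum>i<n. \<Sum>k<n. \<Sum>j<N. \<kappa> * ((q $ i * w j $ i) * (q $ k * w j $ k)))"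
    by (simp add: sum_distrib_left sum_distrib_right mult_ac)
  also have "\<dots> = (\<Sum>i<n. \<Sum>j<N. \<Sum>k<n. \<kappa> * ((q $ i * w j $ i) * (q $ k * w j $ k)))"
    by (intro sum.cong refl sum.swap)
  also have "\<dots> = (\<Sum>j<N. \<Sum>i<n. \<Sum>k<n. \<kappa> * ((q $ i * w j $ i) * (q $ k * w j $ k)))"
    by (rule sum.swap)
  also have "\<dots> = (\<Sum>j<N. \<kappa> * ((\<Sum>i<n. q $ i * w j $ i) * (\<Sum>k<n. q $ k * w j $ k)))"
    unfolding sum_product by (simp only: sum_distrib_left)
  also have "\<dots> = (\<Sum>j<N. \<kappa> * (q \<bullet> w j)\<^sup>2)"
    using carrier_vecD[OF w]
    by (intro sum.cong refl) (simp add: scalar_prod_def power2_eq_square lessThan_atLeast0)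
  finally show ?thesis by (simp add: sum_distrib_left)
qed

text \<open>Take the first k eigenvectors of the Gram matrix C as columns of W. The squared residual of a
  vector is the sum of its squared coefficients along the remaining eigenvectors q, and
  \<open>q \<bullet> C q\<close> is the weighted sum over j of the squared coefficients of \<open>w j\<close> along q. Unit vectors
  have entries in \<open>[-1,1]\<close>, so W is admissible in the minimization that defines the optimal DOD.\<close>
lemma gram_eigenvalue_tail:
  fixes w :: "nat \<Rightarrow> real Matrix.vec" and \<kappa> :: real
  assumes w: "\<And>j. j < N \<Longrightarrow> w j \<in> carrier_vec n" and k: "k \<le> n"
  defines "C \<equiv> Matrix.mat n n (\<lambda>(i, k). \<kappa> * (\<Sum>j<N. w j $ i * w j $ k))"
  shows "\<exists>W \<in> unit_box n k. transpose_mat W * W = 1\<^sub>m k \<and>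
     \<kappa> * (\<Sum>j<N. (vnorm (w j - W *\<^sub>v (transpose_mat W *\<^sub>v w j)))\<^sup>2)
       = sum_list (drop k (sorted_eigenvalues C))"
proof -
  have C: "C \<in> carrier_mat n n" "transpose_mat C = C"
    unfolding C_def by (auto intro!: eq_matI simp: mult.commute)
  define es where "es = sorted_eigenvalues C"
  note es = sorted_eigenvalues_real_symmetric[OF C, folded es_def]
  obtain Q where Q: "Q \<in> carrier_mat n n" "transpose_mat Q * Q = 1\<^sub>m n"
    and ev: "\<And>l. l < n \<Longrightarrow> C *\<^sub>v col Q l = es ! l \<cdot>\<^sub>v col Q l"
    using spectral_theorem_real_symmetric[OF C es] by blast
  have qc: "col Q l \<in> carrier_vec n" if "l < n" for l using Q that by auto
  have QQ: "col Q i \<bullet> col Q j = (if i = j then 1 else 0)" if "i < n" "j < n" for i j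
    using arg_cong[OF Q(2), of "\<lambda>M. M $$ (i, j)"] Q(1) that by simp
  have eq: "\<kappa> * (\<Sum>j<N. (col Q l \<bullet> w j)\<^sup>2) = es ! l" if l: "l < n" for l
  proof -
    have "\<kappa> * (\<Sum>j<N. (col Q l \<bullet> w j)\<^sup>2) = col Q l \<bullet> (C *\<^sub>v col Q l)"
      unfolding C_def by (rule scalar_prod_gram[symmetric]) (use w qc[OF l] in auto)
    also have "\<dots> = es ! l * (col Q l \<bullet> col Q l)" unfolding ev[OF l] using qc[OF l] by simp
    finally show ?thesis using QQ[OF l l] by simp
  qed
  define W where "W = Matrix.mat n k (\<lambda>(i, j). Q $$ (i, j))"
  have W: "W \<in> carrier_mat n k" by (simp add: W_def)
  have colW: "col W j = col Q j" if "j < k" for j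
    using that k Q by (auto simp: W_def intro!: eq_vecI)
  have WW: "transpose_mat W * W = 1\<^sub>m k"
    by (rule eq_matI) (use W k QQ in \<open>auto simp: colW\<close>)
  have tail: "(vnorm (v - W *\<^sub>v (transpose_mat W *\<^sub>v v)))\<^sup>2 = (\<Sum>l=k..<n. (col Q l \<bullet> v)\<^sup>2)"
    if v: "v \<in> carrier_vec n" for v
  proof -
    have tQ: "transpose_mat Q \<in> carrier_mat n n" using Q by simp
    have "v = (Q * transpose_mat Q) *\<^sub>v v" using orthogonal_mat_right_inverse[OF Q] v by simp
    then have "vnorm v = vnorm (transpose_mat Q *\<^sub>v v)"
      using vnorm_mult_isometry[OF Q, of "transpose_mat Q *\<^sub>v v"] Q(1) v by simp
    then have "(vnorm v)\<^sup>2 = (transpose_mat Q *\<^sub>v v) \<bullet> (transpose_mat Q *\<^sub>v v)"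
      by (simp only: vnorm_square)
    also have "\<dots> = (\<Sum>l<n. (col Q l \<bullet> v)\<^sup>2)"
      unfolding real_scalar_prod_self using Q(1) by simp
    also have "\<dots> = (\<Sum>l<k. (col Q l \<bullet> v)\<^sup>2) + (\<Sum>l=k..<n. (col Q l \<bullet> v)\<^sup>2)"
      using k by (simp add: lessThan_atLeast0 sum.atLeastLessThan_concat)
    also have "(\<Sum>l<k. (col Q l \<bullet> v)\<^sup>2) = (vnorm (transpose_mat W *\<^sub>v v))\<^sup>2"
      using W unfolding vnorm_square by (simp add: real_scalar_prod_self colW)
    finally show ?thesis using vnorm_residual[OF W WW v] by simp
  qed
  have "\<kappa> * (\<Sum>j<N. (vnorm (w j - W *\<^sub>v (transpose_mat W *\<^sub>v w j)))\<^sup>2)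
      = \<kappa> * (\<Sum>j<N. \<Sum>l=k..<n. (col Q l \<bullet> w j)\<^sup>2)"
    using w by (simp add: tail)
  also have "\<dots> = (\<Sum>l=k..<n. \<kappa> * (\<Sum>j<N. (col Q l \<bullet> w j)\<^sup>2))"
    unfolding sum_distrib_left by (rule sum.swap)
  also have "\<dots> = (\<Sum>l=k..<n. es ! l)" by (intro sum.cong) (auto simp: eq)
  also have "\<dots> = (\<Sum>l<n - k. es ! (k + l))"
    by (rule sum.reindex_bij_witness[of _ "\<lambda>l. k + l" "\<lambda>l. l - k"]) (use k in auto)
  also have "\<dots> = sum_list (drop k es)"
    using es(2) by (simp add: sum_list_sum_nth lessThan_atLeast0)
  finally have sum: "\<kappa> * (\<Sum>j<N. (vnorm (w j - W *\<^sub>v (transpose_mat W *\<^sub>v w j)))\<^sup>2)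
      = sum_list (drop k es)" .
  have "W \<in> unit_box n k"
  proof -
    have "\<bar>W $$ (i, j)\<bar> \<le> 1" if ij: "i < n" "j < k" for i j
    proof -
      have "(col Q j $ i)\<^sup>2 \<le> (\<Sum>i<n. (col Q j $ i)\<^sup>2)"
        by (rule member_le_sum) (use ij in auto)
      also have "\<dots> = 1"
        using QQ[of j j] ij k Q(1) by (simp add: real_scalar_prod_self)
      finally have "\<bar>col Q j $ i\<bar> \<le> 1" by (simp add: abs_square_le_1)
      then show ?thesis using ij k Q(1) by (simp add: W_def)
    qed
    then show ?thesis using W by (force simp: unit_box_def abs_le_iff)
  qed
  then show ?thesis using WW sum es_def by blast
qed

text \<open>Orthogonality to the accumulated vectors makes every correction vanish; zero vectors are allowed
  because division by zero yields zero.\<close>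
lemma gram_schmidt_sub2_orthogonal:
  fixes ws us :: "real Matrix.vec list"
  assumes "set ws \<subseteq> carrier_vec n" "set us \<subseteq> carrier_vec n"
    and "\<And>w u. w \<in> set ws \<Longrightarrow> u \<in> set us \<Longrightarrow> w \<bullet> u = 0"
    and "\<And>i j. i < length ws \<Longrightarrow> j < i \<Longrightarrow> ws ! i \<bullet> ws ! j = 0"
  shows "gram_schmidt_sub2 n us ws = ws"
  using assms
proof (induction ws arbitrary: us)
  case (Cons w ws)
  have "adjuster n w us = 0\<^sub>v n"
    using Cons.prems(2,3)
  proof (induction us)
    case (Cons u us)
    then have "w \<bullet> u = 0" "adjuster n w us = 0\<^sub>v n" by auto
    then show ?case using Cons.prems(1) by (auto intro!: eq_vecI)
  qed simp
  then have w: "adjuster n w us + w = w" using Cons.prems(1) by simp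
  have "gram_schmidt_sub2 n (w # us) ws = ws"
  proof (rule Cons.IH)
    fix v u assume v: "v \<in> set ws" and u: "u \<in> set (w # us)"
    show "v \<bullet> u = 0"
    proof (cases "u = w")
      case True
      obtain i where "i < length ws" "v = ws ! i" using v by (metis in_set_conv_nth)
      then show ?thesis using Cons.prems(4)[of "Suc i" 0] True by simp
    qed (use Cons.prems(3) u v in auto)
  next
    fix i j assume "i < length ws" "j < i"
    then show "ws ! i \<bullet> ws ! j = 0" using Cons.prems(4)[of "Suc i" "Suc j"] by simp
  qed (use Cons.prems in auto)
  then show ?case by (simp add: Let_def w)
qed simp

lemma ORTH_orthogonal_cols:
  fixes W :: "real mat"
  assumes W: "W \<in> carrier_mat n k" and orth: "\<And>i j. i < k \<Longrightarrow> j < i \<Longrightarrow> col W i \<bullet> col W j = 0"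
  shows "ORTH W = Matrix.mat n k (\<lambda>(i, j). W $$ (i, j) / vnorm (col W j))"
proof -
  have gs: "gram_schmidt (dim_row W) (cols W) = cols W"
    unfolding gram_schmidt_code
    by (rule gram_schmidt_sub2_orthogonal) (use W orth in \<open>auto simp: cols_def\<close>)
  show ?thesis
    unfolding ORTH_def gs
    by (rule eq_matI) (use W in \<open>auto simp: mat_of_cols_index vnorm_def\<close>)
qed

section \<open>ReLU networks with bump functions as seeds\<close>

text \<open>The inserted layer carries \<open>\<rho>(y)\<close> and \<open>\<rho>(-y)\<close>, whose difference is the output y of the first
  network. Only the case of a single linear layer on top is treated: it suffices for roots that
  are linear combinations of the seed's outputs.\<close>
lemma realize_concat_linear:
  assumes "well_shaped d l \<Phi>" "B \<in> carrier_mat n l" "c \<in> carrier_vec n" "z \<in> carrier_vec d"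
  shows "realize (net_concat [(B, c)] \<Phi>) z = B *\<^sub>v realize \<Phi> z + c"
  using assms
proof (induction d l \<Phi> arbitrary: z rule: well_shaped.induct)
  case (2 d l A b)
  then have A: "A \<in> carrier_mat l d" and b: "b \<in> carrier_vec l" by auto
  define y where "y = A *\<^sub>v z + b"
  have y: "y \<in> carrier_vec l" using A b 2 by (simp add: y_def)
  define A2 where "A2 = Matrix.mat (2 * l) d (\<lambda>(i, j). if i < l then A $$ (i, j) else - A $$ (i - l, j))"
  define b2 where "b2 = Matrix.vec (2 * l) (\<lambda>i. if i < l then b $ i else - b $ (i - l))"
  define B2 where "B2 = Matrix.mat n (d + l + l) (\<lambda>(i, j).
           if j < d then 0
           else if j < d + l then B $$ (i, j - d)
           else if j < d + 2 * l then - B $$ (i, j - d - l)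
           else B $$ (i, j - d - l))"
  have concat: "net_concat [(B, c)] [(A, b)] = [(A2, b2), (B2, c)]"
  proof -
    note dims = carrier_matD[OF A] carrier_matD[OF 2(2)]
    show ?thesis
      by (simp add: concatenate_def Let_def A2_def b2_def B2_def dims, unfold dims, simp)
  qed
  define h where "h = map_vec (max 0) (A2 *\<^sub>v z + b2)"
  have h: "h = map_vec (max 0) y @\<^sub>v map_vec (max 0) (- y)"
    unfolding h_def
  proof (rule eq_vecI)
    fix i assume "i < dim_vec (map_vec (max 0) y @\<^sub>v map_vec (max 0) (- y))"
    then have i: "i < 2 * l" using y by simp
    show "map_vec (max 0) (A2 *\<^sub>v z + b2) $ i = (map_vec (max 0) y @\<^sub>v map_vec (max 0) (- y)) $ i"
      using i A b 2 by (auto simp: A2_def b2_def y_def scalar_prod_def sum_negf)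
  qed (use y in \<open>auto simp: A2_def b2_def\<close>)
  have yd: "dim_vec y = l" using y by simp
  have h_pos: "h $ j = max 0 (y $ j)" and h_neg: "h $ (l + j) = max 0 (- y $ j)" if "j < l" for j
    unfolding h using that by (simp_all add: yd)
  have zd: "dim_vec z = d" and hd: "dim_vec h = l + l" unfolding h using 2(4) by (simp_all add: yd)
  have "B2 *\<^sub>v (z @\<^sub>v h) = B *\<^sub>v y"
  proof (rule eq_vecI)
    fix i assume "i < dim_vec (B *\<^sub>v y)"
    then have i: "i < n" using 2 by simp
    have dim: "dim_vec (z @\<^sub>v h) = d + l + l" using 2 y h by simp
    have "(B2 *\<^sub>v (z @\<^sub>v h)) $ i = (\<Sum>j=0..<d + l + l. B2 $$ (i, j) * (z @\<^sub>v h) $ j)"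
      using i dim by (simp add: B2_def scalar_prod_def)
    also have "\<dots> = (\<Sum>j=0..<d. B2 $$ (i, j) * (z @\<^sub>v h) $ j)
        + ((\<Sum>j=d..<d + l. B2 $$ (i, j) * (z @\<^sub>v h) $ j)
        + (\<Sum>j=d + l..<d + l + l. B2 $$ (i, j) * (z @\<^sub>v h) $ j))"
      by (simp add: sum.atLeastLessThan_concat)
    also have "(\<Sum>j=0..<d. B2 $$ (i, j) * (z @\<^sub>v h) $ j) = 0"
      using i by (intro sum.neutral) (auto simp: B2_def)
    also have "(\<Sum>j=d..<d + l. B2 $$ (i, j) * (z @\<^sub>v h) $ j) = (\<Sum>j=0..<l. B $$ (i, j) * max 0 (y $ j))"
    proof (rule sum.reindex_bij_witness[of _ "\<lambda>j. d + j" "\<lambda>j. j - d"])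
      fix j assume j: "j \<in> {d..<d + l}"
      then show "B $$ (i, j - d) * max 0 (y $ (j - d)) = B2 $$ (i, j) * (z @\<^sub>v h) $ j"
        using i h_pos[of "j - d"] less_diff_conv2[of d j l] by (simp add: B2_def zd hd add.commute)
    qed auto
    also have "(\<Sum>j=d + l..<d + l + l. B2 $$ (i, j) * (z @\<^sub>v h) $ j)
        = (\<Sum>j=0..<l. - B $$ (i, j) * max 0 (- y $ j))"
    proof (rule sum.reindex_bij_witness[of _ "\<lambda>j. d + l + j" "\<lambda>j. j - (d + l)"])
      fix j assume j: "j \<in> {d + l..<d + l + l}"
      then have "h $ (j - d) = max 0 (- y $ (j - (d + l)))" using h_neg[of "j - (d + l)"] less_diff_conv2[of "d + l" j l] by (simp add: add.commute)
      moreover have "j - d - l = j - (d + l)" by simp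
      ultimately show "- B $$ (i, j - (d + l)) * max 0 (- y $ (j - (d + l))) = B2 $$ (i, j) * (z @\<^sub>v h) $ j"
        using i j by (simp add: B2_def zd hd)
    qed auto
    also have "0 + ((\<Sum>j=0..<l. B $$ (i, j) * max 0 (y $ j)) + (\<Sum>j=0..<l. - B $$ (i, j) * max 0 (- y $ j)))
        = (\<Sum>j=0..<l. B $$ (i, j) * y $ j)"
      by (simp add: sum.distrib[symmetric] max_def algebra_simps) (auto intro!: sum.cong)
    finally show "(B2 *\<^sub>v (z @\<^sub>v h)) $ i = (B *\<^sub>v y) $ i"
      using i 2 y by (simp add: scalar_prod_def)
  qed (use 2 in \<open>auto simp: B2_def\<close>)
  then show ?case unfolding concat by (simp add: h_def y_def)
next
  case (3 d l A b L Ls)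
  obtain A' b' where L: "L = (A', b')" by (cases L)
  have "net_concat [(B, c)] ((A, b) # L # Ls) = (A, b) # net_concat [(B, c)] (L # Ls)"
    by (simp add: concatenate_def Let_def)
  moreover obtain L' Ls' where "net_concat [(B, c)] (L # Ls) = L' # Ls'"
    by (cases "net_concat [(B, c)] (L # Ls)") (auto simp: concatenate_def Let_def)
  ultimately have "realize (net_concat [(B, c)] ((A, b) # L # Ls)) z
      = realize (net_concat [(B, c)] (L # Ls)) (z @\<^sub>v map_vec (max 0) (A *\<^sub>v z + b))"
    by simp
  also have "\<dots> = B *\<^sub>v realize (L # Ls) (z @\<^sub>v map_vec (max 0) (A *\<^sub>v z + b)) + c"
  proof (rule 3(1))
    show "well_shaped (d + dim_row A) l (L # Ls)" using 3(2) by simp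
    have "dim_vec z = d" "dim_vec b = dim_row A" using 3(2,5) by auto
    then show "z @\<^sub>v map_vec (max 0) (A *\<^sub>v z + b) \<in> carrier_vec (d + dim_row A)"
      by (intro carrier_vecI) simp
  qed (use 3(3,4) in auto)
  finally show ?case by simp
qed auto

text \<open>The trapezoidal bump of the box with lower corner \<open>lo\<close> and upper corner \<open>hi\<close>: it equals 1 on the
  box and decreases with slope \<sigma> in the \<open>\<ell>\<^sup>1\<close>-distance to the box.\<close>
definition hat :: "nat \<Rightarrow> real \<Rightarrow> (nat \<Rightarrow> real) \<Rightarrow> (nat \<Rightarrow> real) \<Rightarrow> (nat \<Rightarrow> real) \<Rightarrow> real" where
  "hat d \<sigma> lo hi x = max 0 (1 - \<sigma> * (\<Sum>i<d. max 0 (lo i - x i) + max 0 (x i - hi i)))"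

text \<open>Two hidden layers and a linear layer that passes the bumps on. Box g owns the block of 2d
  neurons of the first layer that starts at \<open>2 d g\<close>: first \<open>\<rho>(lo i - x i)\<close> for all i, then
  \<open>\<rho>(x i - hi i)\<close>, so neuron r reads coordinate \<open>r mod d\<close>. The second layer sums the block of each
  box.\<close>
definition seed_net :: "nat \<Rightarrow> nat \<Rightarrow> real \<Rightarrow> (nat \<Rightarrow> nat \<Rightarrow> real) \<Rightarrow> (nat \<Rightarrow> nat \<Rightarrow> real) \<Rightarrow> network" where
  "seed_net d K \<sigma> lo hi =
     [(Matrix.mat (2 * d * K) d (\<lambda>(r, j).
         if j = r mod d then (if r mod (2 * d) < d then - 1 else 1) else 0),
       Matrix.vec (2 * d * K) (\<lambda>r.
         if r mod (2 * d) < d then lo (r div (2 * d)) (r mod d) else - hi (r div (2 * d)) (r mod d))),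
      (Matrix.mat K (d + 2 * d * K) (\<lambda>(g, c). if d \<le> c \<and> (c - d) div (2 * d) = g then - \<sigma> else 0),
       Matrix.vec K (\<lambda>_. 1)),
      (Matrix.mat K (d + 2 * d * K + K) (\<lambda>(g, c). if c = d + 2 * d * K + g then 1 else 0), 0\<^sub>v K)]"

text \<open>The first layer is dense, which costs a factor d only. The second layer has to be sparse: each of
  its columns is used by at most one box, so that the number of weights stays linear in K.\<close>
definition seed_arch :: "nat \<Rightarrow> nat \<Rightarrow> architecture" where
  "seed_arch d K =
     [(Matrix.mat (2 * d * K) d (\<lambda>_. True), Matrix.vec (2 * d * K) (\<lambda>_. True)),
      (Matrix.mat K (d + 2 * d * K) (\<lambda>(g, c). d \<le> c \<and> (c - d) div (2 * d) = g), Matrix.vec K (\<lambda>_. True)),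
      (Matrix.mat K (d + 2 * d * K + K) (\<lambda>(g, c). c = d + 2 * d * K + g), Matrix.vec K (\<lambda>_. False))]"

text \<open>Column g of the output matrix is the value that is attained where bump g is 1.\<close>
definition root_net :: "nat \<Rightarrow> nat \<Rightarrow> (nat \<Rightarrow> real Matrix.vec) \<Rightarrow> network" where
  "root_net K n V = [(Matrix.mat n K (\<lambda>(r, g). V g $ r), 0\<^sub>v n)]"

definition root_arch :: "nat \<Rightarrow> nat \<Rightarrow> architecture" where
  "root_arch K n = [(Matrix.mat n K (\<lambda>_. True), Matrix.vec n (\<lambda>_. False))]"

lemma fits_seed: "fits (seed_arch d K) (seed_net d K \<sigma> lo hi)"
  by (auto simp: fits_def seed_arch_def seed_net_def)

lemma fits_root: "fits (root_arch K n) (root_net K n V)"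
  by (auto simp: fits_def root_arch_def root_net_def)

lemma fits_concat_root_seed:
  "fits (arch_concat (root_arch K n) (seed_arch d K)) (net_concat (root_net K n V) (seed_net d K \<sigma> lo hi))"
  by (auto simp: fits_def concatenate_def Let_def seed_arch_def seed_net_def root_arch_def root_net_def)

lemma well_shaped_seed_arch: "well_shaped d K (seed_arch d K)"
  by (simp add: seed_arch_def)

lemma well_shaped_seed_net: "well_shaped d K (seed_net d K \<sigma> lo hi)"
  by (simp add: seed_net_def)

lemma well_shaped_root_arch: "well_shaped K n (root_arch K n)"
  by (simp add: root_arch_def)

lemma well_shaped_concat_root_seed: "well_shaped d n (arch_concat (root_arch K n) (seed_arch d K))"
  by (simp add: concatenate_def Let_def seed_arch_def root_arch_def)

lemma length_concat_root_seed: "length (arch_concat (root_arch K n) (seed_arch d K)) = 4"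
  by (simp add: concatenate_def Let_def seed_arch_def root_arch_def)

lemma realize_seed_net:
  assumes d: "0 < d" and z: "z \<in> carrier_vec d"
  shows "realize (seed_net d K \<sigma> lo hi) z = Matrix.vec K (\<lambda>g. hat d \<sigma> (lo g) (hi g) (\<lambda>i. z $ i))"
proof -
  define h1 where "h1 = Matrix.vec (2 * d * K) (\<lambda>r. max 0 (if r mod (2 * d) < d
     then lo (r div (2 * d)) (r mod d) - z $ (r mod d) else z $ (r mod d) - hi (r div (2 * d)) (r mod d)))"
  define h2 where "h2 = Matrix.vec K (\<lambda>g. hat d \<sigma> (lo g) (hi g) (\<lambda>i. z $ i))"
  note net = seed_net_def[of d K \<sigma> lo hi]
  define A1 b1 where "A1 = fst (seed_net d K \<sigma> lo hi ! 0)" and "b1 = snd (seed_net d K \<sigma> lo hi ! 0)"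
  define A2 b2 where "A2 = fst (seed_net d K \<sigma> lo hi ! 1)" and "b2 = snd (seed_net d K \<sigma> lo hi ! 1)"
  define A3 where "A3 = fst (seed_net d K \<sigma> lo hi ! 2)"
  have split: "seed_net d K \<sigma> lo hi = [(A1, b1), (A2, b2), (A3, 0\<^sub>v K)]"
    unfolding A1_def A2_def A3_def b1_def b2_def net by simp
  have l1: "map_vec (max 0) (A1 *\<^sub>v z + b1) = h1"
  proof (rule eq_vecI)
    fix r assume "r < dim_vec h1"
    then have r: "r < 2 * d * K" by (simp add: h1_def)
    have "Matrix.row A1 r \<bullet> z = (\<Sum>j=0..<d. A1 $$ (r, j) * z $ j)"
      using r z by (simp add: A1_def net scalar_prod_def)
    also have "\<dots> = (\<Sum>j=0..<d. if j = r mod d then (if r mod (2 * d) < d then - 1 else 1) * z $ j else 0)"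
      using r by (intro sum.cong) (auto simp: A1_def net)
    also have "\<dots> = (if r mod (2 * d) < d then - 1 else 1) * z $ (r mod d)"
      using d by (simp add: sum.delta)
    finally show "map_vec (max 0) (A1 *\<^sub>v z + b1) $ r = h1 $ r"
      using r by (simp add: h1_def A1_def b1_def net)
  qed (simp add: b1_def net h1_def)
  have l2: "map_vec (max 0) (A2 *\<^sub>v (z @\<^sub>v h1) + b2) = h2"
  proof (rule eq_vecI)
    fix g assume "g < dim_vec h2"
    then have g: "g < K" by (simp add: h2_def)
    have dim: "dim_vec (z @\<^sub>v h1) = d + 2 * d * K" using z by (simp add: h1_def)
    have pos: "2 * d * g + c < 2 * d * K" if "c < 2 * d" for c
    proof -
      have "2 * d * g + c < 2 * d * (g + 1)" using that by simp
      also have "\<dots> \<le> 2 * d * K" using g by (intro mult_le_mono) auto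
      finally show ?thesis .
    qed
    have "Matrix.row A2 g \<bullet> (z @\<^sub>v h1) = (\<Sum>c=0..<d + 2 * d * K. A2 $$ (g, c) * (z @\<^sub>v h1) $ c)"
      using g dim by (simp add: A2_def net scalar_prod_def)
    also have "\<dots> = (\<Sum>c\<in>{d + 2 * d * g..<d + 2 * d * g + 2 * d}. A2 $$ (g, c) * (z @\<^sub>v h1) $ c)"
    proof (rule sum.mono_neutral_right)
      show "{d + 2 * d * g..<d + 2 * d * g + 2 * d} \<subseteq> {0..<d + 2 * d * K}"
      proof
        fix c assume "c \<in> {d + 2 * d * g..<d + 2 * d * g + 2 * d}"
        then show "c \<in> {0..<d + 2 * d * K}" using pos[of "c - (d + 2 * d * g)"] unfolding atLeastLessThan_iff by linarith
      qed
      show "\<forall>c\<in>{0..<d + 2 * d * K} - {d + 2 * d * g..<d + 2 * d * g + 2 * d}. A2 $$ (g, c) * (z @\<^sub>v h1) $ c = 0"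
      proof
        fix c assume c: "c \<in> {0..<d + 2 * d * K} - {d + 2 * d * g..<d + 2 * d * g + 2 * d}"
        have "\<not> (d \<le> c \<and> (c - d) div (2 * d) = g)"
        proof
          assume a: "d \<le> c \<and> (c - d) div (2 * d) = g"
          then have "c - d = 2 * d * g + (c - d) mod (2 * d)" using div_mult_mod_eq[of "c - d" "2 * d"] by (simp add: mult.commute)
          moreover have "(c - d) mod (2 * d) < 2 * d" using d by simp
          ultimately have "c \<in> {d + 2 * d * g..<d + 2 * d * g + 2 * d}"
            using a unfolding atLeastLessThan_iff by linarith
          then show False using c by blast
        qed
        then show "A2 $$ (g, c) * (z @\<^sub>v h1) $ c = 0" using g c by (auto simp: A2_def net)
      qed
    qed simp
    also have "\<dots> = (\<Sum>c<2 * d. - \<sigma> * h1 $ (2 * d * g + c))"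
    proof (rule sum.reindex_bij_witness[of _ "\<lambda>c. d + (2 * d * g + c)" "\<lambda>c. c - (d + 2 * d * g)"])
      fix c assume "c \<in> {..<2 * d}"
      then have c: "c < 2 * d" by simp
      show "d + (2 * d * g + c) \<in> {d + 2 * d * g..<d + 2 * d * g + 2 * d}" using c by simp
    next
      fix c assume c: "c \<in> {d + 2 * d * g..<d + 2 * d * g + 2 * d}"
      define e where "e = c - (d + 2 * d * g)"
      have ce: "c = d + (2 * d * g + e)" "e < 2 * d" using c by (auto simp: e_def)
      have "A2 $$ (g, c) = - \<sigma>" using g ce pos[OF ce(2)] by (auto simp: A2_def net)
      moreover have "(z @\<^sub>v h1) $ c = h1 $ (2 * d * g + e)"
        using z pos[OF ce(2)] unfolding ce(1) by (simp add: h1_def)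
      ultimately show "- \<sigma> * h1 $ (2 * d * g + (c - (d + 2 * d * g))) = A2 $$ (g, c) * (z @\<^sub>v h1) $ c"
        by (simp add: e_def)
    qed auto
    also have "\<dots> = - \<sigma> * (\<Sum>c<2 * d. h1 $ (2 * d * g + c))" by (simp add: sum_distrib_left)
    also have "(\<Sum>c<2 * d. h1 $ (2 * d * g + c)) = (\<Sum>c=0..<d. h1 $ (2 * d * g + c)) + (\<Sum>c=d..<d + d. h1 $ (2 * d * g + c))"
      by (simp add: lessThan_atLeast0 sum.atLeastLessThan_concat mult_2)
    also have "(\<Sum>c=0..<d. h1 $ (2 * d * g + c)) = (\<Sum>i<d. max 0 (lo g i - z $ i))"
    proof (rule sum.cong)
      fix i assume "i \<in> {..<d}"
      then have i: "i < d" by simp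
      have "(2 * d * g + i) mod d = i" using i by (metis mod_less mod_mult_self4 mult.commute mult.left_commute)
      then show "h1 $ (2 * d * g + i) = max 0 (lo g i - z $ i)"
        using pos[of i] i by (simp add: h1_def)
    qed auto
    also have "(\<Sum>c=d..<d + d. h1 $ (2 * d * g + c)) = (\<Sum>i<d. max 0 (z $ i - hi g i))"
    proof (rule sum.reindex_bij_witness[of _ "\<lambda>i. d + i" "\<lambda>i. i - d"])
      fix c assume c: "c \<in> {d..<d + d}"
      define i where "i = c - d"
      have i: "i < d" "c = d + i" using c by (auto simp: i_def)
      have "2 * d * g + (d + i) = i + d * (2 * g + 1)" by (simp add: algebra_simps)
      then have "(2 * d * g + (d + i)) mod d = i" using i by (metis mod_less mod_mult_self2)
      then show "max 0 (z $ (c - d) - hi g (c - d)) = h1 $ (2 * d * g + c)"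
        using pos[of c] i by (simp add: h1_def)
    qed auto
    finally show "map_vec (max 0) (A2 *\<^sub>v (z @\<^sub>v h1) + b2) $ g = h2 $ g"
      using g by (simp add: h2_def hat_def A2_def b2_def net sum.distrib)
  qed (simp add: b2_def net h2_def)
  have l3: "A3 *\<^sub>v ((z @\<^sub>v h1) @\<^sub>v h2) + 0\<^sub>v K = h2"
  proof (rule eq_vecI)
    fix g assume "g < dim_vec h2"
    then have g: "g < K" by (simp add: h2_def)
    have dim: "dim_vec ((z @\<^sub>v h1) @\<^sub>v h2) = d + 2 * d * K + K" using z by (simp add: h1_def h2_def)
    have "Matrix.row A3 g \<bullet> ((z @\<^sub>v h1) @\<^sub>v h2)
        = (\<Sum>c=0..<d + 2 * d * K + K. if c = d + 2 * d * K + g then ((z @\<^sub>v h1) @\<^sub>v h2) $ c else 0)"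
      unfolding scalar_prod_def dim using g by (intro sum.cong) (auto simp: A3_def net)
    also have "\<dots> = h2 $ g"
      using g z by (simp add: h1_def h2_def)
    finally show "(A3 *\<^sub>v ((z @\<^sub>v h1) @\<^sub>v h2) + 0\<^sub>v K) $ g = h2 $ g"
      using g by (simp add: A3_def net)
  qed (simp add: h2_def A3_def net)
  show ?thesis
    unfolding split using l1 l2 l3 by (simp add: h2_def)
qed

lemma realize_concat_root_seed:
  assumes "0 < d" "z \<in> carrier_vec d"
  shows "realize (net_concat (root_net K n V) (seed_net d K \<sigma> lo hi)) z
    = Matrix.vec n (\<lambda>r. \<Sum>g<K. hat d \<sigma> (lo g) (hi g) (\<lambda>i. z $ i) * V g $ r)"
  unfolding root_net_def
  by (subst realize_concat_linear[OF well_shaped_seed_net _ _ assms(2)])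
     (auto intro!: eq_vecI sum.cong simp: realize_seed_net[OF assms] scalar_prod_def lessThan_atLeast0)

text \<open>Linear in the number K of boxes and in the output dimension n. The two sparse layers are
  counted by injecting their entries into their columns and rows, respectively.\<close>
lemma active_weights_concat_root_seed:
  assumes "1 \<le> K" "1 \<le> n"
  shows "active_weights (arch_concat (root_arch K n) (seed_arch d K)) \<le> (2 * d\<^sup>2 + 5 * d + 5) * (n * K)"
proof -
  let ?P = "\<lambda>m n f. {(i, j). i < m \<and> j < n \<and> Matrix.mat m n f $$ (i, j)}"
  define D where "D = d + 2 * d * K"
  have P: "?P m k f = {(i, j). i < m \<and> j < k \<and> f (i, j)}" for m k f by auto
  have V: "{i. i < m \<and> Matrix.vec m f $ i} = {i. i < m \<and> f i}" for m f by auto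
  define f2 where "f2 = (\<lambda>(g, c). d \<le> c \<and> (c - d) div (2 * d) = g)"
  define f3 where "f3 = (\<lambda>(i, j). if i < K then j = D + i else j = D + (i - K))"
  define f4 :: "nat \<times> nat \<Rightarrow> bool" where "f4 = (\<lambda>(i, j). D + K \<le> j)"
  have arch: "arch_concat (root_arch K n) (seed_arch d K) =
     [(Matrix.mat (2 * d * K) d (\<lambda>_. True), Matrix.vec (2 * d * K) (\<lambda>_. True)),
      (Matrix.mat K D f2, Matrix.vec K (\<lambda>_. True)),
      (Matrix.mat (2 * K) (D + K) f3, Matrix.vec (2 * K) (\<lambda>_. False)),
      (Matrix.mat n (D + K + K + K) f4, Matrix.vec n (\<lambda>_. False))]"
    by (auto simp: concatenate_def Let_def seed_arch_def root_arch_def f2_def f3_def f4_def D_def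
        intro!: eq_matI eq_vecI)
  have c1: "card {(i, j). i < 2 * d * K \<and> j < d \<and> True} \<le> 2 * d * K * d"
  proof -
    have "{(i, j). i < 2 * d * K \<and> j < d \<and> True} = {..<2 * d * K} \<times> {..<d}" by auto
    then show ?thesis by (simp add: card_cartesian_product)
  qed
  have c2: "card {(i, j). i < K \<and> j < D \<and> f2 (i, j)} \<le> D"
  proof -
    have "{(i, j). i < K \<and> j < D \<and> f2 (i, j)} \<subseteq> (\<lambda>c. ((c - d) div (2 * d), c)) ` {..<D}"
      by (auto simp: f2_def)
    then show ?thesis using surj_card_le[of "{..<D}"] by simp
  qed
  have c3: "card {(i, j). i < 2 * K \<and> j < D + K \<and> f3 (i, j)} \<le> 2 * K"
  proof -
    have "{(i, j). i < 2 * K \<and> j < D + K \<and> f3 (i, j)} \<subseteq> (\<lambda>i. (i, if i < K then D + i else D + (i - K))) ` {..<2 * K}"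
      by (auto simp: f3_def split: if_splits)
    then show ?thesis using surj_card_le[of "{..<2 * K}"] by simp
  qed
  have c4: "card {(i, j). i < n \<and> j < D + K + K + K \<and> f4 (i, j)} \<le> n * (2 * K)"
  proof -
    have "{(i, j). i < n \<and> j < D + K + K + K \<and> f4 (i, j)} = {..<n} \<times> {D + K..<D + K + K + K}"
      by (auto simp: f4_def)
    then show ?thesis by (simp add: card_cartesian_product)
  qed
  have "active_weights (arch_concat (root_arch K n) (seed_arch d K))
      \<le> 2 * d * K * d + 2 * d * K + (D + K) + 2 * K + n * (2 * K)"
    using c1 c2 c3 c4 unfolding active_weights_def arch by (simp add: P V)
  also have "\<dots> = (2 * d\<^sup>2 + 4 * d + 3) * K + d + 2 * (n * K)"
    by (simp add: D_def power2_eq_square algebra_simps)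
  also have "\<dots> \<le> (2 * d\<^sup>2 + 4 * d + 3) * (n * K) + d * (n * K) + 2 * (n * K)"
    using assms by (intro add_mono mult_le_mono) auto
  finally show ?thesis by (simp add: algebra_simps)
qed

section \<open>Disjoint boxes and their bump functions\<close>

text \<open>The bump of \<open>cbox a b\<close> in a Euclidean space, independent of an enumeration of the basis.\<close>
definition box_hat :: "real \<Rightarrow> 'a \<Rightarrow> 'a \<Rightarrow> 'a::euclidean_space \<Rightarrow> real" where
  "box_hat \<sigma> a b x = max 0 (1 - \<sigma> * (\<Sum>e\<in>Basis. max 0 (inner a e - inner x e) + max 0 (inner x e - inner b e)))"

lemma hat_coords:
  fixes a b x :: "'a::euclidean_space"
  shows "hat DIM('a) \<sigma> (\<lambda>i. inner a (from_nat_into Basis i)) (\<lambda>i. inner b (from_nat_into Basis i))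
    (\<lambda>i. coords x $ i) = box_hat \<sigma> a b x"
proof -
  have "bij_betw (from_nat_into (Basis :: 'a set)) {..<DIM('a)} Basis"
    by (rule bij_betw_from_nat_into_finite) simp
  then have "(\<Sum>e\<in>Basis. max 0 (inner a e - inner x e) + max 0 (inner x e - inner b e))
    = (\<Sum>i<DIM('a). max 0 (inner a (from_nat_into Basis i) - inner x (from_nat_into Basis i))
        + max 0 (inner x (from_nat_into Basis i) - inner b (from_nat_into Basis i)))"
    by (rule sum.reindex_bij_betw[symmetric])
  then show ?thesis by (simp add: hat_def box_hat_def coords_def)
qed

lemma box_hat_nonneg: "0 \<le> box_hat \<sigma> a b x"
  by (simp add: box_hat_def)

lemma box_hat_le_1: "0 \<le> \<sigma> \<Longrightarrow> box_hat \<sigma> a b x \<le> 1"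
  by (simp add: box_hat_def sum_nonneg)

lemma box_hat_eq_1: "x \<in> cbox a b \<Longrightarrow> box_hat \<sigma> a b x = 1"
  by (simp add: box_hat_def mem_box)

text \<open>The nearest point is obtained by clamping the coordinates of x to the box.\<close>
lemma box_hat_support:
  assumes \<sigma>: "0 < \<sigma>" and ne: "cbox a b \<noteq> {}" and pos: "0 < box_hat \<sigma> a b x"
  shows "\<exists>y \<in> cbox a b. dist x y < 1 / \<sigma>"
proof -
  define y where "y = (\<Sum>e\<in>Basis. max (inner a e) (min (inner x e) (inner b e)) *\<^sub>R e)"
  have ye: "inner y e = max (inner a e) (min (inner x e) (inner b e))" if "e \<in> Basis" for e
    unfolding y_def using that by simp
  have ab: "inner a e \<le> inner b e" if "e \<in> Basis" for e
    using ne that by (auto simp: box_ne_empty)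
  have "y \<in> cbox a b" using ab by (auto simp: mem_box ye)
  moreover have "dist x y < 1 / \<sigma>"
  proof -
    have "dist x y \<le> (\<Sum>e\<in>Basis. \<bar>inner (x - y) e\<bar>)" unfolding dist_norm by (rule norm_le_l1)
    also have "\<dots> = (\<Sum>e\<in>Basis. max 0 (inner a e - inner x e) + max 0 (inner x e - inner b e))"
    proof (rule sum.cong)
      fix e :: 'a assume e: "e \<in> Basis"
      show "\<bar>inner (x - y) e\<bar> = max 0 (inner a e - inner x e) + max 0 (inner x e - inner b e)"
        using ab[OF e] by (auto simp: inner_diff_left ye[OF e] max_def min_def)
    qed simp
    also have "\<dots> < 1 / \<sigma>" using pos \<sigma> by (simp add: box_hat_def field_simps split: if_splits)
    finally show ?thesis .
  qed
  ultimately show ?thesis by blast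
qed

text \<open>Finitely many disjoint compact sets have positive mutual distance m; slope \<open>2/m\<close> confines each
  bump to points closer than \<open>m/2\<close> to its box.\<close>
lemma disjoint_boxes_disjoint_hats:
  fixes a b :: "nat \<Rightarrow> 'a::euclidean_space"
  assumes ne: "\<And>g. g < K \<Longrightarrow> cbox (a g) (b g) \<noteq> {}"
    and disj: "\<And>g g'. g < K \<Longrightarrow> g' < K \<Longrightarrow> g \<noteq> g' \<Longrightarrow> cbox (a g) (b g) \<inter> cbox (a g') (b g') = {}"
  shows "\<exists>\<sigma>>0. \<forall>x. \<forall>g<K. \<forall>g'<K. g \<noteq> g' \<longrightarrow> box_hat \<sigma> (a g) (b g) x = 0 \<or> box_hat \<sigma> (a g') (b g') x = 0"
proof -
  have "\<exists>d>0. \<forall>x\<in>cbox (a g) (b g). \<forall>y\<in>cbox (a g') (b g'). d \<le> dist x y"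
    if "g < K" "g' < K" "g \<noteq> g'" for g g'
    using separate_compact_closed[OF compact_cbox closed_cbox disj[OF that]] by blast
  then obtain d where d: "\<And>g g'. g < K \<Longrightarrow> g' < K \<Longrightarrow> g \<noteq> g' \<Longrightarrow> 0 < d g g' \<and>
      (\<forall>x\<in>cbox (a g) (b g). \<forall>y\<in>cbox (a g') (b g'). d g g' \<le> dist x y)"
    by metis
  define D where "D = insert 1 ((\<lambda>(g, g'). d g g') ` {(g, g'). g < K \<and> g' < K \<and> g \<noteq> g'})"
  have "finite {(g, g'). g < K \<and> g' < K \<and> g \<noteq> g'}"
    by (rule finite_subset[of _ "{..<K} \<times> {..<K}"]) auto
  then have fin: "finite D" by (simp add: D_def)
  define m where "m = Min D"
  have m: "0 < m" unfolding m_def using fin d by (subst Min_gr_iff) (auto simp: D_def)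
  have "box_hat (2 / m) (a g) (b g) x = 0 \<or> box_hat (2 / m) (a g') (b g') x = 0"
    if g: "g < K" "g' < K" "g \<noteq> g'" for x g g'
  proof (rule ccontr)
    assume "\<not> ?thesis"
    then have pos: "0 < box_hat (2 / m) (a g) (b g) x" "0 < box_hat (2 / m) (a g') (b g') x"
      using box_hat_nonneg by (metis less_eq_real_def)+
    obtain y where y: "y \<in> cbox (a g) (b g)" "dist x y < 1 / (2 / m)"
      using box_hat_support[OF _ ne[OF g(1)] pos(1)] m by auto
    obtain y' where y': "y' \<in> cbox (a g') (b g')" "dist x y' < 1 / (2 / m)"
      using box_hat_support[OF _ ne[OF g(2)] pos(2)] m by auto
    have "m \<le> d g g'" unfolding m_def using fin g by (intro Min_le) (auto simp: D_def)
    also have "\<dots> \<le> dist y y'" using d[OF g] y y' by blast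
    also have "\<dots> \<le> dist x y + dist x y'" by (rule dist_triangle3)
    finally show False using y y' by simp
  qed
  then show ?thesis using m by (intro exI[of _ "2 / m"]) auto
qed

text \<open>The K boxes cover S up to measure \<kappa>; being closed and disjoint, they are separated by gaps.\<close>
definition box_cover ::
  "'a::euclidean_space set \<Rightarrow> real \<Rightarrow> real \<Rightarrow> nat \<Rightarrow> (nat \<Rightarrow> 'a) \<Rightarrow> (nat \<Rightarrow> 'a) \<Rightarrow> bool" where
  "box_cover S h \<kappa> K a b \<longleftrightarrow> 1 \<le> K \<and>
    (\<forall>g<K. cbox (a g) (b g) \<noteq> {}) \<and>
    (\<forall>g<K. \<forall>g'<K. g \<noteq> g' \<longrightarrow> cbox (a g) (b g) \<inter> cbox (a g') (b g') = {}) \<and>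
    (\<forall>g<K. \<forall>x\<in>cbox (a g) (b g). \<forall>y\<in>cbox (a g) (b g). dist x y \<le> h) \<and>
    measure lborel S \<le> (\<Sum>g<K. measure lborel (cbox (a g) (b g) \<inter> S)) + \<kappa>"

lemma box_coverD:
  assumes "box_cover S h \<kappa> K a b"
  shows "1 \<le> K" "g < K \<Longrightarrow> cbox (a g) (b g) \<noteq> {}"
    "g < K \<Longrightarrow> g' < K \<Longrightarrow> g \<noteq> g' \<Longrightarrow> cbox (a g) (b g) \<inter> cbox (a g') (b g') = {}"
    "g < K \<Longrightarrow> x \<in> cbox (a g) (b g) \<Longrightarrow> y \<in> cbox (a g) (b g) \<Longrightarrow> dist x y \<le> h"
    "measure lborel S \<le> (\<Sum>g<K. measure lborel (cbox (a g) (b g) \<inter> S)) + \<kappa>"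
  using assms unfolding box_cover_def by blast+

text \<open>Subdivide a cube around S into \<open>n\<^sup>d\<close> cubes, n being of order \<open>1/h\<close>, and shrink each by a margin
  \<tau> on every side; the volume that is lost tends to 0 with \<tau>. The bound on the number of boxes
  does not involve \<kappa>, which is why the accuracy of the cover is free of charge for the complexity.\<close>
lemma grid_boxes:
  fixes S :: "'a::euclidean_space set"
  assumes "compact S"
  shows "\<exists>C\<ge>1. \<forall>h \<kappa>. 0 < h \<and> h \<le> 1 \<and> 0 < \<kappa> \<longrightarrow>
    (\<exists>K a b. real K \<le> (C / h) ^ DIM('a) \<and> box_cover S h \<kappa> K a b)"
proof -
  obtain R where R: "0 < R" "\<And>x. x \<in> S \<Longrightarrow> norm x \<le> R"
    using compact_imp_bounded[OF assms] by (auto simp: bounded_pos)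
  define D where "D = DIM('a)"
  have D: "1 \<le> D" by (simp add: D_def Suc_le_eq)
  define C where "C = 2 * R * real D + 1"
  have "C \<ge> 1" using R by (simp add: C_def)
  moreover have "\<exists>K a b. real K \<le> (C / h) ^ DIM('a) \<and> box_cover S h \<kappa> K a b"
    if h: "0 < h" "h \<le> 1" and \<kappa>: "0 < \<kappa>" for h \<kappa> :: real
  proof -
    define n where "n = nat \<lceil>2 * R * D / h\<rceil>"
    have quot: "0 < 2 * R * D / h" using R D h by simp
    have n: "1 \<le> n" "2 * R * D / h \<le> real n" "real n \<le> C / h"
    proof -
      show "2 * R * D / h \<le> real n" unfolding n_def by linarith
      then show "1 \<le> n" using quot by (cases n) auto
      have "real n \<le> 2 * R * D / h + 1" unfolding n_def using quot by linarith
      also have "\<dots> \<le> C / h" using h by (simp add: C_def field_simps)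
      finally show "real n \<le> C / h" .
    qed
    \<comment> \<open>side length of the cubes before shrinking\<close>
    define w where "w = 2 * R / real n"
    have w: "0 < w" "D * w \<le> h" "real n * w = 2 * R"
      using R n h by (auto simp: w_def field_simps)
    define K where "K = n ^ D"
    define P where "P = PiE (Basis :: 'a set) (\<lambda>_. {..<n})"
    have P: "finite P" "card P = K" by (auto simp: P_def K_def D_def card_PiE finite_PiE)
    obtain k where k: "bij_betw k {0..<K} P" using ex_bij_betw_nat_finite[OF P(1)] P(2) by auto
    have Kw: "real K * w ^ D = (2 * R) ^ D"
      unfolding K_def of_nat_power power_mult_distrib[symmetric] w(3) by (rule refl)
    have "((\<lambda>\<tau>. (2 * R) ^ D - real K * (w - 2 * \<tau>) ^ D) \<longlongrightarrow> (2 * R) ^ D - real K * (w - 2 * 0) ^ D) (at_right 0)"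
      by (intro tendsto_intros)
    then have "eventually (\<lambda>\<tau>. (2 * R) ^ D - real K * (w - 2 * \<tau>) ^ D < \<kappa>) (at_right 0)"
      by (rule order_tendstoD(2)) (use \<kappa> Kw in simp)
    moreover have "eventually (\<lambda>\<tau>. \<tau> < w / 2) (at_right 0)"
      using w by (intro order_tendstoD(2)[OF tendsto_ident_at]) simp
    moreover have "eventually (\<lambda>\<tau>::real. 0 < \<tau>) (at_right 0)" by (rule eventually_at_right_less)
    ultimately have "eventually (\<lambda>\<tau>. (2 * R) ^ D - real K * (w - 2 * \<tau>) ^ D < \<kappa> \<and> \<tau> < w / 2 \<and> 0 < \<tau>) (at_right 0)"
      by (intro eventually_conj)
    then obtain \<tau> where \<tau>: "(2 * R) ^ D - real K * (w - 2 * \<tau>) ^ D < \<kappa>" "\<tau> < w / 2" "0 < \<tau>"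
      using eventually_happens by (metis (mono_tags, lifting) trivial_limit_at_right_real)
    define a where "a g = (\<Sum>e\<in>Basis. (- R + real (k g e) * w + \<tau>) *\<^sub>R e)" for g
    define b where "b g = (\<Sum>e\<in>Basis. (- R + (real (k g e) + 1) * w - \<tau>) *\<^sub>R e)" for g
    have ae: "inner (a g) e = - R + real (k g e) * w + \<tau>" if "e \<in> Basis" for g e
      unfolding a_def using that by simp
    have be: "inner (b g) e = - R + (real (k g e) + 1) * w - \<tau>" if "e \<in> Basis" for g e
      unfolding b_def using that by simp
    have ba: "inner (b g) e - inner (a g) e = w - 2 * \<tau>" if "e \<in> Basis" for g e
      using ae[OF that, of g] be[OF that, of g] by (simp add: algebra_simps)
    have ab: "inner (a g) e \<le> inner (b g) e" if "e \<in> Basis" for g e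
      using ba[OF that, of g] \<tau> by linarith
    have ne: "cbox (a g) (b g) \<noteq> {}" for g using ab by (auto simp: box_ne_empty)
    have kn: "k g e < n" if "g < K" "e \<in> Basis" for g e
      using bij_betwE[OF k] that by (auto simp: P_def PiE_def Pi_def)
    have disj: "cbox (a g) (b g) \<inter> cbox (a g') (b g') = {}" if g: "g < K" "g' < K" "g \<noteq> g'" for g g'
    proof -
      have "k g \<noteq> k g'" using k g by (auto simp: bij_betw_def inj_on_def)
      moreover have "k g \<in> P" "k g' \<in> P" using bij_betwE[OF k] g by auto
      ultimately obtain e where e: "e \<in> Basis" "k g e \<noteq> k g' e"
        unfolding P_def by (meson PiE_ext)
      have step: "(real i + 1) * w \<le> real j * w" if "i < j" for i j :: nat
        using that w by (intro mult_right_mono) auto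
      show ?thesis
      proof (rule ccontr)
        assume "\<not> ?thesis"
        then obtain x where "x \<in> cbox (a g) (b g)" "x \<in> cbox (a g') (b g')" by auto
        then have x: "inner (a g) e \<le> inner x e" "inner x e \<le> inner (b g) e"
           "inner (a g') e \<le> inner x e" "inner x e \<le> inner (b g') e"
          using e by (auto simp: mem_box)
        show False
        proof (cases "k g e < k g' e")
          case True
          then show False using step[OF True] x ae[OF e(1), of g'] be[OF e(1), of g] \<tau> by linarith
        next
          case False
          then have "k g' e < k g e" using e by simp
          then show False using step[of "k g' e" "k g e"] x ae[OF e(1), of g] be[OF e(1), of g'] \<tau> by linarith
        qed
      qed
    qed
    have diam: "dist x y \<le> h" if "x \<in> cbox (a g) (b g)" "y \<in> cbox (a g) (b g)" for g x y
    proof -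
      have "dist x y \<le> (\<Sum>e\<in>Basis. \<bar>inner (x - y) e\<bar>)" unfolding dist_norm by (rule norm_le_l1)
      also have "\<dots> \<le> (\<Sum>e\<in>(Basis::'a set). w)"
      proof (rule sum_mono)
        fix e :: 'a assume e: "e \<in> Basis"
        then show "\<bar>inner (x - y) e\<bar> \<le> w"
          using that ba[OF e, of g] \<tau> by (fastforce simp: mem_box inner_diff_left abs_le_iff)
      qed
      also have "\<dots> = D * w" by (simp add: D_def)
      finally show ?thesis using w by simp
    qed
    have meas_box: "measure lborel (cbox (a g) (b g)) = (w - 2 * \<tau>) ^ D" for g
      using ba by (simp add: content_cbox' ne D_def inner_diff_left)
    define Q where "Q = cbox (- R *\<^sub>R One) (R *\<^sub>R (One :: 'a))"
    have Qe: "inner (R *\<^sub>R One) e = R" if "e \<in> Basis" for e :: 'a using that by simp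
    have mQ: "measure lborel Q = (2 * R) ^ D"
      unfolding Q_def using R by (subst content_cbox') (auto simp: D_def box_ne_empty inner_diff_left)
    have SQ: "S \<subseteq> Q"
    proof
      fix x assume "x \<in> S"
      then have "\<bar>inner x e\<bar> \<le> R" if "e \<in> Basis" for e using R(2) Basis_le_norm[OF that, of x] by force
      then show "x \<in> Q" by (fastforce simp: Q_def mem_box abs_le_iff)
    qed
    have boxQ: "cbox (a g) (b g) \<subseteq> Q" if g: "g < K" for g
    proof
      fix x assume x: "x \<in> cbox (a g) (b g)"
      have "- R \<le> inner x e \<and> inner x e \<le> R" if e: "e \<in> Basis" for e
      proof -
        have "(real (k g e) + 1) * w \<le> real n * w" using kn[OF g e] w by (intro mult_right_mono) auto
        moreover have "0 \<le> real (k g e) * w" using w by simp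
        moreover have "inner (a g) e \<le> inner x e" "inner x e \<le> inner (b g) e" using x e by (auto simp: mem_box)
        ultimately show ?thesis using ae[OF e, of g] be[OF e, of g] \<tau> w(3) by linarith
      qed
      then show "x \<in> Q" by (simp add: Q_def mem_box)
    qed
    define U where "U = (\<Union>g<K. cbox (a g) (b g))"
    have U: "U \<in> sets lborel" "U \<subseteq> Q" using boxQ by (auto simp: U_def)
    have finQ: "Q \<in> fmeasurable lborel" by (simp add: Q_def)
    have S: "S \<in> sets lborel" using assms by (simp add: borel_compact)
    have finS: "S \<in> fmeasurable lborel" using fmeasurableI2[OF finQ SQ S] .
    have finU: "U \<in> fmeasurable lborel" using fmeasurableI2[OF finQ U(2,1)] .
    have mU: "measure lborel U = real K * (w - 2 * \<tau>) ^ D"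
    proof -
      have "measure lborel U = (\<Sum>g<K. measure lborel (cbox (a g) (b g)))"
        unfolding U_def by (rule measure_UNION') (use disj in \<open>auto simp: pairwise_def disjnt_def\<close>)
      then show ?thesis by (simp add: meas_box)
    qed
    have "measure lborel S = measure lborel (S \<inter> U) + measure lborel (S - U)"
    proof -
      have "emeasure lborel S \<noteq> \<infinity>" using finS by (simp add: fmeasurable_def less_top)
      then have "emeasure lborel (S \<inter> U) \<noteq> \<infinity>" "emeasure lborel (S - U) \<noteq> \<infinity>"
        using S emeasure_mono[of "S \<inter> U" S lborel] emeasure_mono[of "S - U" S lborel]
        by (auto simp: top_unique)
      then show ?thesis
        using measure_Union[of lborel "S \<inter> U" "S - U"] S U(1) by (simp add: Int_Diff_Un Int_Diff_disjoint)
    qed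
    also have "measure lborel (S - U) \<le> measure lborel (Q - U)"
      by (rule measure_mono_fmeasurable) (use SQ S U finQ in \<open>auto intro: fmeasurable_Diff\<close>)
    also have "measure lborel (Q - U) = (2 * R) ^ D - real K * (w - 2 * \<tau>) ^ D"
      using measure_Diff[OF _ _ U(1), of Q] finQ U(2) unfolding mQ mU
      by (auto simp: fmeasurable_def less_top mQ[symmetric])
    also have "\<dots> \<le> \<kappa>" using \<tau>(1) by simp
    also have "measure lborel (S \<inter> U) = (\<Sum>g<K. measure lborel (cbox (a g) (b g) \<inter> S))"
    proof -
      have "S \<inter> U = (\<Union>g<K. cbox (a g) (b g) \<inter> S)" by (auto simp: U_def)
      also have "measure lborel \<dots> = (\<Sum>g<K. measure lborel (cbox (a g) (b g) \<inter> S))"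
        by (rule measure_UNION')
           (use disj finS in \<open>auto simp: pairwise_def disjnt_def intro!: fmeasurable_Int_fmeasurable\<close>)
      finally show ?thesis .
    qed
    finally have cover: "measure lborel S \<le> (\<Sum>g<K. measure lborel (cbox (a g) (b g) \<inter> S)) + \<kappa>" by simp
    have "1 \<le> K" using n by (simp add: K_def)
    moreover have "real K \<le> (C / h) ^ DIM('a)"
      unfolding K_def D_def[symmetric] using n(3) by (simp add: power_mono)
    ultimately have "real K \<le> (C / h) ^ DIM('a) \<and> box_cover S h \<kappa> K a b"
      unfolding box_cover_def using ne disj diam cover by blast
    then show ?thesis by blast
  qed
  ultimately show ?thesis by blast
qed

section \<open>Concentration of empirical frequencies\<close>

lemma indep_vars_coordinates:
  assumes "\<And>i. i \<in> I \<Longrightarrow> prob_space (N i)" "finite I" "I \<noteq> {}"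
  shows "prob_space.indep_vars (PiM I N) N (\<lambda>i \<omega>. \<omega> i) I"
proof -
  interpret P: prob_space "PiM I N" by (rule prob_space_PiM) (rule assms(1))
  have "distr (PiM I N) (PiM I N) (\<lambda>x. \<lambda>i\<in>I. x i) = distr (PiM I N) (PiM I N) (\<lambda>x. x)"
    by (rule distr_cong) (auto simp: space_PiM PiE_def extensional_restrict)
  also have "\<dots> = PiM I N" by (rule distr_id2) simp
  also have "\<dots> = PiM I (\<lambda>i. distr (PiM I N) (N i) (\<lambda>\<omega>. \<omega> i))"
    by (rule PiM_cong) (simp_all add: distr_PiM_component assms)
  finally show ?thesis
    by (subst P.indep_vars_iff_distr_eq_PiM') (use assms(3) in \<open>auto intro: measurable_component_singleton\<close>)
qed

lemma frequency_lower_tail: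
  fixes n :: nat and \<gamma> :: real
  assumes M: "prob_space M" and B: "B \<in> sets M" and n: "0 < n" and \<gamma>: "0 \<le> \<gamma>"
  shows "measure (PiM {..<n} (\<lambda>_. M))
    {\<omega> \<in> space (PiM {..<n} (\<lambda>_. M)). real (card {j. j < n \<and> \<omega> j \<in> B}) / n \<le> measure M B - \<gamma>}
    \<le> exp (- 2 * n * \<gamma>\<^sup>2)"
proof -
  let ?P = "PiM {..<n} (\<lambda>_. M)"
  interpret M: prob_space M by fact
  interpret P: prob_space ?P by (rule prob_space_PiM) (rule M)
  define X where "X i \<omega> = (indicator B (\<omega> i) :: real)" for i and \<omega> :: "nat \<Rightarrow> 'a"
  have distr: "distr ?P M (\<lambda>\<omega>. \<omega> i) = M" if "i < n" for i
    using distr_PiM_component[of "{..<n}" "\<lambda>_. M" i] M that by simp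
  have meas: "(\<lambda>\<omega>. \<omega> i) \<in> ?P \<rightarrow>\<^sub>M M" if "i < n" for i
    using that by (intro measurable_component_singleton) auto
  have distrX: "distr ?P borel (X i) = distr M borel (indicator B)" if "i < n" for i
    using distr_distr[OF _ meas[OF that], of "indicator B :: 'a \<Rightarrow> real" borel] B distr[OF that]
    by (simp add: o_def X_def[abs_def])
  have expX: "P.expectation (X 0) = measure M B"
  proof -
    have "P.expectation (X 0) = (\<integral>x. indicator B x \<partial>(distr ?P M (\<lambda>\<omega>. \<omega> 0)))"
      unfolding X_def using meas[OF n] B by (subst integral_distr) auto
    then show ?thesis using distr[OF n] B by simp
  qed
  interpret H: Hoeffding_ineq_iid ?P "{..<n}" X "X 0" 0 1 "measure M B"
  proof unfold_locales
    have "P.indep_vars (\<lambda>_. borel) (\<lambda>i \<omega>. (indicator B (\<omega> i) :: real)) {..<n}"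
      by (rule P.indep_vars_compose2[OF indep_vars_coordinates]) (use M n B in auto)
    then show "P.indep_vars (\<lambda>_. borel) X {..<n}" by (simp add: X_def[abs_def])
    show "distr ?P borel (X i) = distr ?P borel (X 0)" if "i \<in> {..<n}" for i
      using distrX that n by simp
    show "P.random_variable borel (X 0)" unfolding X_def using meas[OF n] B by measurable
    show "AE x in ?P. X 0 x \<in> {0..1}" by (simp add: X_def indicator_def)
    show "measure M B \<equiv> P.expectation (X 0)" using expX by simp
  qed simp
  have count: "(\<Sum>i<n. X i \<omega>) = real (card {j. j < n \<and> \<omega> j \<in> B})" for \<omega>
  proof -
    have "(\<Sum>i<n. X i \<omega>) = real (card ({..<n} \<inter> {j. \<omega> j \<in> B}))"
      by (simp add: X_def indicator_def if_distrib sum.If_cases)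
    also have "{..<n} \<inter> {j. \<omega> j \<in> B} = {j. j < n \<and> \<omega> j \<in> B}" by auto
    finally show ?thesis .
  qed
  show ?thesis
  proof -
    have "{..<n} \<noteq> {}" using n by auto
    then show ?thesis using H.Hoeffding_ineq_le'[OF \<gamma>] unfolding count by simp
  qed
qed

lemma frequency_set_measurable:
  assumes "B \<in> sets M"
  shows "{\<omega> \<in> space (PiM {..<n} (\<lambda>_. M)). x < real (card {j. j < n \<and> \<omega> j \<in> B}) / real n}
    \<in> sets (PiM {..<n::nat} (\<lambda>_. M))"
proof -
  have count: "real (card {j. j < n \<and> \<omega> j \<in> B}) = (\<Sum>i<n. indicator B (\<omega> i))" for \<omega> :: "nat \<Rightarrow> 'a"
  proof -
    have "(\<Sum>i<n. indicator B (\<omega> i)) = real (card ({..<n} \<inter> {j. \<omega> j \<in> B}))"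
      by (simp add: indicator_def if_distrib sum.If_cases)
    also have "{..<n} \<inter> {j. \<omega> j \<in> B} = {j. j < n \<and> \<omega> j \<in> B}" by auto
    finally show ?thesis by simp
  qed
  have "(\<lambda>\<omega>. (\<Sum>i<n. indicator B (\<omega> i)) / real n) \<in> borel_measurable (PiM {..<n} (\<lambda>_. M))"
    using assms by (intro borel_measurable_divide borel_measurable_sum borel_measurable_const)
      (auto intro!: measurable_compose[OF measurable_component_singleton])
  then show ?thesis unfolding count by measurable
qed

text \<open>Hoeffding's inequality for every set and the union bound. Only lower deviations matter below: sets
  with too many samples do no harm, since the squared residuals are nonnegative.\<close>
lemma frequencies_uniformly_large:
  fixes B :: "nat \<Rightarrow> 'a set"
  assumes M: "prob_space M" and B: "\<And>g. g < K \<Longrightarrow> B g \<in> sets M" and \<gamma>: "0 < \<gamma>" and \<delta>: "0 < \<delta>"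
  shows "\<exists>n\<ge>1. \<exists>E \<in> sets (PiM {..<n} (\<lambda>_. M)). measure (PiM {..<n} (\<lambda>_. M)) E > 1 - \<delta> \<and>
     (\<forall>\<omega>\<in>E. \<forall>g<K. measure M (B g) - \<gamma> < real (card {j. j < n \<and> \<omega> j \<in> B g}) / real n)"
proof -
  have "((\<lambda>n. real K * exp (- 2 * real n * \<gamma>\<^sup>2)) \<longlongrightarrow> real K * 0) sequentially"
  proof (intro tendsto_mult tendsto_const filterlim_compose[OF exp_at_bot])
    have "filterlim (\<lambda>n. (2 * \<gamma>\<^sup>2) * real n) at_top sequentially"
      using \<gamma> by (intro filterlim_tendsto_pos_mult_at_top[OF tendsto_const] filterlim_real_sequentially) auto
    then have "filterlim (\<lambda>n. - ((2 * \<gamma>\<^sup>2) * real n)) at_bot sequentially"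
      by (simp add: filterlim_uminus_at_top)
    then show "filterlim (\<lambda>n. - 2 * real n * \<gamma>\<^sup>2) at_bot sequentially"
      by (simp add: mult_ac)
  qed
  then have "eventually (\<lambda>n. real K * exp (- 2 * real n * \<gamma>\<^sup>2) < \<delta>) sequentially"
    using \<delta> by (intro order_tendstoD(2)) auto
  then obtain n0 where n0: "\<And>n. n \<ge> n0 \<Longrightarrow> real K * exp (- 2 * real n * \<gamma>\<^sup>2) < \<delta>"
    by (auto simp: eventually_sequentially)
  define n where "n = max 1 n0"
  have n: "1 \<le> n" "real K * exp (- 2 * real n * \<gamma>\<^sup>2) < \<delta>" using n0[of n] by (auto simp: n_def)
  let ?P = "PiM {..<n} (\<lambda>_. M)"
  interpret P: prob_space ?P by (rule prob_space_PiM) (rule M)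
  define E where "E g = {\<omega> \<in> space ?P. measure M (B g) - \<gamma> < real (card {j. j < n \<and> \<omega> j \<in> B g}) / real n}" for g
  have E: "E g \<in> sets ?P" if "g < K" for g
    unfolding E_def by (rule frequency_set_measurable) (use B that in auto)
  define F where "F = (\<Union>g<K. space ?P - E g)"
  have F: "F \<in> sets ?P" unfolding F_def using E by (intro sets.finite_UN sets.Diff) auto
  have "measure ?P F \<le> (\<Sum>g<K. measure ?P (space ?P - E g))"
    unfolding F_def by (rule P.finite_measure_subadditive_finite) (use E in auto)
  also have "\<dots> \<le> (\<Sum>g<K. exp (- 2 * real n * \<gamma>\<^sup>2))"
  proof (rule sum_mono)
    fix g assume "g \<in> {..<K}"
    moreover have "space ?P - E g = {\<omega> \<in> space ?P. real (card {j. j < n \<and> \<omega> j \<in> B g}) / n \<le> measure M (B g) - \<gamma>}"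
      by (auto simp: E_def)
    ultimately show "measure ?P (space ?P - E g) \<le> exp (- 2 * real n * \<gamma>\<^sup>2)"
      using frequency_lower_tail[OF M, of "B g" n \<gamma>] B \<gamma> n(1) by simp
  qed
  finally have "measure ?P F < \<delta>" using n by simp
  moreover have "measure ?P (space ?P - F) = 1 - measure ?P F" using F by (rule P.prob_compl)
  moreover have "space ?P - F \<in> sets ?P" using F by blast
  moreover have "\<forall>\<omega>\<in>space ?P - F. \<forall>g<K. measure M (B g) - \<gamma> < real (card {j. j < n \<and> \<omega> j \<in> B g}) / real n"
    by (auto simp: F_def E_def)
  ultimately show ?thesis using n(1) by (intro exI[of _ n] conjI bexI[of _ "space ?P - F"]) auto
qed

section \<open>Integration of errors that are bounded cell by cell\<close>

lemma measure_lborel_Times: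
  fixes A :: "'a::euclidean_space set" and B :: "'b::euclidean_space set"
  assumes "A \<in> sets borel" "B \<in> sets borel"
  shows "measure lborel (A \<times> B) = measure lborel A * measure lborel B"
proof -
  have "emeasure lborel (A \<times> B) = emeasure lborel A * emeasure lborel B"
    using assms lborel.emeasure_pair_measure_Times[of A lborel B] by (simp add: lborel_prod)
  then show ?thesis by (simp add: measure_def enn2real_mult)
qed

text \<open>The integrand is dominated by a step function almost everywhere, and the upper integral is monotone
  for non-measurable integrands as well.\<close>
lemma nn_integral_le_finite_pieces:
  fixes E f :: "'a \<Rightarrow> real" and D :: "'i \<Rightarrow> 'a set"
  assumes \<Omega>: "\<Omega> \<in> fmeasurable M" and I: "finite I"
    and D: "\<And>i. i \<in> I \<Longrightarrow> D i \<in> sets M" "\<And>i. i \<in> I \<Longrightarrow> D i \<subseteq> \<Omega>" "disjoint_family_on D I"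
    and f: "AE x in M. x \<in> \<Omega> \<longrightarrow> f x \<le> E x"
    and C: "\<And>i x. i \<in> I \<Longrightarrow> x \<in> D i \<Longrightarrow> E x \<le> C i" "\<And>i. i \<in> I \<Longrightarrow> 0 \<le> C i"
    and C0: "\<And>x. x \<in> \<Omega> \<Longrightarrow> E x \<le> C0" "0 \<le> C0"
  shows "(\<integral>\<^sup>+x\<in>\<Omega>. ennreal (f x) \<partial>M)
    \<le> ennreal ((\<Sum>i\<in>I. C i * measure M (D i)) + C0 * (measure M \<Omega> - (\<Sum>i\<in>I. measure M (D i))))"
proof -
  define U where "U = (\<Union>i\<in>I. D i)"
  have U: "U \<in> sets M" "U \<subseteq> \<Omega>" using D I by (auto simp: U_def)
  have Df: "D i \<in> fmeasurable M" if "i \<in> I" for i using fmeasurableI2[OF \<Omega> D(2,1)] that by blast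
  have Uf: "U \<in> fmeasurable M" using fmeasurableI2[OF \<Omega> U(2,1)] .
  have mU: "measure M U = (\<Sum>i\<in>I. measure M (D i))"
    unfolding U_def using I Df D(3)
    by (intro measure_UNION') (auto simp: pairwise_def disjnt_def disjoint_family_on_def)
  have rest: "\<Omega> - U \<in> fmeasurable M" using \<Omega> U(1) by (rule fmeasurable_Diff)
  have mrest: "measure M (\<Omega> - U) = measure M \<Omega> - measure M U"
    using \<Omega> U by (intro measure_Diff) (auto simp: fmeasurable_def less_top[symmetric])
  have em: "emeasure M X = ennreal (measure M X)" if "X \<in> fmeasurable M" for X
    using that by (intro emeasure_eq_ennreal_measure) (auto simp: fmeasurable_def)
  have "(\<integral>\<^sup>+x\<in>\<Omega>. ennreal (f x) \<partial>M)
    \<le> (\<integral>\<^sup>+x. (\<Sum>i\<in>I. ennreal (C i) * indicator (D i) x) + ennreal C0 * indicator (\<Omega> - U) x \<partial>M)"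
  proof (rule nn_integral_mono_AE)
    show "AE x in M. ennreal (f x) * indicator \<Omega> x
      \<le> (\<Sum>i\<in>I. ennreal (C i) * indicator (D i) x) + ennreal C0 * indicator (\<Omega> - U) x"
      using f
    proof eventually_elim
      case (elim x)
      show ?case
      proof (cases "x \<in> \<Omega>")
        case x: True
        show ?thesis
        proof (cases "x \<in> U")
          case True
          then obtain i where i: "i \<in> I" "x \<in> D i" by (auto simp: U_def)
          have "ennreal (f x) \<le> ennreal (C i) * indicator (D i) x"
            using elim x i C(1)[OF i] by (auto intro!: ennreal_leI)
          also have "\<dots> \<le> (\<Sum>i\<in>I. ennreal (C i) * indicator (D i) x)"
            by (rule member_le_sum[OF i(1)]) (use I in auto)
          finally show ?thesis using x by (simp add: add_increasing2)
        next
          case False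
          then show ?thesis using elim x C0(1)[OF x] by (auto intro!: ennreal_leI add_increasing)
        qed
      qed simp
    qed
  qed
  also have "\<dots> = (\<Sum>i\<in>I. ennreal (C i) * emeasure M (D i)) + ennreal C0 * emeasure M (\<Omega> - U)"
  proof -
    have "(\<integral>\<^sup>+x. (\<Sum>i\<in>I. ennreal (C i) * indicator (D i) x) + ennreal C0 * indicator (\<Omega> - U) x \<partial>M)
      = (\<integral>\<^sup>+x. (\<Sum>i\<in>I. ennreal (C i) * indicator (D i) x) \<partial>M) + (\<integral>\<^sup>+x. ennreal C0 * indicator (\<Omega> - U) x \<partial>M)"
      using D(1) rest by (intro nn_integral_add) (auto intro!: borel_measurable_sum)
    also have "(\<integral>\<^sup>+x. (\<Sum>i\<in>I. ennreal (C i) * indicator (D i) x) \<partial>M)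
      = (\<Sum>i\<in>I. (\<integral>\<^sup>+x. ennreal (C i) * indicator (D i) x \<partial>M))"
      using D(1) by (intro nn_integral_sum) auto
    finally show ?thesis using D(1) rest by (simp add: nn_integral_cmult_indicator)
  qed
  also have "\<dots> = (\<Sum>i\<in>I. ennreal (C i * measure M (D i))) + ennreal (C0 * measure M (\<Omega> - U))"
    using Df rest C(2) C0(2) by (simp add: em ennreal_mult)
  also have "\<dots> = ennreal ((\<Sum>i\<in>I. C i * measure M (D i)) + C0 * measure M (\<Omega> - U))"
    using C(2) C0(2) by (subst sum_ennreal) (auto simp: ennreal_plus[symmetric] sum_nonneg simp del: ennreal_plus)
  finally show ?thesis unfolding mrest mU .
qed

text \<open>The step from samples to the integral on one cell: p is the probability of the cell, X the set of
  the samples in it, and E a value that is controlled by every one of these samples. Averaging over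
  X turns the true weight p into the empirical weight \<open>card X / n\<close>; the deficit, at most \<gamma>, is
  charged with the uniform bound \<open>C0\<close>.\<close>
lemma empirical_cell_bound:
  fixes r :: "nat \<Rightarrow> real" and X :: "nat set"
  assumes n: "0 < n" and X: "X \<subseteq> {..<n}"
    and freq: "p < real (card X) / real n + \<gamma>"
    and E: "0 \<le> E" "E \<le> C0" "\<And>j. j \<in> X \<Longrightarrow> E \<le> 2 * r j + \<rho>" and \<gamma>: "0 \<le> \<gamma>"
  shows "p * E \<le> 2 / real n * (\<Sum>j\<in>X. r j) + \<rho> * (real (card X) / real n) + \<gamma> * C0"
proof -
  have "real (card X) * E \<le> (\<Sum>j\<in>X. 2 * r j + \<rho>)"
    using E(3) by (metis sum_bounded_below)
  also have "\<dots> = 2 * (\<Sum>j\<in>X. r j) + real (card X) * \<rho>"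
    by (simp add: sum.distrib sum_distrib_left)
  finally have "real (card X) / real n * E \<le> 2 / real n * (\<Sum>j\<in>X. r j) + \<rho> * (real (card X) / real n)"
    using n by (simp add: field_simps)
  moreover have "p * E \<le> (real (card X) / real n + \<gamma>) * E" using freq E(1) by (intro mult_right_mono) auto
  moreover have "\<gamma> * E \<le> \<gamma> * C0" using E \<gamma> by (intro mult_left_mono) auto
  ultimately show ?thesis by (simp add: distrib_right)
qed

text \<open>Here f is the relative error, E its pointwise bound, and \<open>r g j\<close> the squared residual of sample j
  at the reference point of box g. On the cell of the boxes g and h the bound of
  \<open>empirical_cell_bound\<close>, divided by the probability of h, serves as the constant of a step function;
  summed over h it is controlled by the sample mean J. The set outside the cells contributes at most
  \<open>C0\<close> times its measure.\<close>
lemma error_integral_bound: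
  fixes \<Theta> :: "'a::euclidean_space set" and \<Theta>' :: "'b::euclidean_space set"
    and T :: real and a b :: "nat \<Rightarrow> 'a \<times> real" and a' b' :: "nat \<Rightarrow> 'b" and f E :: "'a \<times> 'b \<times> real \<Rightarrow> real"
  defines "Y \<equiv> \<Theta> \<times> {0..T}" and "\<Omega> \<equiv> \<Theta> \<times> \<Theta>' \<times> {0..T}"
  assumes cpt: "compact \<Theta>" "compact \<Theta>'" and pos: "0 < measure lborel \<Theta>'"
    and disj: "\<And>g h. g < K \<Longrightarrow> h < K \<Longrightarrow> g \<noteq> h \<Longrightarrow> cbox (a g) (b g) \<inter> cbox (a h) (b h) = {}"
    and disj': "\<And>g h. g < K' \<Longrightarrow> h < K' \<Longrightarrow> g \<noteq> h \<Longrightarrow> cbox (a' g) (b' g) \<inter> cbox (a' h) (b' h) = {}"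
    and cover: "measure lborel Y \<le> (\<Sum>g<K. measure lborel (cbox (a g) (b g) \<inter> Y)) + \<kappa>"
    and cover': "measure lborel \<Theta>' \<le> (\<Sum>g<K'. measure lborel (cbox (a' g) (b' g) \<inter> \<Theta>')) + \<kappa>"
    and n: "0 < n" and \<gamma>: "0 \<le> \<gamma>" and \<rho>: "0 \<le> \<rho>" and r: "\<And>g j. 0 \<le> r g j" and J: "0 \<le> J" and \<kappa>: "0 \<le> \<kappa>"
    and freq: "\<And>g. g < K' \<Longrightarrow> measure lborel (cbox (a' g) (b' g) \<inter> \<Theta>') / measure lborel \<Theta>' - \<gamma>
      < real (card {j. j < n \<and> \<nu>s j \<in> cbox (a' g) (b' g)}) / real n"
    and f: "AE x in lborel. x \<in> \<Omega> \<longrightarrow> f x \<le> E x"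
    and E: "\<And>x. x \<in> \<Omega> \<Longrightarrow> 0 \<le> E x" "\<And>x. x \<in> \<Omega> \<Longrightarrow> E x \<le> C0"
    and cell: "\<And>g g' j \<mu> \<nu> t. g < K \<Longrightarrow> g' < K' \<Longrightarrow> j < n \<Longrightarrow> \<nu>s j \<in> cbox (a' g') (b' g') \<Longrightarrow>
      (\<mu>, \<nu>, t) \<in> \<Omega> \<Longrightarrow> (\<mu>, t) \<in> cbox (a g) (b g) \<Longrightarrow> \<nu> \<in> cbox (a' g') (b' g') \<Longrightarrow>
      E (\<mu>, \<nu>, t) \<le> 2 * r g j + \<rho>"
    and samples: "\<And>g. g < K \<Longrightarrow> cbox (a g) (b g) \<inter> Y \<noteq> {} \<Longrightarrow>
      measure lborel \<Theta>' / real n * (\<Sum>j<n. r g j) \<le> J"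
  shows "(\<integral>\<^sup>+x\<in>\<Omega>. ennreal (f x) \<partial>lborel)
    \<le> ennreal (measure lborel Y * (2 * J + measure lborel \<Theta>' * (\<rho> + real K' * \<gamma> * C0))
        + C0 * (\<kappa> * (measure lborel Y + measure lborel \<Theta>')))"
proof (cases "\<Omega> = {}")
  case False
  then obtain x0 where "x0 \<in> \<Omega>" by blast
  then have C0: "0 \<le> C0" using E(1)[of x0] E(2)[of x0] by linarith
  let ?B = "\<lambda>g. cbox (a g) (b g)" and ?B' = "\<lambda>g. cbox (a' g) (b' g)"
  define I where "I = {..<K} \<times> {..<K'}"
  define D where "D = (\<lambda>(g, g'). {(\<mu>, \<nu>, t). (\<mu>, \<nu>, t) \<in> \<Omega> \<and> (\<mu>, t) \<in> ?B g \<and> \<nu> \<in> ?B' g'})"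
  define p where "p g' = measure lborel (?B' g' \<inter> \<Theta>') / measure lborel \<Theta>'" for g'
  define X where "X g' = {j. j < n \<and> \<nu>s j \<in> ?B' g'}" for g'
  define num where "num g g' = 2 / real n * (\<Sum>j\<in>X g'. r g j) + \<rho> * (real (card (X g')) / real n) + \<gamma> * C0" for g g'
  \<comment> \<open>a cell of probability 0 has measure 0, so any upper bound of the error is admissible there\<close>
  define C where "C = (\<lambda>(g, g'). if p g' = 0 then C0 else num g g' / p g')"
  have borel [measurable]: "\<Theta> \<in> sets borel" "\<Theta>' \<in> sets borel"
    using cpt by (simp_all add: borel_compact)
  have B_eq: "?B g = cbox (fst (a g)) (fst (b g)) \<times> cbox (snd (a g)) (snd (b g))" for g
    using cbox_Pair_eq[of "fst (a g)" "snd (a g)" "fst (b g)" "snd (b g)"] by simp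
  have times: "{(\<mu>, \<nu>, t). (\<mu>, \<nu>, t) \<in> U \<times> U' \<times> I \<and> (\<mu>, t) \<in> P \<times> Q \<and> \<nu> \<in> V'} = (P \<inter> U) \<times> (V' \<inter> U') \<times> (Q \<inter> I)"
    for U P :: "'a set" and U' V' :: "'b set" and I Q :: "real set"
    by blast
  have D_eq: "D (g, g') = (cbox (fst (a g)) (fst (b g)) \<inter> \<Theta>) \<times> (?B' g' \<inter> \<Theta>') \<times> (cbox (snd (a g)) (snd (b g)) \<inter> {0..T})"
    for g g'
    unfolding D_def \<Omega>_def prod.case B_eq by (rule times)
  have BY_eq: "?B g \<inter> Y = (cbox (fst (a g)) (fst (b g)) \<inter> \<Theta>) \<times> (cbox (snd (a g)) (snd (b g)) \<inter> {0..T})" for g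
    unfolding Y_def B_eq by (rule Times_Int_Times)
  have D_meas: "D i \<in> sets lborel" for i
    by (cases i) (simp only: D_eq sets_lborel, intro borel_Times, auto)
  have mD: "measure lborel (D (g, g')) = measure lborel (?B g \<inter> Y) * measure lborel (?B' g' \<inter> \<Theta>')" for g g'
    unfolding D_eq BY_eq by (subst measure_lborel_Times | (auto intro!: borel_Times)[1])+ 
  have m\<Omega>: "measure lborel \<Omega> = measure lborel Y * measure lborel \<Theta>'"
    unfolding \<Omega>_def Y_def by (subst measure_lborel_Times | (auto intro!: borel_Times)[1])+ 
  have cY: "compact Y" unfolding Y_def using cpt by (intro compact_Times) auto
  have \<Omega>f: "\<Omega> \<in> fmeasurable lborel"
    unfolding \<Omega>_def using cpt by (intro fmeasurable_compact compact_Times) auto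
  have Ddisj: "disjoint_family_on D I"
    unfolding disjoint_family_on_def
  proof (intro ballI impI)
    fix i j assume ij: "i \<in> I" "j \<in> I" "i \<noteq> j"
    obtain g g' h h' where eq: "i = (g, g')" "j = (h, h')" by (metis surj_pair)
    have "?B g \<inter> ?B h = {} \<or> ?B' g' \<inter> ?B' h' = {}"
      using ij disj[of g h] disj'[of g' h'] unfolding eq I_def by blast
    then show "D i \<inter> D j = {}" unfolding eq D_def by blast
  qed
  have sumY: "(\<Sum>g<K. measure lborel (?B g \<inter> Y)) \<le> measure lborel Y"
  proof -
    have "(\<Sum>g<K. measure lborel (?B g \<inter> Y)) = measure lborel (\<Union>g<K. ?B g \<inter> Y)"
      by (rule measure_UNION'[symmetric])
         (use disj cY in \<open>auto simp: pairwise_def disjnt_def intro!: fmeasurable_compact closed_Int_compact\<close>)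
    also have "\<dots> \<le> measure lborel Y"
      by (rule measure_mono_fmeasurable) (use cY in \<open>auto intro!: fmeasurable_compact sets.finite_UN borel_compact closed_Int_compact\<close>)
    finally show ?thesis .
  qed
  have sum': "(\<Sum>g<K'. measure lborel (?B' g \<inter> \<Theta>')) \<le> measure lborel \<Theta>'"
  proof -
    have "(\<Sum>g<K'. measure lborel (?B' g \<inter> \<Theta>')) = measure lborel (\<Union>g<K'. ?B' g \<inter> \<Theta>')"
      by (rule measure_UNION'[symmetric])
         (use disj' cpt in \<open>auto simp: pairwise_def disjnt_def intro!: fmeasurable_compact closed_Int_compact\<close>)
    also have "\<dots> \<le> measure lborel \<Theta>'"
      by (rule measure_mono_fmeasurable) (use cpt in \<open>auto intro!: fmeasurable_compact sets.finite_UN borel_compact closed_Int_compact\<close>)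
    finally show ?thesis .
  qed
  have num_nonneg: "0 \<le> num g g'" for g g'
    unfolding num_def using r \<rho> \<gamma> C0 by (intro add_nonneg_nonneg mult_nonneg_nonneg sum_nonneg) auto
  have p_nonneg: "0 \<le> p g'" for g' by (simp add: p_def)
  have EC: "E x \<le> C i" if i: "i \<in> I" and x: "x \<in> D i" for i x
  proof -
    obtain g g' \<mu> \<nu> t where eq: "i = (g, g')" "x = (\<mu>, \<nu>, t)" by (metis surj_pair)
    have g: "g < K" "g' < K'" using i eq by (auto simp: I_def)
    have x': "(\<mu>, \<nu>, t) \<in> \<Omega>" "(\<mu>, t) \<in> ?B g" "\<nu> \<in> ?B' g'" using x eq by (auto simp: D_def)
    show ?thesis
    proof (cases "p g' = 0")
      case True
      then show ?thesis using E(2)[OF x'(1)] eq by (simp add: C_def)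
    next
      case False
      have "p g' * E x \<le> num g g'"
        unfolding num_def eq
      proof (rule empirical_cell_bound[OF n])
        show "X g' \<subseteq> {..<n}" by (auto simp: X_def)
        show "p g' < real (card (X g')) / real n + \<gamma>" using freq[OF g(2)] by (simp add: p_def X_def)
        show "E (\<mu>, \<nu>, t) \<le> 2 * r g j + \<rho>" if "j \<in> X g'" for j
          using cell[OF g _ _ x'] that by (auto simp: X_def)
      qed (use E x' \<gamma> in auto)
      then show ?thesis using False p_nonneg[of g'] eq by (simp add: C_def field_simps)
    qed
  qed
  have "(\<integral>\<^sup>+x\<in>\<Omega>. ennreal (f x) \<partial>lborel)
    \<le> ennreal ((\<Sum>i\<in>I. C i * measure lborel (D i)) + C0 * (measure lborel \<Omega> - (\<Sum>i\<in>I. measure lborel (D i))))"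
  proof (rule nn_integral_le_finite_pieces[OF \<Omega>f _ D_meas _ Ddisj f EC _ E(2) C0])
    show "0 \<le> C i" for i using num_nonneg p_nonneg C0 by (cases i) (simp add: C_def)
  qed (auto simp: I_def D_def)
  also have "\<dots> \<le> ennreal (measure lborel Y * (2 * J + measure lborel \<Theta>' * (\<rho> + real K' * \<gamma> * C0))
        + C0 * (\<kappa> * (measure lborel Y + measure lborel \<Theta>')))"
  proof (intro ennreal_leI add_mono mult_left_mono C0)
    have Cm: "C (g, g') * measure lborel (D (g, g')) \<le> measure lborel (?B g \<inter> Y) * (measure lborel \<Theta>' * num g g')" for g g'
    proof (cases "p g' = 0")
      case True
      then have "measure lborel (?B' g' \<inter> \<Theta>') = 0" using pos by (simp add: p_def)
      then show ?thesis using num_nonneg[of g g'] by (simp add: mD)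
    next
      case False
      then have "measure lborel (?B' g' \<inter> \<Theta>') = p g' * measure lborel \<Theta>'" using pos by (simp add: p_def)
      then show ?thesis using False by (simp add: mD C_def)
    qed
    have inner: "measure lborel (?B g \<inter> Y) * (\<Sum>g'<K'. measure lborel \<Theta>' * num g g')
      \<le> measure lborel (?B g \<inter> Y) * (2 * J + measure lborel \<Theta>' * (\<rho> + real K' * \<gamma> * C0))" if g: "g < K" for g
    proof (cases "?B g \<inter> Y = {}")
      case False
      have cells: "(\<Sum>g'<K'. \<Sum>j\<in>X g'. h j) \<le> (\<Sum>j<n. h j)" if h: "\<And>j. 0 \<le> h j" for h :: "nat \<Rightarrow> real"
      proof -
        have "(\<Sum>g'<K'. \<Sum>j\<in>X g'. h j) = (\<Sum>j\<in>(\<Union>g'<K'. X g'). h j)"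
          by (rule sum.UNION_disjoint[symmetric]) (use disj' in \<open>auto simp: X_def\<close>)
        also have "\<dots> \<le> (\<Sum>j<n. h j)" by (rule sum_mono2) (use h in \<open>auto simp: X_def\<close>)
        finally show ?thesis .
      qed
      have q: "(\<Sum>g'<K'. real (card (X g')) / real n) \<le> 1"
        using cells[of "\<lambda>_. 1 / real n"] n by (simp add: sum_divide_distrib)
      have "(\<Sum>g'<K'. num g g') = 2 / real n * (\<Sum>g'<K'. \<Sum>j\<in>X g'. r g j)
          + \<rho> * (\<Sum>g'<K'. real (card (X g')) / real n) + real K' * (\<gamma> * C0)"
        unfolding num_def by (simp add: sum.distrib sum_distrib_left)
      also have "\<dots> \<le> 2 / real n * (\<Sum>j<n. r g j) + \<rho> * 1 + real K' * (\<gamma> * C0)"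
        using cells[of "r g"] r q \<rho> by (intro add_mono mult_left_mono order_refl) auto
      finally have "measure lborel \<Theta>' * (\<Sum>g'<K'. num g g')
         \<le> measure lborel \<Theta>' * (2 / real n * (\<Sum>j<n. r g j) + \<rho> + real K' * (\<gamma> * C0))"
        by (intro mult_left_mono) auto
      also have "\<dots> = 2 * (measure lborel \<Theta>' / real n * (\<Sum>j<n. r g j)) + measure lborel \<Theta>' * (\<rho> + real K' * \<gamma> * C0)"
        by (simp add: algebra_simps)
      also have "\<dots> \<le> 2 * J + measure lborel \<Theta>' * (\<rho> + real K' * \<gamma> * C0)"
        using samples[OF g False] by simp
      finally show ?thesis by (intro mult_left_mono) (auto simp: sum_distrib_left)
    qed simp
    have "(\<Sum>i\<in>I. C i * measure lborel (D i)) = (\<Sum>g<K. \<Sum>g'<K'. C (g, g') * measure lborel (D (g, g')))"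
      unfolding I_def by (simp add: sum.cartesian_product case_prod_unfold)
    also have "\<dots> \<le> (\<Sum>g<K. \<Sum>g'<K'. measure lborel (?B g \<inter> Y) * (measure lborel \<Theta>' * num g g'))"
      by (intro sum_mono Cm)
    also have "\<dots> \<le> (\<Sum>g<K. measure lborel (?B g \<inter> Y) * (2 * J + measure lborel \<Theta>' * (\<rho> + real K' * \<gamma> * C0)))"
      using inner by (intro sum_mono) (simp add: sum_distrib_left)
    also have "\<dots> = (\<Sum>g<K. measure lborel (?B g \<inter> Y)) * (2 * J + measure lborel \<Theta>' * (\<rho> + real K' * \<gamma> * C0))"
      by (simp add: sum_distrib_right)
    also have "\<dots> \<le> measure lborel Y * (2 * J + measure lborel \<Theta>' * (\<rho> + real K' * \<gamma> * C0))"
      using sumY J \<rho> \<gamma> C0 pos by (intro mult_right_mono) auto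
    finally show "(\<Sum>i\<in>I. C i * measure lborel (D i)) \<le> measure lborel Y * (2 * J + measure lborel \<Theta>' * (\<rho> + real K' * \<gamma> * C0))" .
    define y t where "y = (\<Sum>g<K. measure lborel (?B g \<inter> Y))" and "t = (\<Sum>g<K'. measure lborel (?B' g \<inter> \<Theta>'))"
    have "(\<Sum>i\<in>I. measure lborel (D i)) = (\<Sum>g<K. \<Sum>g'<K'. measure lborel (D (g, g')))"
      unfolding I_def by (simp add: sum.cartesian_product case_prod_unfold)
    also have "\<dots> = y * t" by (simp add: mD y_def t_def sum_product)
    finally have "measure lborel \<Omega> - (\<Sum>i\<in>I. measure lborel (D i)) = measure lborel Y * (measure lborel \<Theta>' - t) + (measure lborel Y - y) * t"
      by (simp add: m\<Omega> algebra_simps)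
    also have "\<dots> \<le> measure lborel Y * \<kappa> + \<kappa> * measure lborel \<Theta>'"
      using cover cover' sum' \<kappa> by (intro add_mono mult_left_mono mult_mono) (auto simp: y_def t_def sum_nonneg)
    finally show "measure lborel \<Omega> - (\<Sum>i\<in>I. measure lborel (D i)) \<le> \<kappa> * (measure lborel Y + measure lborel \<Theta>')"
      by (simp add: algebra_simps)
  qed
  finally show ?thesis .
qed simp

section \<open>Coordinates with respect to the POD basis\<close>

text \<open>With as many modes as degrees of freedom, the POD matrix is the full eigenbasis.\<close>
lemma is_POD_full:
  assumes "is_POD \<Theta> \<Theta>' T Nh G u Ns1 \<mu>s Ns2 \<nu>s Nt Nh A"
  shows "A \<in> carrier_mat Nh Nh" "g_orthonormal G A"
proof -
  obtain E where E: "E \<in> carrier_mat Nh Nh" "g_orthonormal G E"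
    and A: "A = mat_of_cols Nh (map (col E) [0..<Nh])"
    using assms unfolding is_POD_def Let_def leading_eigenbasis_def by auto
  have "A = E" unfolding A using E(1) mat_of_cols_cols[of E] by (simp add: cols_def)
  then show "A \<in> carrier_mat Nh Nh" "g_orthonormal G A" using E by auto
qed

context
  fixes Nh :: nat and G A :: "real mat"
  assumes spd: "spd Nh G" and A: "A \<in> carrier_mat Nh Nh" and orth: "g_orthonormal G A"
begin

lemma G_carrier: "G \<in> carrier_mat Nh Nh"
  using spd by (simp add: spd_def)

lemma AtG_carrier: "transpose_mat A * G \<in> carrier_mat Nh Nh"
  using A G_carrier by auto

lemma AtGA: "transpose_mat A * G * A = 1\<^sub>m Nh"
  using orth A by (simp add: g_orthonormal_def)

lemma AAtG: "A * (transpose_mat A * G) = 1\<^sub>m Nh"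
  using mat_mult_left_right_inverse[OF AtG_carrier A AtGA] .

lemma synthesis_analysis:
  assumes "v \<in> carrier_vec Nh"
  shows "A *\<^sub>v (transpose_mat A * G *\<^sub>v v) = v"
  using assoc_mult_mat_vec[OF A AtG_carrier assms] assms unfolding AAtG by simp

lemma analysis_synthesis:
  assumes "c \<in> carrier_vec Nh"
  shows "transpose_mat A * G *\<^sub>v (A *\<^sub>v c) = c"
  using assoc_mult_mat_vec[OF AtG_carrier A assms] assms unfolding AtGA by simp

lemma gnorm_synthesis:
  assumes c: "c \<in> carrier_vec Nh"
  shows "gnorm G (A *\<^sub>v c) = vnorm c"
proof -
  have Ac: "A *\<^sub>v c \<in> carrier_vec Nh" using A c by simp
  have tA: "transpose_mat A \<in> carrier_mat Nh Nh" using A by simp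
  have "(A *\<^sub>v c) \<bullet> (G *\<^sub>v (A *\<^sub>v c)) = (G *\<^sub>v (A *\<^sub>v c)) \<bullet> (A *\<^sub>v c)"
    using Ac G_carrier by (intro comm_scalar_prod) auto
  also have "\<dots> = (transpose_mat A *\<^sub>v (G *\<^sub>v (A *\<^sub>v c))) \<bullet> c"
    using transpose_vec_mult_scalar[OF A c, of "G *\<^sub>v (A *\<^sub>v c)"] Ac G_carrier by simp
  also have "transpose_mat A *\<^sub>v (G *\<^sub>v (A *\<^sub>v c)) = c"
    using analysis_synthesis[OF c] assoc_mult_mat_vec[OF tA G_carrier Ac] by simp
  finally show ?thesis by (simp add: gnorm_def vnorm_def)
qed

lemma gnorm_analysis:
  assumes "v \<in> carrier_vec Nh"
  shows "gnorm G v = vnorm (transpose_mat A * G *\<^sub>v v)"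
  using gnorm_synthesis[of "transpose_mat A * G *\<^sub>v v"] synthesis_analysis[OF assms] AtG_carrier assms by simp

lemma analysis_diff:
  assumes "v \<in> carrier_vec Nh" "v' \<in> carrier_vec Nh"
  shows "transpose_mat A * G *\<^sub>v (v - v') = transpose_mat A * G *\<^sub>v v - transpose_mat A * G *\<^sub>v v'"
  using mult_minus_distrib_mat_vec[OF AtG_carrier assms] .

lemma gnorm_triangle:
  assumes "v \<in> carrier_vec Nh" "v' \<in> carrier_vec Nh"
  shows "gnorm G v \<le> gnorm G v' + gnorm G (v - v')"
proof -
  let ?w = "\<lambda>v. transpose_mat A * G *\<^sub>v v"
  have c: "?w v \<in> carrier_vec Nh" "?w v' \<in> carrier_vec Nh" using AtG_carrier assms by auto
  have "?w v = ?w v' + (?w v - ?w v')" using c by (intro eq_vecI) auto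
  then have "vnorm (?w v) \<le> vnorm (?w v') + vnorm (?w v - ?w v')"
    using vnorm_triangle[of "?w v'" Nh "?w v - ?w v'"] c by simp
  then show ?thesis using assms by (simp add: gnorm_analysis analysis_diff)
qed

text \<open>In POD coordinates the DOD functional becomes a Euclidean projection error.\<close>
lemma J_hat_coordinates:
  assumes W: "W \<in> carrier_mat Nh k"
    and u: "\<And>j. j < N \<Longrightarrow> u (\<mu>, \<nu>s j, t) \<in> carrier_vec Nh"
  shows "J_hat \<Theta>' G u N \<nu>s (\<mu>, t) (A * W) = measure lborel \<Theta>' / real N *
    (\<Sum>j<N. let w = transpose_mat A * G *\<^sub>v u (\<mu>, \<nu>s j, t) in (vnorm (w - W *\<^sub>v (transpose_mat W *\<^sub>v w)))\<^sup>2)"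
proof -
  have "gnorm G (v - A * W * transpose_mat (A * W) * G *\<^sub>v v)
    = vnorm (transpose_mat A * G *\<^sub>v v - W *\<^sub>v (transpose_mat W *\<^sub>v (transpose_mat A * G *\<^sub>v v)))"
    if v: "v \<in> carrier_vec Nh" for v
  proof -
    define w where "w = transpose_mat A * G *\<^sub>v v"
    have w: "w \<in> carrier_vec Nh" using AtG_carrier v by (simp add: w_def)
    have tA: "transpose_mat A \<in> carrier_mat Nh Nh" and tW: "transpose_mat W \<in> carrier_mat k Nh"
      using A W by auto
    have p: "W *\<^sub>v (transpose_mat W *\<^sub>v w) \<in> carrier_vec Nh" using W w by auto
    have AW: "A * W \<in> carrier_mat Nh k" using A W by simp
    have Gv: "G *\<^sub>v v \<in> carrier_vec Nh" using G_carrier v by simp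
    have "transpose_mat (A * W) = transpose_mat W * transpose_mat A" using transpose_mult[OF A W] .
    moreover have "A * W * (transpose_mat W * transpose_mat A) \<in> carrier_mat Nh Nh"
      by (rule mult_carrier_mat[OF AW mult_carrier_mat[OF tW tA]])
    ultimately have "A * W * transpose_mat (A * W) * G *\<^sub>v v = (A * W * (transpose_mat W * transpose_mat A)) *\<^sub>v (G *\<^sub>v v)"
      by (simp only: assoc_mult_mat_vec[OF _ G_carrier v])
    also have "\<dots> = (A * W) *\<^sub>v ((transpose_mat W * transpose_mat A) *\<^sub>v (G *\<^sub>v v))"
      using assoc_mult_mat_vec[OF AW _ Gv, of "transpose_mat W * transpose_mat A"] tW tA by simp
    also have "(transpose_mat W * transpose_mat A) *\<^sub>v (G *\<^sub>v v) = transpose_mat W *\<^sub>v w"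
      unfolding w_def using assoc_mult_mat_vec[OF tW tA Gv] assoc_mult_mat_vec[OF tA G_carrier v] by simp
    also have "(A * W) *\<^sub>v (transpose_mat W *\<^sub>v w) = A *\<^sub>v (W *\<^sub>v (transpose_mat W *\<^sub>v w))"
      using assoc_mult_mat_vec[OF A W] tW w by simp
    finally have "v - A * W * transpose_mat (A * W) * G *\<^sub>v v = A *\<^sub>v (w - W *\<^sub>v (transpose_mat W *\<^sub>v w))"
      using synthesis_analysis[OF v] mult_minus_distrib_mat_vec[OF A w p] by (simp add: w_def)
    then show ?thesis using gnorm_synthesis[of "w - W *\<^sub>v (transpose_mat W *\<^sub>v w)"] w p by (simp add: w_def)
  qed
  then show ?thesis unfolding J_hat_def Let_def using u by simp
qed

lemma g_orthonormal_coordinates: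
  assumes W: "W \<in> carrier_mat Nh k" and "g_orthonormal G (A * W)"
  shows "transpose_mat W * W = 1\<^sub>m k"
proof -
  have tA: "transpose_mat A \<in> carrier_mat Nh Nh" and tW: "transpose_mat W \<in> carrier_mat k Nh"
    using A W by auto
  have AW: "A * W \<in> carrier_mat Nh k" using A W by simp
  have "1\<^sub>m k = transpose_mat (A * W) * G * (A * W)" using assms(2) W by (simp add: g_orthonormal_def)
  also have "\<dots> = transpose_mat W * ((transpose_mat A * G * A) * W)"
    unfolding transpose_mult[OF A W]
    using assoc_mult_mat[OF tW tA G_carrier] assoc_mult_mat[OF tW AtG_carrier AW]
      assoc_mult_mat[OF AtG_carrier A W] by simp
  also have "\<dots> = transpose_mat W * W" unfolding AtGA using W by simp
  finally show ?thesis by simp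
qed

text \<open>The least number exists because the tail beyond the last eigenvalue is empty.\<close>
lemma reduced_dim_spec:
  assumes y: "0 \<le> m\<^sup>2 / (16 * measure lborel (\<Theta> \<times> {0..T})) * \<epsilon>\<^sup>2"
  shows "1 \<le> reduced_dim \<Theta> \<Theta>' T G u N \<nu>s A m \<epsilon>" and "\<And>y. y \<in> \<Theta> \<times> {0..T} \<Longrightarrow>
    sum_list (drop (reduced_dim \<Theta> \<Theta>' T G u N \<nu>s A m \<epsilon>) (sorted_eigenvalues (sample_correlation \<Theta>' G u N \<nu>s A y)))
      \<le> m\<^sup>2 / (16 * measure lborel (\<Theta> \<times> {0..T})) * \<epsilon>\<^sup>2"
proof -
  let ?P = "\<lambda>k. 1 \<le> k \<and> (\<forall>y \<in> \<Theta> \<times> {0..T}.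
        sum_list (drop k (sorted_eigenvalues (sample_correlation \<Theta>' G u N \<nu>s A y)))
          \<le> m\<^sup>2 / (16 * measure lborel (\<Theta> \<times> {0..T})) * \<epsilon>\<^sup>2)"
  have "length (sorted_eigenvalues (sample_correlation \<Theta>' G u N \<nu>s A y)) = Nh" for y
    by (rule sorted_eigenvalues_real_symmetric)
       (use A in \<open>auto intro!: eq_matI simp: sample_correlation_def Let_def mult.commute split: prod.split\<close>)
  then have "?P (max 1 Nh)" using y by simp
  then have "?P (reduced_dim \<Theta> \<Theta>' T G u N \<nu>s A m \<epsilon>)" unfolding reduced_dim_def by (rule LeastI)
  then show "1 \<le> reduced_dim \<Theta> \<Theta>' T G u N \<nu>s A m \<epsilon>" and "\<And>y. y \<in> \<Theta> \<times> {0..T} \<Longrightarrow>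
    sum_list (drop (reduced_dim \<Theta> \<Theta>' T G u N \<nu>s A m \<epsilon>) (sorted_eigenvalues (sample_correlation \<Theta>' G u N \<nu>s A y)))
      \<le> m\<^sup>2 / (16 * measure lborel (\<Theta> \<times> {0..T})) * \<epsilon>\<^sup>2" by auto
qed

text \<open>The minimizer does at least as well as the leading eigenvectors.\<close>
lemma optimal_DOD_residual:
  assumes opt: "optimal_DOD \<Theta> \<Theta>' T G u N \<nu>s A k s" and k: "k \<le> Nh"
    and y: "(\<mu>, t) \<in> \<Theta> \<times> {0..T}"
    and u: "\<And>j. j < N \<Longrightarrow> u (\<mu>, \<nu>s j, t) \<in> carrier_vec Nh"
  shows "s (\<mu>, t) \<in> carrier_mat Nh k" "transpose_mat (s (\<mu>, t)) * s (\<mu>, t) = 1\<^sub>m k"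
    "measure lborel \<Theta>' / real N * (\<Sum>j<N. let w = transpose_mat A * G *\<^sub>v u (\<mu>, \<nu>s j, t) in
       (vnorm (w - s (\<mu>, t) *\<^sub>v (transpose_mat (s (\<mu>, t)) *\<^sub>v w)))\<^sup>2)
     \<le> sum_list (drop k (sorted_eigenvalues (sample_correlation \<Theta>' G u N \<nu>s A (\<mu>, t))))"
proof -
  have min: "is_arg_min (\<lambda>W. J_hat \<Theta>' G u N \<nu>s (\<mu>, t) (A * W)) (\<lambda>W. W \<in> unit_box Nh k) (s (\<mu>, t))"
    and orth': "g_orthonormal G (A * s (\<mu>, t))"
    using opt y A unfolding optimal_DOD_def by auto
  then show s: "s (\<mu>, t) \<in> carrier_mat Nh k" by (simp add: is_arg_min_def unit_box_def)
  show "transpose_mat (s (\<mu>, t)) * s (\<mu>, t) = 1\<^sub>m k"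
    by (rule g_orthonormal_coordinates[OF s orth'])
  define w where "w j = transpose_mat A * G *\<^sub>v u (\<mu>, \<nu>s j, t)" for j
  have w: "w j \<in> carrier_vec Nh" if "j < N" for j
    unfolding w_def using AtG_carrier u[OF that] by simp
  obtain W where W: "W \<in> unit_box Nh k" and J: "measure lborel \<Theta>' / real N *
      (\<Sum>j<N. (vnorm (w j - W *\<^sub>v (transpose_mat W *\<^sub>v w j)))\<^sup>2)
       = sum_list (drop k (sorted_eigenvalues (Matrix.mat Nh Nh (\<lambda>(i, k). measure lborel \<Theta>' / real N * (\<Sum>j<N. w j $ i * w j $ k)))))"
    using gram_eigenvalue_tail[where N = N and w = w and n = Nh and k = k and \<kappa> = "measure lborel \<Theta>' / real N"] w k
    by blast
  have sc: "sample_correlation \<Theta>' G u N \<nu>s A (\<mu>, t)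
      = Matrix.mat Nh Nh (\<lambda>(i, k). measure lborel \<Theta>' / real N * (\<Sum>j<N. w j $ i * w j $ k))"
    unfolding sample_correlation_def Let_def w_def prod.case using A by simp
  have Wc: "W \<in> carrier_mat Nh k" using W by (simp add: unit_box_def)
  have "J_hat \<Theta>' G u N \<nu>s (\<mu>, t) (A * s (\<mu>, t)) \<le> J_hat \<Theta>' G u N \<nu>s (\<mu>, t) (A * W)"
    using min W by (auto simp: is_arg_min_linorder)
  also have "\<dots> = sum_list (drop k (sorted_eigenvalues (sample_correlation \<Theta>' G u N \<nu>s A (\<mu>, t))))"
    using J_hat_coordinates[OF Wc, of N u \<mu> \<nu>s t \<Theta>', OF u] J unfolding sc Let_def w_def by simp
  finally show "measure lborel \<Theta>' / real N * (\<Sum>j<N. let w = transpose_mat A * G *\<^sub>v u (\<mu>, \<nu>s j, t) in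
       (vnorm (w - s (\<mu>, t) *\<^sub>v (transpose_mat (s (\<mu>, t)) *\<^sub>v w)))\<^sup>2)
     \<le> sum_list (drop k (sorted_eigenvalues (sample_correlation \<Theta>' G u N \<nu>s A (\<mu>, t))))"
    using J_hat_coordinates[OF s, of N u \<mu> \<nu>s t \<Theta>', OF u] by simp
qed

end

section \<open>Piecewise constant DOD networks\<close>

text \<open>The projection of z approximates x when both are close to y and y is close to its own projection:
  \<open>x - P z = (x - y) + (y - P y) + P (y - z)\<close>, and P does not increase norms.\<close>
lemma cell_error:
  fixes W :: "real mat"
  assumes W: "W \<in> carrier_mat n k" "transpose_mat W * W = 1\<^sub>m k"
    and c: "x \<in> carrier_vec n" "y \<in> carrier_vec n" "z \<in> carrier_vec n"
    and xy: "vnorm (x - y) \<le> \<alpha>" and yz: "vnorm (y - z) \<le> \<beta>"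
  shows "(vnorm (x - W *\<^sub>v (transpose_mat W *\<^sub>v z)))\<^sup>2
    \<le> 2 * (vnorm (y - W *\<^sub>v (transpose_mat W *\<^sub>v y)))\<^sup>2 + 2 * (\<alpha> + \<beta>)\<^sup>2"
proof -
  have tW: "transpose_mat W \<in> carrier_mat k n" using W by simp
  define P where "P v = W *\<^sub>v (transpose_mat W *\<^sub>v v)" for v
  have P: "P v \<in> carrier_vec n" if "v \<in> carrier_vec n" for v using W tW that by (simp add: P_def)
  have tc: "transpose_mat W *\<^sub>v v \<in> carrier_vec k" if "v \<in> carrier_vec n" for v
    using tW that by (rule mult_mat_vec_carrier)
  have yzc: "y - z \<in> carrier_vec n" using c by (rule_tac minus_carrier_vec)
  have Pd: "P y - P z = P (y - z)"
    unfolding P_def mult_minus_distrib_mat_vec[OF tW c(2,3)]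
    by (rule mult_minus_distrib_mat_vec[OF W(1) tc[OF c(2)] tc[OF c(3)], symmetric])
  have "vnorm (P (y - z)) = vnorm (transpose_mat W *\<^sub>v (y - z))"
    unfolding P_def by (rule vnorm_mult_isometry[OF W tc[OF yzc]])
  also have "\<dots> \<le> vnorm (y - z)" by (rule vnorm_projection_le(1)[OF W yzc])
  finally have Pyz: "vnorm (P (y - z)) \<le> \<beta>" using yz by simp
  have "x - P z = (x - y) + ((y - P y) + P (y - z))"
  proof (rule eq_vecI)
    note dims = carrier_vecD[OF c(1)] carrier_vecD[OF c(2)] carrier_vecD[OF c(3)]
      carrier_vecD[OF P[OF c(2)]] carrier_vecD[OF P[OF c(3)]]
    show "dim_vec (x - P z) = dim_vec ((x - y) + ((y - P y) + P (y - z)))"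
      unfolding Pd[symmetric] by (simp add: dims)
    fix i assume "i < dim_vec ((x - y) + ((y - P y) + P (y - z)))"
    then have "i < n" unfolding Pd[symmetric] by (simp add: dims)
    then show "(x - P z) $ i = ((x - y) + ((y - P y) + P (y - z))) $ i"
      unfolding Pd[symmetric] by (simp add: dims)
  qed
  then have "vnorm (x - P z) \<le> vnorm (x - y) + vnorm ((y - P y) + P (y - z))"
    using c P[OF c(2)] P[OF yzc] vnorm_triangle[of "x - y" n "(y - P y) + P (y - z)"] by simp
  also have "vnorm ((y - P y) + P (y - z)) \<le> vnorm (y - P y) + vnorm (P (y - z))"
    using c P[OF c(2)] P[OF yzc] vnorm_triangle[of "y - P y" n "P (y - z)"] by simp
  finally have "vnorm (x - P z) \<le> vnorm (y - P y) + (\<alpha> + \<beta>)" using xy Pyz by simp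
  then have "(vnorm (x - P z))\<^sup>2 \<le> (vnorm (y - P y) + (\<alpha> + \<beta>))\<^sup>2" by (intro power_mono) auto
  also have "\<dots> \<le> 2 * (vnorm (y - P y))\<^sup>2 + 2 * (\<alpha> + \<beta>)\<^sup>2"
  proof -
    have "(p + q)\<^sup>2 \<le> 2 * p\<^sup>2 + 2 * q\<^sup>2" for p q :: real
      using zero_le_power2[of "p - q"] by (simp add: power2_sum power2_diff)
    then show ?thesis .
  qed
  finally show ?thesis by (simp add: P_def)
qed

text \<open>If the stacked outputs of the branches form a positive multiple of a matrix W whose columns are
  orthogonal and either unit vectors or zero, then orthonormalization returns W itself.\<close>
lemma inner_DOD_piecewise_constant:
  fixes y :: "'a::euclidean_space" and V :: "nat \<Rightarrow> real mat"
  assumes W: "W \<in> carrier_mat n k" "\<And>i j. i < k \<Longrightarrow> j < i \<Longrightarrow> col W i \<bullet> col W j = 0"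
      "\<And>j. j < k \<Longrightarrow> vnorm (col W j) \<in> {0, 1}"
    and c: "0 < c" and V: "\<And>g. g < K \<Longrightarrow> V g \<in> carrier_mat n k"
    and sum: "\<And>i j. i < n \<Longrightarrow> j < k \<Longrightarrow> (\<Sum>g<K. box_hat \<sigma> (a g) (b g) y * V g $$ (i, j)) = c * W $$ (i, j)"
  shows "inner_DOD n k
    (seed_net DIM('a) K \<sigma> (\<lambda>g i. inner (a g) (from_nat_into Basis i)) (\<lambda>g i. inner (b g) (from_nat_into Basis i)))
    (\<lambda>j. root_net K n (\<lambda>g. col (V g) j)) (coords y) = W"
proof -
  define X where "X = c \<cdot>\<^sub>m W"
  have X: "X \<in> carrier_mat n k" using W by (simp add: X_def)
  have stack: "STACK n (map (\<lambda>j. realize (net_concat (root_net K n (\<lambda>g. col (V g) j))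
      (seed_net DIM('a) K \<sigma> (\<lambda>g i. inner (a g) (from_nat_into Basis i)) (\<lambda>g i. inner (b g) (from_nat_into Basis i)))) (coords y)) [0..<k]) = X"
  proof (rule eq_matI)
    fix i j assume "i < dim_row X" "j < dim_col X"
    then have ij: "i < n" "j < k" using X by auto
    have "(\<Sum>g<K. box_hat \<sigma> (a g) (b g) y * col (V g) j $ i)
        = (\<Sum>g<K. box_hat \<sigma> (a g) (b g) y * V g $$ (i, j))"
    proof (rule sum.cong)
      fix g assume "g \<in> {..<K}"
      then have "V g \<in> carrier_mat n k" using V by simp
      then show "box_hat \<sigma> (a g) (b g) y * col (V g) j $ i = box_hat \<sigma> (a g) (b g) y * V g $$ (i, j)"
        using ij by simp
    qed simp
    moreover have "coords y \<in> carrier_vec DIM('a)" by (simp add: coords_def)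
    ultimately show "STACK n (map (\<lambda>j. realize (net_concat (root_net K n (\<lambda>g. col (V g) j))
      (seed_net DIM('a) K \<sigma> (\<lambda>g i. inner (a g) (from_nat_into Basis i)) (\<lambda>g i. inner (b g) (from_nat_into Basis i)))) (coords y)) [0..<k]) $$ (i, j) = X $$ (i, j)"
      using ij W(1) sum[OF ij] V
      by (simp add: STACK_def mat_of_cols_index realize_concat_root_seed hat_coords X_def)
  qed (use X in \<open>auto simp: STACK_def\<close>)
  have colX: "col X j = c \<cdot>\<^sub>v col W j" if "j < k" for j
    using that W(1) by (auto simp: X_def intro!: eq_vecI)
  have "ORTH X = Matrix.mat n k (\<lambda>(i, j). X $$ (i, j) / vnorm (col X j))"
  proof (rule ORTH_orthogonal_cols[OF X])
    fix i j :: nat assume "i < k" "j < i"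
    then show "col X i \<bullet> col X j = 0"
      using W(2)[of i j] W(1) by (simp add: colX)
  qed
  also have "\<dots> = W"
  proof (rule eq_matI)
    fix i j assume "i < dim_row W" "j < dim_col W"
    then have ij: "i < n" "j < k" using W by auto
    have "W $$ (i, j) = 0" if "vnorm (col W j) = 0"
    proof -
      have "(\<Sum>i<n. (col W j $ i)\<^sup>2) = 0"
        using that ij W(1) vnorm_square[of "col W j"] by (simp add: real_scalar_prod_self)
      then show ?thesis using ij W(1) by (simp add: sum_nonneg_eq_0_iff)
    qed
    then show "Matrix.mat n k (\<lambda>(i, j). X $$ (i, j) / vnorm (col X j)) $$ (i, j) = W $$ (i, j)"
      using W(3)[OF ij(2)] ij W(1) c by (auto simp: colX vnorm_smult X_def)
  qed (use W in auto)
  finally show ?thesis unfolding inner_DOD_def stack .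
qed

definition box_seed :: "nat \<Rightarrow> real \<Rightarrow> (nat \<Rightarrow> 'a::euclidean_space) \<Rightarrow> (nat \<Rightarrow> 'a) \<Rightarrow> network" where
  "box_seed K \<sigma> a b = seed_net DIM('a) K \<sigma> (\<lambda>g i. inner (a g) (from_nat_into Basis i))
     (\<lambda>g i. inner (b g) (from_nat_into Basis i))"

lemma realize_box_net:
  fixes x :: "'a::euclidean_space"
  shows "realize (net_concat (root_net K n V) (box_seed K \<sigma> a b)) (coords x)
    = Matrix.vec n (\<lambda>r. \<Sum>g<K. box_hat \<sigma> (a g) (b g) x * V g $ r)"
proof -
  have "coords x \<in> carrier_vec DIM('a)" by (simp add: coords_def)
  then show ?thesis unfolding box_seed_def by (simp add: realize_concat_root_seed hat_coords)
qed

context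
  fixes K :: nat and \<sigma> :: real and a b :: "nat \<Rightarrow> 'a::euclidean_space"
  assumes K: "1 \<le> K" and \<sigma>: "0 \<le> \<sigma>"
    and hats: "\<And>x g h. g < K \<Longrightarrow> h < K \<Longrightarrow> g \<noteq> h \<Longrightarrow> box_hat \<sigma> (a g) (b g) x = 0 \<or> box_hat \<sigma> (a h) (b h) x = 0"
begin

text \<open>The supports are disjoint, so at most one summand survives.\<close>
lemma box_hat_sum_single:
  "\<exists>g c. g < K \<and> 0 \<le> c \<and> c \<le> 1 \<and> (\<forall>f. (\<Sum>h<K. box_hat \<sigma> (a h) (b h) x * f h) = c * f g)"
proof (cases "\<exists>g<K. box_hat \<sigma> (a g) (b g) x \<noteq> 0")
  case True
  then obtain g where g: "g < K" "box_hat \<sigma> (a g) (b g) x \<noteq> 0" by blast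
  have "(\<Sum>h<K. box_hat \<sigma> (a h) (b h) x * f h) = box_hat \<sigma> (a g) (b g) x * f g" for f
  proof -
    have "(\<Sum>h<K. box_hat \<sigma> (a h) (b h) x * f h) = (\<Sum>h\<in>{g}. box_hat \<sigma> (a h) (b h) x * f h)"
      using g hats[of _ g x] by (intro sum.mono_neutral_right) auto
    then show ?thesis by simp
  qed
  then show ?thesis using g(1) box_hat_nonneg box_hat_le_1[OF \<sigma>] by blast
next
  case False
  then show ?thesis using K by (intro exI[of _ 0]) auto
qed

lemma box_hat_sum_in_box:
  assumes g: "g < K" and x: "x \<in> cbox (a g) (b g)"
  shows "(\<Sum>h<K. box_hat \<sigma> (a h) (b h) x * f h) = f g"
proof -
  have 1: "box_hat \<sigma> (a g) (b g) x = 1" using x by (rule box_hat_eq_1)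
  then have "(\<Sum>h<K. box_hat \<sigma> (a h) (b h) x * f h) = (\<Sum>h\<in>{g}. box_hat \<sigma> (a h) (b h) x * f h)"
    using g hats[of _ g x] by (intro sum.mono_neutral_right) auto
  then show ?thesis using 1 by simp
qed

lemma realize_box_net_in_box:
  assumes "g < K" "x \<in> cbox (a g) (b g)" "V g \<in> carrier_vec n"
  shows "realize (net_concat (root_net K n V) (box_seed K \<sigma> a b)) (coords x) = V g"
  unfolding realize_box_net using assms by (intro eq_vecI) (auto simp: box_hat_sum_in_box)

lemma realize_box_net_bounded:
  fixes x :: 'a
  assumes V: "\<And>g. g < K \<Longrightarrow> V g \<in> carrier_vec n" and M: "\<And>g. g < K \<Longrightarrow> vnorm (V g) \<le> M"
  shows "vnorm (realize (net_concat (root_net K n V) (box_seed K \<sigma> a b)) (coords x)) \<le> M"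
proof -
  obtain g c where g: "g < K" "0 \<le> c" "c \<le> 1"
    "\<And>f. (\<Sum>h<K. box_hat \<sigma> (a h) (b h) x * f h) = c * f g"
    using box_hat_sum_single[of x] by blast
  have "realize (net_concat (root_net K n V) (box_seed K \<sigma> a b)) (coords x) = c \<cdot>\<^sub>v V g"
    unfolding realize_box_net using V[OF g(1)] by (intro eq_vecI) (auto simp: g(4))
  moreover have "c * vnorm (V g) \<le> 1 * M" using g M by (intro mult_mono) auto
  ultimately show ?thesis using g(2) by (simp add: vnorm_smult)
qed

text \<open>Everywhere the inner module returns one of the prescribed matrices or zero; the norm bound takes
  care of the points outside all boxes.\<close>
lemma inner_DOD_contraction:
  fixes V :: "nat \<Rightarrow> real mat" and y :: 'a
  assumes V: "\<And>g. g < K \<Longrightarrow> V g \<in> carrier_mat n k"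
    "\<And>g. g < K \<Longrightarrow> transpose_mat (V g) * V g = 1\<^sub>m k \<or> V g = 0\<^sub>m n k"
  defines "W \<equiv> \<lambda>y::'a. inner_DOD n k (box_seed K \<sigma> a b) (\<lambda>j. root_net K n (\<lambda>g. col (V g) j)) (coords y)"
  shows "W y \<in> carrier_mat n k" "v \<in> carrier_vec k \<Longrightarrow> vnorm (W y *\<^sub>v v) \<le> vnorm v"
    "g < K \<Longrightarrow> y \<in> cbox (a g) (b g) \<Longrightarrow> W y = V g"
proof -
  have cols: "col (V g) i \<bullet> col (V g) j = (if i = j \<and> V g \<noteq> 0\<^sub>m n k then 1 else 0)" if "g < K" "i < k" "j < k" for g i j
    using V(2)[OF that(1)]
  proof
    assume one: "transpose_mat (V g) * V g = 1\<^sub>m k"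
    have "col (V g) i \<bullet> col (V g) j = (if i = j then 1 else 0)" if "i < k" "j < k" for i j
      using arg_cong[OF one, of "\<lambda>M. M $$ (i, j)"] V(1)[OF \<open>g < K\<close>] that by simp
    moreover from this[OF that(2,2)] have "V g \<noteq> 0\<^sub>m n k" using that(2) by auto
    ultimately show ?thesis using that by simp
  next
    assume "V g = 0\<^sub>m n k"
    then show ?thesis using that by simp
  qed
  have norms: "vnorm (col (V g) j) \<in> {0, 1}" if "g < K" "j < k" for g j
    using cols[OF that(1,2,2)] by (auto simp: vnorm_def)
  have eq: "W y = X" if "X \<in> carrier_mat n k" "0 < c"
     "\<And>i j. i < k \<Longrightarrow> j < i \<Longrightarrow> col X i \<bullet> col X j = 0" "\<And>j. j < k \<Longrightarrow> vnorm (col X j) \<in> {0, 1}"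
     "\<And>i j. i < n \<Longrightarrow> j < k \<Longrightarrow> (\<Sum>g<K. box_hat \<sigma> (a g) (b g) y * V g $$ (i, j)) = c * X $$ (i, j)" for X c
    unfolding W_def box_seed_def
    by (rule inner_DOD_piecewise_constant[OF that(1) that(3) that(4) that(2) V(1) that(5)])
  have eqV: "W y = V g" if "g < K" "0 < c" "\<And>f. (\<Sum>h<K. box_hat \<sigma> (a h) (b h) y * f h) = c * f g" for g c
    by (rule eq[of "V g" c]) (use that V cols norms in auto)
  show "g < K \<Longrightarrow> y \<in> cbox (a g) (b g) \<Longrightarrow> W y = V g"
    using eqV[of g 1] box_hat_sum_in_box[of g y] by simp
  have "W y \<in> carrier_mat n k \<and> (v \<in> carrier_vec k \<longrightarrow> vnorm (W y *\<^sub>v v) \<le> vnorm v)"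
  proof -
    obtain g c where g: "g < K" "0 \<le> c" "c \<le> 1"
      "\<And>f. (\<Sum>h<K. box_hat \<sigma> (a h) (b h) y * f h) = c * f g"
      using box_hat_sum_single[of y] by blast
    have "W y = V g \<or> W y = 0\<^sub>m n k"
    proof (cases "c = 0")
      case True
      have "W y = 0\<^sub>m n k" by (rule eq[of _ 1]) (use True g(4) in auto)
      then show ?thesis by simp
    qed (use eqV[OF g(1) _ g(4)] g(2) in auto)
    then have W: "W y \<in> carrier_mat n k" "transpose_mat (W y) * W y = 1\<^sub>m k \<or> W y = 0\<^sub>m n k"
      using V[OF g(1)] by auto
    have "vnorm (W y *\<^sub>v v) \<le> vnorm v" if v: "v \<in> carrier_vec k"
      using W(2)
    proof
      assume "transpose_mat (W y) * W y = 1\<^sub>m k"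
      then show ?thesis using vnorm_mult_isometry[OF W(1) _ v] by simp
    next
      assume 0: "W y = 0\<^sub>m n k"
      have "0\<^sub>m n k *\<^sub>v v = 0\<^sub>v n" using v by (intro eq_vecI) auto
      then show ?thesis by (simp add: 0)
    qed
    then show ?thesis using W(1) by blast
  qed
  then show "W y \<in> carrier_mat n k" "v \<in> carrier_vec k \<Longrightarrow> vnorm (W y *\<^sub>v v) \<le> vnorm v" by auto
qed

end

section \<open>Relative error and solution map\<close>

lemma rel_error_lessI:
  assumes "(\<integral>\<^sup>+ x \<in> \<Theta> \<times> \<Theta>' \<times> {0..T}. ennreal ((gnorm G (u x - uh x))\<^sup>2 / (gnorm G (u x))\<^sup>2) \<partial>lborel) \<le> ennreal B"
    and "B < \<epsilon>\<^sup>2" "0 < \<epsilon>"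
  shows "rel_error \<Theta> \<Theta>' T G u uh < ennreal \<epsilon>"
proof -
  define I where "I = (\<integral>\<^sup>+ x \<in> \<Theta> \<times> \<Theta>' \<times> {0..T}. ennreal ((gnorm G (u x - uh x))\<^sup>2 / (gnorm G (u x))\<^sup>2) \<partial>lborel)"
  have I: "I \<le> ennreal B" using assms by (simp add: I_def)
  then have fin: "I \<noteq> \<infinity>" by (auto simp: top_unique)
  have "enn2real I \<le> max 0 B" using I by (metis enn2real_mono enn2real_ennreal ennreal_less_top ennreal_max_0 max.cobounded1 max.commute)
  also have "\<dots> < \<epsilon>\<^sup>2" using assms by simp
  finally have "sqrt (enn2real I) < \<epsilon>" using assms(3) by (intro real_less_lsqrt) auto
  then show ?thesis using fin assms(3) unfolding rel_error_def I_def[symmetric] Let_def by (simp add: ennreal_lessI)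
qed

lemma rel_error_not_less:
  assumes "1 \<le> (\<integral>\<^sup>+ x \<in> \<Theta> \<times> \<Theta>' \<times> {0..T}. ennreal ((gnorm G (u x - uh x))\<^sup>2 / (gnorm G (u x))\<^sup>2) \<partial>lborel)"
    and "\<epsilon> < 1"
  shows "\<not> rel_error \<Theta> \<Theta>' T G u uh < ennreal \<epsilon>"
proof -
  define I where "I = (\<integral>\<^sup>+ x \<in> \<Theta> \<times> \<Theta>' \<times> {0..T}. ennreal ((gnorm G (u x - uh x))\<^sup>2 / (gnorm G (u x))\<^sup>2) \<partial>lborel)"
  have I: "1 \<le> I" using assms by (simp add: I_def)
  show ?thesis
  proof (cases "I = \<infinity>")
    case False
    then have "1 \<le> enn2real I" using enn2real_mono[OF I] by (simp add: less_top)
    then have "1 \<le> sqrt (enn2real I)" by simp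
    then have "ennreal \<epsilon> \<le> ennreal (sqrt (enn2real I))"
      using assms(2) by (intro ennreal_leI) linarith
    then show ?thesis using False unfolding rel_error_def I_def[symmetric] Let_def by (simp add: not_less)
  qed (unfold rel_error_def I_def[symmetric] Let_def, simp)
qed

text \<open>The second part yields, by Lipschitz continuity, an upper bound of the solution that depends only on
  m, L and the domain.\<close>
lemma solution_map_lower_bound:
  fixes \<Theta> :: "(real^'p) set" and \<Theta>' :: "(real^'q) set"
  assumes sol: "solution_map \<Theta> \<Theta>' T L m Nh G u" and cpt: "compact \<Theta>" "compact \<Theta>'"
  shows "AE x in lborel. x \<in> \<Theta> \<times> \<Theta>' \<times> {0..T} \<longrightarrow> m \<le> gnorm G (u x)"
    and "\<exists>x \<in> \<Theta> \<times> \<Theta>' \<times> {0..T}. gnorm G (u x) < m + 1"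
proof -
  let ?\<Omega> = "\<Theta> \<times> \<Theta>' \<times> {0..T}"
  let ?M = "restrict_space lborel ?\<Omega>"
  have \<Omega>: "?\<Omega> \<in> sets lborel" using cpt by (simp add: borel_compact compact_Times)
  have ess: "esssup ?M (\<lambda>x. - ereal (gnorm G (u x))) = - ereal m"
    using sol unfolding solution_map_def essinf_def by (metis ereal_uminus_uminus)
  have "AE x in ?M. - ereal (gnorm G (u x)) \<le> - ereal m"
    unfolding ess[symmetric] by (rule esssup_AE)
  then have "AE x in ?M. m \<le> gnorm G (u x)" by simp
  then show "AE x in lborel. x \<in> ?\<Omega> \<longrightarrow> m \<le> gnorm G (u x)"
    using \<Omega> by (simp add: AE_restrict_space_iff)
  show "\<exists>x \<in> ?\<Omega>. gnorm G (u x) < m + 1"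
  proof (rule ccontr)
    assume "\<not> ?thesis"
    then have big: "m + 1 \<le> gnorm G (u x)" if "x \<in> ?\<Omega>" for x using that by force
    have meas: "(\<lambda>x. - ereal (gnorm G (u x))) \<in> borel_measurable ?M"
      using ess esssup_non_measurable[of "\<lambda>x. - ereal (gnorm G (u x))" ?M]
      by (metis MInfty_neq_ereal(1) PInfty_neq_ereal(1) top_ereal_def uminus_ereal.simps(1))
    have "esssup ?M (\<lambda>x. - ereal (gnorm G (u x))) \<le> - ereal (m + 1)"
      by (rule esssup_I[OF meas], rule AE_I2) (use big in \<open>force simp: space_restrict_space\<close>)
    then show False unfolding ess by simp
  qed
qed

lemma dist_triple_le:
  fixes \<mu> \<mu>' :: "'a::metric_space" and \<nu> \<nu>' :: "'b::metric_space" and t t' :: "'c::metric_space"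
  shows "dist (\<mu>, \<nu>, t) (\<mu>', \<nu>', t') \<le> dist (\<mu>, t) (\<mu>', t') + dist \<nu> \<nu>'"
proof -
  have "dist (\<mu>, \<nu>, t) (\<mu>', \<nu>', t') = sqrt ((dist (\<mu>, t) (\<mu>', t'))\<^sup>2 + (dist \<nu> \<nu>')\<^sup>2)"
    by (simp add: dist_Pair_Pair algebra_simps)
  also have "\<dots> \<le> dist (\<mu>, t) (\<mu>', t') + dist \<nu> \<nu>'" by (rule sqrt_sum_squares_le_sum) auto
  finally show ?thesis .
qed

section \<open>Choice of the weights\<close>

text \<open>Corners of the products of the boxes of both covers, in the coordinate order \<open>(\<mu>, \<nu>, t)\<close>; the pair
  of box numbers is encoded as \<open>k = g K' + h\<close>.\<close>
definition product_corner ::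
  "nat \<Rightarrow> (nat \<Rightarrow> 'a \<times> real) \<Rightarrow> (nat \<Rightarrow> 'b) \<Rightarrow> nat \<Rightarrow> 'a::euclidean_space \<times> 'b::euclidean_space \<times> real" where
  "product_corner K' a a' k = (fst (a (k div K')), a' (k mod K'), snd (a (k div K')))"

lemma mem_product_box:
  "(\<mu>, \<nu>, t) \<in> cbox (product_corner K' a a' k) (product_corner K' b b' k) \<longleftrightarrow>
   (\<mu>, t) \<in> cbox (a (k div K')) (b (k div K')) \<and> \<nu> \<in> cbox (a' (k mod K')) (b' (k mod K'))"
proof -
  have "cbox (a g) (b g) = cbox (fst (a g)) (fst (b g)) \<times> cbox (snd (a g)) (snd (b g))" for g
    using cbox_Pair_eq[of "fst (a g)" "snd (a g)" "fst (b g)" "snd (b g)"] by simp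
  then show ?thesis unfolding product_corner_def cbox_Pair_eq by blast
qed

lemma product_boxes:
  fixes a b :: "nat \<Rightarrow> 'a::euclidean_space \<times> real" and a' b' :: "nat \<Rightarrow> 'b::euclidean_space"
  assumes ne: "\<And>g. g < K \<Longrightarrow> cbox (a g) (b g) \<noteq> {}" "\<And>g. g < K' \<Longrightarrow> cbox (a' g) (b' g) \<noteq> {}"
    and disj: "\<And>g h. g < K \<Longrightarrow> h < K \<Longrightarrow> g \<noteq> h \<Longrightarrow> cbox (a g) (b g) \<inter> cbox (a h) (b h) = {}"
    and disj': "\<And>g h. g < K' \<Longrightarrow> h < K' \<Longrightarrow> g \<noteq> h \<Longrightarrow> cbox (a' g) (b' g) \<inter> cbox (a' h) (b' h) = {}"
    and k: "k < K * K'"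
  defines "B \<equiv> \<lambda>k. cbox (product_corner K' a a' k) (product_corner K' b b' k)"
  shows "B k \<noteq> {}" "l < K * K' \<Longrightarrow> k \<noteq> l \<Longrightarrow> B k \<inter> B l = {}"
proof -
  have idx: "i div K' < K \<and> i mod K' < K'" if "i < K * K'" for i
  proof -
    have "0 < K'" using that by (cases K') auto
    then show ?thesis using that by (simp add: less_mult_imp_div_less)
  qed
  obtain y where y: "y \<in> cbox (a (k div K')) (b (k div K'))" using ne(1) idx[OF k] by blast
  obtain \<nu> where \<nu>: "\<nu> \<in> cbox (a' (k mod K')) (b' (k mod K'))" using ne(2) idx[OF k] by blast
  have "(fst y, \<nu>, snd y) \<in> B k" unfolding B_def mem_product_box using y \<nu> by simp
  then show "B k \<noteq> {}" by blast
  assume l: "l < K * K'" "k \<noteq> l"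
  then have "k div K' \<noteq> l div K' \<or> k mod K' \<noteq> l mod K'" by (metis div_mult_mod_eq)
  then have "cbox (a (k div K')) (b (k div K')) \<inter> cbox (a (l div K')) (b (l div K')) = {} \<or>
     cbox (a' (k mod K')) (b' (k mod K')) \<inter> cbox (a' (l mod K')) (b' (l mod K')) = {}"
    using disj disj' idx[OF k] idx[OF l(1)] by blast
  then show "B k \<inter> B l = {}"
    unfolding B_def by (auto simp: mem_product_box simp del: mem_box)
qed

lemma gnorm_DOD_DFNN:
  assumes spd: "spd Nh G" and A: "A \<in> carrier_mat Nh Nh" and orth: "g_orthonormal G A"
    and W: "inner_DOD Nh k S R (coords (\<mu>, t)) \<in> carrier_mat Nh k"
    and \<phi>: "realize F (coords (\<mu>, \<nu>, t)) \<in> carrier_vec k" and v: "v \<in> carrier_vec Nh"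
  shows "gnorm G (v - DOD_DFNN A k S R F (\<mu>, \<nu>, t))
    = vnorm (transpose_mat A * G *\<^sub>v v - inner_DOD Nh k S R (coords (\<mu>, t)) *\<^sub>v realize F (coords (\<mu>, \<nu>, t)))"
proof -
  define w where "w = transpose_mat A * G *\<^sub>v v"
  have w: "w \<in> carrier_vec Nh" unfolding w_def using AtG_carrier[OF spd A orth] v by (rule mult_mat_vec_carrier)
  define p where "p = inner_DOD Nh k S R (coords (\<mu>, t)) *\<^sub>v realize F (coords (\<mu>, \<nu>, t))"
  have p: "p \<in> carrier_vec Nh" unfolding p_def using W \<phi> by (rule mult_mat_vec_carrier)
  have "DOD_DFNN A k S R F (\<mu>, \<nu>, t) = A *\<^sub>v p"
    using A assoc_mult_mat_vec[OF A W \<phi>] by (simp add: DOD_DFNN_def p_def)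
  then have "v - DOD_DFNN A k S R F (\<mu>, \<nu>, t) = A *\<^sub>v (w - p)"
    using synthesis_analysis[OF spd A orth v] mult_minus_distrib_mat_vec[OF A w p] by (simp add: w_def)
  moreover have "w - p \<in> carrier_vec Nh" using p by (rule minus_carrier_vec[OF w])
  ultimately show ?thesis using gnorm_synthesis[OF spd A orth] unfolding w_def p_def by simp
qed

text \<open>The central estimate. It concerns one fixed sample that puts more than the fraction \<open>p - \<gamma>\<close> of its
  points into every box of \<open>\<Theta>'\<close> of probability p, so the matrices and vectors that
  are stored in the networks may depend on the sample.\<close>
lemma DOD_DFNN_error_representative_sample:
  fixes \<Theta> :: "(real^'p) set" and \<Theta>' :: "(real^'q) set" and T :: real and K' :: nat
    and a b :: "nat \<Rightarrow> (real^'p) \<times> real" and a' b' :: "nat \<Rightarrow> real^'q"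
    and u :: "(real^'p) \<times> (real^'q) \<times> real \<Rightarrow> real Matrix.vec"
  defines "Y \<equiv> \<Theta> \<times> {0..T}" and "\<Omega> \<equiv> \<Theta> \<times> \<Theta>' \<times> {0..T}"
    and "a2 \<equiv> product_corner K' a a'" and "b2 \<equiv> product_corner K' b b'"
  assumes cpt: "compact \<Theta>" "compact \<Theta>'" and pos: "0 < measure lborel Y" "0 < measure lborel \<Theta>'"
    and "0 < m" "0 < L" "0 < \<epsilon>" "0 \<le> M" "0 \<le> \<eta>" "0 \<le> \<kappa>" "0 \<le> \<gamma>"
    and sol: "solution_map \<Theta> \<Theta>' T L m Nh G u"
    and A: "A \<in> carrier_mat Nh Nh" and orth: "g_orthonormal G A"
    and bound: "\<And>x. x \<in> \<Omega> \<Longrightarrow> gnorm G (u x) \<le> M"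
    and boxes: "box_cover Y \<eta> \<kappa> K a b" and boxes': "box_cover \<Theta>' \<eta> \<kappa> K' a' b'"
    and \<sigma>: "0 \<le> \<sigma>" "\<And>x g h. g < K \<Longrightarrow> h < K \<Longrightarrow> g \<noteq> h \<Longrightarrow>
        box_hat \<sigma> (a g) (b g) x = 0 \<or> box_hat \<sigma> (a h) (b h) x = 0"
    and \<sigma>2: "0 \<le> \<sigma>2" "\<And>x k l. k < K * K' \<Longrightarrow> l < K * K' \<Longrightarrow> k \<noteq> l \<Longrightarrow>
        box_hat \<sigma>2 (a2 k) (b2 k) x = 0 \<or> box_hat \<sigma>2 (a2 l) (b2 l) x = 0"
    and n: "0 < n" and \<nu>s: "\<And>j. j < n \<Longrightarrow> \<nu>s j \<in> \<Theta>'"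
    and freq: "\<And>g. g < K' \<Longrightarrow> measure lborel (cbox (a' g) (b' g) \<inter> \<Theta>') / measure lborel \<Theta>' - \<gamma>
      < real (card {j. j < n \<and> \<nu>s j \<in> cbox (a' g) (b' g)}) / real n"
    and N': "N' = reduced_dim \<Theta> \<Theta>' T G u n \<nu>s A m \<epsilon>" "N' < Nh"
    and opt: "optimal_DOD \<Theta> \<Theta>' T G u n \<nu>s A N' s"
    and const: "measure lborel Y * (2 * (m\<^sup>2 / (16 * measure lborel Y) * \<epsilon>\<^sup>2)
         + measure lborel \<Theta>' * (18 * L\<^sup>2 * \<eta>\<^sup>2 + real K' * \<gamma> * (4 * M\<^sup>2)))
         + 4 * M\<^sup>2 * (\<kappa> * (measure lborel Y + measure lborel \<Theta>')) < m\<^sup>2 * \<epsilon>\<^sup>2"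
  shows "\<exists>V VF. rel_error \<Theta> \<Theta>' T G u (DOD_DFNN A N' (box_seed K \<sigma> a b) (\<lambda>j. root_net K Nh (\<lambda>g. col (V g) j))
      (net_concat (root_net (K * K') N' VF) (box_seed (K * K') \<sigma>2 a2 b2))) < ennreal \<epsilon>"
proof -
  note K = box_coverD(1)[OF boxes] box_coverD(1)[OF boxes']
  note disj = box_coverD(3)[OF boxes] and disj' = box_coverD(3)[OF boxes']
  note diam = box_coverD(4)[OF boxes] and diam' = box_coverD(4)[OF boxes']
  note cover = box_coverD(5)[OF boxes] and cover' = box_coverD(5)[OF boxes']
  have spd: "spd Nh G" and uc: "\<And>x. x \<in> \<Omega> \<Longrightarrow> u x \<in> carrier_vec Nh"
    and lip: "\<And>x y. x \<in> \<Omega> \<Longrightarrow> y \<in> \<Omega> \<Longrightarrow> gnorm G (u x - u y) \<le> L * dist x y"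
    using sol by (auto simp: solution_map_def \<Omega>_def)
  define w where "w x = transpose_mat A * G *\<^sub>v u x" for x
  have w: "w x \<in> carrier_vec Nh" if "x \<in> \<Omega>" for x
    unfolding w_def using AtG_carrier[OF spd A orth] uc[OF that] by (rule mult_mat_vec_carrier)
  have w_norm: "gnorm G (u x) = vnorm (w x)" if "x \<in> \<Omega>" for x
    unfolding w_def by (rule gnorm_analysis[OF spd A orth uc[OF that]])
  have wM: "vnorm (w x) \<le> M" if "x \<in> \<Omega>" for x
    using bound[OF that] w_norm[OF that] by simp
  have w_lip: "vnorm (w x - w y) \<le> L * dist x y" if "x \<in> \<Omega>" "y \<in> \<Omega>" for x y
  proof -
    have "u x - u y \<in> carrier_vec Nh" using uc that by simp
    then have "gnorm G (u x - u y) = vnorm (w x - w y)"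
      using gnorm_analysis[OF spd A orth] analysis_diff[OF spd A orth] uc that by (simp add: w_def)
    then show ?thesis using lip[OF that] by simp
  qed
  define J where "J = m\<^sup>2 / (16 * measure lborel Y) * \<epsilon>\<^sup>2"
  have J: "0 \<le> J" using pos by (simp add: J_def)
  have u_sample: "u (\<mu>, \<nu>s j, t) \<in> carrier_vec Nh" if "(\<mu>, t) \<in> Y" "j < n" for \<mu> t j
    using that \<nu>s by (intro uc) (auto simp: Y_def \<Omega>_def)
  have tail: "1 \<le> N'" "\<And>y. y \<in> Y \<Longrightarrow>
    sum_list (drop N' (sorted_eigenvalues (sample_correlation \<Theta>' G u n \<nu>s A y))) \<le> J"
    using reduced_dim_spec[OF spd A orth, where \<Theta> = \<Theta> and T = T and N = n and u = u and \<nu>s = \<nu>s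
      and m = m and \<epsilon> = \<epsilon> and \<Theta>' = \<Theta>'] J
    unfolding N'(1) Y_def J_def by auto
  define R where "R W x = (vnorm (x - W *\<^sub>v (transpose_mat W *\<^sub>v x)))\<^sup>2" for W :: "real mat" and x
  have s: "s y \<in> carrier_mat Nh N'" "transpose_mat (s y) * s y = 1\<^sub>m N'"
    "measure lborel \<Theta>' / real n * (\<Sum>j<n. R (s y) (w (fst y, \<nu>s j, snd y))) \<le> J" if y: "y \<in> Y" for y
  proof -
    obtain \<mu> t where yt: "y = (\<mu>, t)" by (cases y)
    have us: "u (\<mu>, \<nu>s j, t) \<in> carrier_vec Nh" if "j < n" for j using u_sample y yt that by simp
    have y': "(\<mu>, t) \<in> \<Theta> \<times> {0..T}" using y yt by (simp add: Y_def)
    note o = optimal_DOD_residual[OF spd A orth opt less_imp_le[OF N'(2)] y' us]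
    show "s y \<in> carrier_mat Nh N'" "transpose_mat (s y) * s y = 1\<^sub>m N'" using o(1,2) yt by auto
    show "measure lborel \<Theta>' / real n * (\<Sum>j<n. R (s y) (w (fst y, \<nu>s j, snd y))) \<le> J"
      using o(3) tail(2)[OF y] unfolding yt R_def w_def Let_def fst_conv snd_conv by linarith
  qed
  \<comment> \<open>Reference points of the boxes that meet the domain; for the other boxes zero is stored.\<close>
  define occ where "occ g \<longleftrightarrow> cbox (a g) (b g) \<inter> Y \<noteq> {}" for g
  define occ' where "occ' g \<longleftrightarrow> cbox (a' g) (b' g) \<inter> \<Theta>' \<noteq> {}" for g
  define yc where "yc g = (SOME y. y \<in> cbox (a g) (b g) \<inter> Y)" for g
  define \<nu>c where "\<nu>c g = (SOME \<nu>. \<nu> \<in> cbox (a' g) (b' g) \<inter> \<Theta>')" for g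
  have yc: "yc g \<in> cbox (a g) (b g)" "yc g \<in> Y" if "occ g" for g
    using that someI_ex[of "\<lambda>y. y \<in> cbox (a g) (b g) \<inter> Y"] unfolding occ_def yc_def by blast+
  have \<nu>c: "\<nu>c g \<in> cbox (a' g) (b' g)" "\<nu>c g \<in> \<Theta>'" if "occ' g" for g
    using that someI_ex[of "\<lambda>y. y \<in> cbox (a' g) (b' g) \<inter> \<Theta>'"] unfolding occ'_def \<nu>c_def by blast+
  define xc where "xc g g' = (fst (yc g), \<nu>c g', snd (yc g))" for g g'
  have xc: "xc g g' \<in> \<Omega>" if "occ g" "occ' g'" for g g'
    using yc[OF that(1)] \<nu>c[OF that(2)] by (auto simp: xc_def \<Omega>_def Y_def mem_Times_iff)
  define V where "V g = (if occ g then s (yc g) else 0\<^sub>m Nh N')" for g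
  define VF where "VF k = (if occ (k div K') \<and> occ' (k mod K')
     then transpose_mat (s (yc (k div K'))) *\<^sub>v w (xc (k div K') (k mod K')) else 0\<^sub>v N')" for k
  have V: "V g \<in> carrier_mat Nh N'" "transpose_mat (V g) * V g = 1\<^sub>m N' \<or> V g = 0\<^sub>m Nh N'" for g
    using s yc by (auto simp: V_def)
  have VF: "VF k \<in> carrier_vec N'" "vnorm (VF k) \<le> M" for k
  proof -
    have "VF k \<in> carrier_vec N' \<and> vnorm (VF k) \<le> M"
    proof (cases "occ (k div K') \<and> occ' (k mod K')")
      case True
      define y x where "y = yc (k div K')" and "x = xc (k div K') (k mod K')"
      have y: "y \<in> Y" and x: "x \<in> \<Omega>" using True yc xc by (auto simp: y_def x_def)
      have "vnorm (transpose_mat (s y) *\<^sub>v w x) \<le> M"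
        using vnorm_projection_le(1)[OF s(1,2)[OF y] w[OF x]] wM[OF x] by simp
      moreover have "transpose_mat (s y) *\<^sub>v w x \<in> carrier_vec N'"
        using s(1)[OF y] w[OF x] by simp
      ultimately show ?thesis using True by (simp add: VF_def y_def x_def)
    next
      case False
      then have "VF k = 0\<^sub>v N'" by (auto simp: VF_def)
      then show ?thesis using \<open>0 \<le> M\<close> by simp
    qed
    then show "VF k \<in> carrier_vec N'" "vnorm (VF k) \<le> M" by auto
  qed
  \<comment> \<open>In coordinates, the reconstruction at \<open>(\<mu>, \<nu>, t)\<close> is \<open>W (\<mu>, t)\<close> applied to \<open>\<phi> (\<mu>, \<nu>, t)\<close>.\<close>
  define W where "W y = inner_DOD Nh N' (box_seed K \<sigma> a b) (\<lambda>j. root_net K Nh (\<lambda>g. col (V g) j)) (coords y)"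
    for y :: "(real^'p) \<times> real"
  define F where "F = net_concat (root_net (K * K') N' VF) (box_seed (K * K') \<sigma>2 a2 b2)"
  define \<phi> where "\<phi> x = realize F (coords x)" for x :: "(real^'p) \<times> (real^'q) \<times> real"
  have KK: "1 \<le> K * K'" using K by simp
  have W: "W y \<in> carrier_mat Nh N'" "\<And>v. v \<in> carrier_vec N' \<Longrightarrow> vnorm (W y *\<^sub>v v) \<le> vnorm v"
    "\<And>g. g < K \<Longrightarrow> y \<in> cbox (a g) (b g) \<Longrightarrow> W y = V g" for y
    using inner_DOD_contraction[where K = K and \<sigma> = \<sigma> and a = a and b = b and V = V and n = Nh and k = N' and y = y]
      K(1) \<sigma> V unfolding W_def by blast+
  have \<phi>c: "\<phi> x \<in> carrier_vec N'" for x by (simp add: \<phi>_def F_def realize_box_net)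
  have \<phi>M: "vnorm (\<phi> x) \<le> M" for x
    unfolding \<phi>_def F_def by (rule realize_box_net_bounded[OF KK \<sigma>2 VF])
  have \<phi>_box: "\<phi> x = VF k" if "k < K * K'" "x \<in> cbox (a2 k) (b2 k)" for x k
    unfolding \<phi>_def F_def by (rule realize_box_net_in_box[where K = "K * K'" and \<sigma> = \<sigma>2 and a = a2 and b = b2 and V = VF and n = N'
          and g = k and x = x, OF KK \<sigma>2 that VF(1)])
  define uh :: "(real^'p) \<times> (real^'q) \<times> real \<Rightarrow> real Matrix.vec" where "uh = DOD_DFNN A N' (box_seed K \<sigma> a b) (\<lambda>j. root_net K Nh (\<lambda>g. col (V g) j)) F"
  define e where "e x = vnorm (w x - W (fst x, snd (snd x)) *\<^sub>v \<phi> x)" for x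
  have e: "gnorm G (u x - uh x) = e x" if x: "x \<in> \<Omega>" for x
  proof -
    obtain \<mu> \<nu> t where eq: "x = (\<mu>, \<nu>, t)" by (metis surj_pair)
    show ?thesis
      using gnorm_DOD_DFNN[OF spd A orth W(1)[unfolded W_def] \<phi>c[unfolded \<phi>_def] uc[OF x], where \<mu> = \<mu> and t = t and \<nu> = \<nu>]
      unfolding uh_def e_def w_def W_def \<phi>_def eq by simp
  qed
  have Wphi: "W y *\<^sub>v \<phi> x \<in> carrier_vec Nh" for x y using W(1) \<phi>c by (rule mult_mat_vec_carrier)
  have e_le: "(e x)\<^sup>2 \<le> 4 * M\<^sup>2" if x: "x \<in> \<Omega>" for x
  proof -
    have "e x \<le> vnorm (w x) + vnorm (W (fst x, snd (snd x)) *\<^sub>v \<phi> x)"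
      unfolding e_def by (rule vnorm_diff_triangle[OF w[OF x] Wphi])
    also have "\<dots> \<le> M + M" using wM[OF x] W(2)[OF \<phi>c] \<phi>M by (intro add_mono order_trans[OF W(2)[OF \<phi>c] \<phi>M])
    finally have "(e x)\<^sup>2 \<le> (2 * M)\<^sup>2" by (intro power_mono) (auto simp: e_def)
    then show ?thesis by (simp add: power_mult_distrib)
  qed
  have cell: "(e (\<mu>, \<nu>, t))\<^sup>2 \<le> 2 * R (s (yc g)) (w (fst (yc g), \<nu>s j, snd (yc g))) + 18 * L\<^sup>2 * \<eta>\<^sup>2"
    if g: "g < K" "g' < K'" and j: "j < n" "\<nu>s j \<in> cbox (a' g') (b' g')"
      and x: "(\<mu>, \<nu>, t) \<in> \<Omega>" "(\<mu>, t) \<in> cbox (a g) (b g)" "\<nu> \<in> cbox (a' g') (b' g')" for g g' j \<mu> \<nu> t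
  proof -
    have occ: "occ g" "occ' g'" using x by (auto simp: occ_def occ'_def \<Omega>_def Y_def simp del: mem_box)
    define z where "z = (fst (yc g), \<nu>s j, snd (yc g))"
    have z: "z \<in> \<Omega>" using yc(2)[OF occ(1)] \<nu>s[OF j(1)] by (auto simp: z_def \<Omega>_def Y_def mem_Times_iff)
    define k where "k = g * K' + g'"
    have k: "k div K' = g" "k mod K' = g'" using g by (auto simp: k_def)
    have kK: "k < K * K'"
    proof -
      have "k < g * K' + K'" using g by (simp add: k_def)
      also have "\<dots> = (g + 1) * K'" by simp
      also have "\<dots> \<le> K * K'" using g by (intro mult_le_mono1) simp
      finally show ?thesis .
    qed
    have "(\<mu>, \<nu>, t) \<in> cbox (a2 k) (b2 k)" unfolding a2_def b2_def mem_product_box k using x by simp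
    then have phi: "\<phi> (\<mu>, \<nu>, t) = transpose_mat (s (yc g)) *\<^sub>v w (xc g g')"
      using \<phi>_box[OF kK] occ by (simp add: VF_def k)
    have Wg: "W (\<mu>, t) = s (yc g)" using W(3)[OF g(1) x(2)] occ by (simp add: V_def)
    \<comment> \<open>z shares the parameter \<open>\<mu>\<close> and the time of the reference point and the sample's \<open>\<nu>\<close>.\<close>
    have d1: "dist (\<mu>, \<nu>, t) z \<le> 2 * \<eta>"
      using dist_triple_le[of \<mu> \<nu> t "fst (yc g)" "\<nu>s j" "snd (yc g)"] diam[OF g(1) x(2) yc(1)[OF occ(1)]]
        diam'[OF g(2) x(3) j(2)] by (simp add: z_def)
    have d2: "dist z (xc g g') \<le> \<eta>"
      using dist_triple_le[of "fst (yc g)" "\<nu>s j" "snd (yc g)" "fst (yc g)" "\<nu>c g'" "snd (yc g)"]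
        diam'[OF g(2) j(2) \<nu>c(1)[OF occ(2)]] by (simp add: z_def xc_def)
    have "(vnorm (w (\<mu>, \<nu>, t) - s (yc g) *\<^sub>v (transpose_mat (s (yc g)) *\<^sub>v w (xc g g'))))\<^sup>2
       \<le> 2 * R (s (yc g)) (w z) + 2 * (L * (2 * \<eta>) + L * \<eta>)\<^sup>2"
      unfolding R_def
    proof (rule cell_error[OF s(1,2)[OF yc(2)[OF occ(1)]] w[OF x(1)] w[OF z] w[OF xc[OF occ]]])
      show "vnorm (w (\<mu>, \<nu>, t) - w z) \<le> L * (2 * \<eta>)"
        using w_lip[OF x(1) z] d1 \<open>0 < L\<close> by (meson less_imp_le mult_left_mono order_trans)
      show "vnorm (w z - w (xc g g')) \<le> L * \<eta>"
        using w_lip[OF z xc[OF occ]] d2 \<open>0 < L\<close> by (meson less_imp_le mult_left_mono order_trans)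
    qed
    also have "2 * (L * (2 * \<eta>) + L * \<eta>)\<^sup>2 = 18 * L\<^sup>2 * \<eta>\<^sup>2" by (simp add: power2_eq_square algebra_simps)
    finally show ?thesis by (simp add: e_def phi Wg z_def)
  qed
  define r where "r g j = R (s (yc g)) (w (fst (yc g), \<nu>s j, snd (yc g))) / m\<^sup>2" for g j
  have m2: "0 < m\<^sup>2" using \<open>0 < m\<close> by simp
  have "(\<integral>\<^sup>+x\<in>\<Omega>. ennreal ((gnorm G (u x - uh x))\<^sup>2 / (gnorm G (u x))\<^sup>2) \<partial>lborel)
    \<le> ennreal (measure lborel Y * (2 * (J / m\<^sup>2) + measure lborel \<Theta>' * (18 * L\<^sup>2 * \<eta>\<^sup>2 / m\<^sup>2 + real K' * \<gamma> * (4 * M\<^sup>2 / m\<^sup>2)))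
        + 4 * M\<^sup>2 / m\<^sup>2 * (\<kappa> * (measure lborel Y + measure lborel \<Theta>')))"
    unfolding Y_def \<Omega>_def
  proof (rule error_integral_bound[where E = "\<lambda>x. (e x)\<^sup>2 / m\<^sup>2" and r = r])
    show "AE x in lborel. x \<in> \<Theta> \<times> \<Theta>' \<times> {0..T} \<longrightarrow>
        (gnorm G (u x - uh x))\<^sup>2 / (gnorm G (u x))\<^sup>2 \<le> (e x)\<^sup>2 / m\<^sup>2"
      using solution_map_lower_bound(1)[OF sol cpt]
    proof eventually_elim
      case (elim x)
      show ?case
      proof
        assume x: "x \<in> \<Theta> \<times> \<Theta>' \<times> {0..T}"
        then have "m\<^sup>2 \<le> (gnorm G (u x))\<^sup>2" using elim \<open>0 < m\<close> by (intro power_mono) auto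
        then show "(gnorm G (u x - uh x))\<^sup>2 / (gnorm G (u x))\<^sup>2 \<le> (e x)\<^sup>2 / m\<^sup>2"
          using e[of x] x m2 by (auto simp: \<Omega>_def intro!: frac_le)
      qed
    qed
    show "(e (\<mu>, \<nu>, t))\<^sup>2 / m\<^sup>2 \<le> 2 * r g j + 18 * L\<^sup>2 * \<eta>\<^sup>2 / m\<^sup>2"
      if "g < K" "g' < K'" "j < n" "\<nu>s j \<in> cbox (a' g') (b' g')" "(\<mu>, \<nu>, t) \<in> \<Theta> \<times> \<Theta>' \<times> {0..T}"
        "(\<mu>, t) \<in> cbox (a g) (b g)" "\<nu> \<in> cbox (a' g') (b' g')" for g g' j \<mu> \<nu> t
      using divide_right_mono[OF cell[OF that(1-4) that(5)[folded \<Omega>_def] that(6,7)], of "m\<^sup>2"]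
      by (simp add: r_def add_divide_distrib)
    show "measure lborel \<Theta>' / real n * (\<Sum>j<n. r g j) \<le> J / m\<^sup>2"
      if "g < K" "cbox (a g) (b g) \<inter> (\<Theta> \<times> {0..T}) \<noteq> {}" for g
    proof -
      have "occ g" using that by (simp add: occ_def Y_def)
      from divide_right_mono[OF s(3)[OF yc(2)[OF this]], of "m\<^sup>2"] show ?thesis
        by (simp add: r_def sum_divide_distrib[symmetric])
    qed
    show "0 \<le> r g j" for g j by (simp add: r_def R_def)
    show "(e x)\<^sup>2 / m\<^sup>2 \<le> 4 * M\<^sup>2 / m\<^sup>2" if "x \<in> \<Theta> \<times> \<Theta>' \<times> {0..T}" for x
      using e_le[of x] that by (intro divide_right_mono) (auto simp: \<Omega>_def)
  qed (use cpt pos disj disj' cover cover' n freq J \<open>0 \<le> \<gamma>\<close> \<open>0 \<le> \<kappa>\<close> in \<open>auto simp: Y_def simp del: mem_box\<close>)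
  moreover have "measure lborel Y * (2 * (J / m\<^sup>2) + measure lborel \<Theta>' * (18 * L\<^sup>2 * \<eta>\<^sup>2 / m\<^sup>2 + real K' * \<gamma> * (4 * M\<^sup>2 / m\<^sup>2)))
        + 4 * M\<^sup>2 / m\<^sup>2 * (\<kappa> * (measure lborel Y + measure lborel \<Theta>')) < \<epsilon>\<^sup>2" (is "?lhs < _")
  proof -
    have "?lhs = (measure lborel Y * (2 * J
         + measure lborel \<Theta>' * (18 * L\<^sup>2 * \<eta>\<^sup>2 + real K' * \<gamma> * (4 * M\<^sup>2)))
         + 4 * M\<^sup>2 * (\<kappa> * (measure lborel Y + measure lborel \<Theta>'))) / m\<^sup>2"
    proof -
      have "y * (2 * (j / q) + v * (p / q + l * (c / q))) + c / q * d = (y * (2 * j + v * (p + l * c)) + c * d) / q"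
        if "q \<noteq> 0" for y j q v p l c d :: real
        using that by (simp add: field_simps)
      then show ?thesis using m2 by simp
    qed
    also have "\<dots> < \<epsilon>\<^sup>2" using const m2 by (simp add: J_def pos_divide_less_eq mult.commute)
    finally show ?thesis .
  qed
  ultimately have "rel_error \<Theta> \<Theta>' T G u uh < ennreal \<epsilon>"
    unfolding \<Omega>_def using \<open>0 < \<epsilon>\<close> by (rule rel_error_lessI)
  then show ?thesis unfolding uh_def F_def by blast
qed

text \<open>With slope \<open>\<sigma> = 0\<close> every bump is identically 1, and the same architectures realize constants. The
  first column of the DOD matrix is set to the first POD mode and the reduced coefficient to c, which
  exceeds the bound M of the solution by so much that the relative error is at least 1.\<close>
lemma DOD_DFNN_large_error_weights:
  fixes \<Theta> :: "(real^'p) set" and \<Theta>' :: "(real^'q) set" and T :: real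
    and u :: "(real^'p) \<times> (real^'q) \<times> real \<Rightarrow> real Matrix.vec"
  defines "\<Omega> \<equiv> \<Theta> \<times> \<Theta>' \<times> {0..T}"
  assumes cpt: "compact \<Theta>" "compact \<Theta>'" and pos: "0 < measure lborel \<Omega>"
    and "0 < m" "0 < M" "\<epsilon> < 1" and N': "1 \<le> N'" "1 \<le> Nh" and K: "1 \<le> K" "1 \<le> K2"
    and sol: "solution_map \<Theta> \<Theta>' T L m Nh G u"
    and A: "A \<in> carrier_mat Nh Nh" and orth: "g_orthonormal G A"
    and bound: "\<And>x. x \<in> \<Omega> \<Longrightarrow> gnorm G (u x) \<le> M"
  shows "\<exists>V VF. \<not> rel_error \<Theta> \<Theta>' T G u (DOD_DFNN A N' (box_seed K 0 (\<lambda>_. 0 :: (real^'p) \<times> real) (\<lambda>_. 0))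
      (\<lambda>j. root_net K Nh (\<lambda>g. col (V g) j))
      (net_concat (root_net K2 N' VF) (box_seed K2 0 (\<lambda>_. 0 :: (real^'p) \<times> (real^'q) \<times> real) (\<lambda>_. 0)))) < ennreal \<epsilon>"
proof -
  have spd: "spd Nh G" and uc: "\<And>x. x \<in> \<Omega> \<Longrightarrow> u x \<in> carrier_vec Nh"
    using sol by (auto simp: solution_map_def \<Omega>_def)
  \<comment> \<open>chosen such that the squared relative error is at least the constant \<open>1 / measure \<Omega>\<close>\<close>
  define c where "c = M + M / sqrt (measure lborel \<Omega>)"
  have c: "0 < c" using \<open>0 < M\<close> pos by (simp add: c_def add_pos_pos)
  define W0 :: "real mat" where "W0 = Matrix.mat Nh N' (\<lambda>(i, j). if i = 0 \<and> j = 0 then 1 else 0)"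
  have W0: "W0 \<in> carrier_mat Nh N'" by (simp add: W0_def)
  define V where "V g = (if g = 0 then W0 else 0\<^sub>m Nh N')" for g :: nat
  define VF where "VF k = (if k = 0 then c \<cdot>\<^sub>v unit_vec N' 0 else 0\<^sub>v N')" for k :: nat
  have hat1: "box_hat 0 a b x = 1" for a b x :: "'a::euclidean_space" by (simp add: box_hat_def)
  have colW0: "col W0 j = (if j = 0 then unit_vec Nh 0 else 0\<^sub>v Nh)" if "j < N'" for j
    using that by (auto simp: W0_def intro!: eq_vecI)
  have W: "inner_DOD Nh N' (box_seed K 0 (\<lambda>_. 0 :: (real^'p) \<times> real) (\<lambda>_. 0)) (\<lambda>j. root_net K Nh (\<lambda>g. col (V g) j)) (coords y) = W0"
    for y :: "(real^'p) \<times> real"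
    unfolding box_seed_def
  proof (rule inner_DOD_piecewise_constant[where c = 1])
    show "(\<Sum>g<K. box_hat 0 0 0 y * V g $$ (i, j)) = 1 * W0 $$ (i, j)" if "i < Nh" "j < N'" for i j
    proof -
      have "(\<Sum>g<K. box_hat 0 0 0 y * V g $$ (i, j)) = (\<Sum>g<K. if g = 0 then W0 $$ (i, j) else 0)"
        using that by (intro sum.cong) (auto simp: hat1 V_def)
      then show ?thesis using K by simp
    qed
    show "vnorm (col W0 j) \<in> {0, 1}" if "j < N'" for j
      using N' that by (simp add: colW0 vnorm_def)
  qed (use W0 N' in \<open>auto simp: V_def colW0\<close>)
  define F where "F = net_concat (root_net K2 N' VF) (box_seed K2 0 (\<lambda>_. 0 :: (real^'p) \<times> (real^'q) \<times> real) (\<lambda>_. 0))"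
  have F: "realize F (coords x) = c \<cdot>\<^sub>v unit_vec N' 0" for x :: "(real^'p) \<times> (real^'q) \<times> real"
  proof (rule eq_vecI)
    fix i assume "i < dim_vec (c \<cdot>\<^sub>v unit_vec N' 0)"
    then have i: "i < N'" by simp
    have "(\<Sum>g<K2. box_hat 0 0 0 x * VF g $ i) = (\<Sum>g<K2. if g = 0 then c * unit_vec N' 0 $ i else 0)"
      using i by (intro sum.cong) (auto simp: hat1 VF_def)
    then show "realize F (coords x) $ i = (c \<cdot>\<^sub>v unit_vec N' 0) $ i"
      using i K by (simp add: F_def realize_box_net)
  qed (simp add: F_def realize_box_net)
  define uh :: "(real^'p) \<times> (real^'q) \<times> real \<Rightarrow> real Matrix.vec"
    where "uh = DOD_DFNN A N' (box_seed K 0 (\<lambda>_. 0 :: (real^'p) \<times> real) (\<lambda>_. 0)) (\<lambda>j. root_net K Nh (\<lambda>g. col (V g) j)) F"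
  have We: "W0 *\<^sub>v (c \<cdot>\<^sub>v unit_vec N' 0) = c \<cdot>\<^sub>v unit_vec Nh 0"
    by (rule eq_vecI) (use N' in \<open>auto simp: W0_def scalar_prod_def mult_delta_left\<close>)
  have far: "M / sqrt (measure lborel \<Omega>) \<le> gnorm G (u x - uh x)" if x: "x \<in> \<Omega>" for x
  proof -
    obtain \<mu> \<nu> t where eq: "x = (\<mu>, \<nu>, t)" by (metis surj_pair)
    define w where "w = transpose_mat A * G *\<^sub>v u x"
    have w: "w \<in> carrier_vec Nh" unfolding w_def using AtG_carrier[OF spd A orth] uc[OF x] by (rule mult_mat_vec_carrier)
    have "vnorm w \<le> M" using bound[OF x] gnorm_analysis[OF spd A orth uc[OF x]] by (simp add: w_def)
    moreover have "vnorm (w - (w - c \<cdot>\<^sub>v unit_vec Nh 0)) = c"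
    proof -
      have "w - (w - c \<cdot>\<^sub>v unit_vec Nh 0) = c \<cdot>\<^sub>v unit_vec Nh 0"
        using carrier_vecD[OF w] by (intro eq_vecI) auto
      then show ?thesis using N' c by (simp add: vnorm_smult vnorm_def)
    qed
    moreover have "vnorm (w - (w - c \<cdot>\<^sub>v unit_vec Nh 0)) \<le> vnorm w + vnorm (w - c \<cdot>\<^sub>v unit_vec Nh 0)"
      using w by (intro vnorm_diff_triangle[of _ Nh]) auto
    ultimately have "M / sqrt (measure lborel \<Omega>) \<le> vnorm (w - c \<cdot>\<^sub>v unit_vec Nh 0)"
      using c_def by linarith
    moreover have "gnorm G (u x - uh x) = vnorm (w - c \<cdot>\<^sub>v unit_vec Nh 0)"
      unfolding uh_def eq
      by (subst gnorm_DOD_DFNN[OF spd A orth]) (use W W0 F uc[OF x] in \<open>simp_all add: eq w_def We\<close>)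
    ultimately show ?thesis by simp
  qed
  have \<Omega>: "\<Omega> \<in> fmeasurable lborel"
    unfolding \<Omega>_def using cpt by (intro fmeasurable_compact compact_Times) auto
  have "1 = ennreal (1 / measure lborel \<Omega>) * emeasure lborel \<Omega>"
  proof -
    have "emeasure lborel \<Omega> = ennreal (measure lborel \<Omega>)"
      using \<Omega> by (intro emeasure_eq_ennreal_measure) (auto simp: fmeasurable_def)
    then show ?thesis using pos by (simp add: ennreal_mult[symmetric])
  qed
  also have "\<dots> = (\<integral>\<^sup>+x\<in>\<Omega>. ennreal (1 / measure lborel \<Omega>) \<partial>lborel)"
    using fmeasurableD[OF \<Omega>] by (rule nn_integral_cmult_indicator[symmetric])
  also have "\<dots> \<le> (\<integral>\<^sup>+x\<in>\<Omega>. ennreal ((gnorm G (u x - uh x))\<^sup>2 / (gnorm G (u x))\<^sup>2) \<partial>lborel)"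
  proof (rule nn_integral_mono_AE)
    show "AE x in lborel. ennreal (1 / measure lborel \<Omega>) * indicator \<Omega> x
      \<le> ennreal ((gnorm G (u x - uh x))\<^sup>2 / (gnorm G (u x))\<^sup>2) * indicator \<Omega> x"
      using solution_map_lower_bound(1)[OF sol cpt]
    proof eventually_elim
      case (elim x)
      show ?case
      proof (cases "x \<in> \<Omega>")
        case True
        then have g: "0 < gnorm G (u x)" "gnorm G (u x) \<le> M" using elim \<open>0 < m\<close> bound by (auto simp: \<Omega>_def)
        have "1 / measure lborel \<Omega> = (M / sqrt (measure lborel \<Omega>))\<^sup>2 / M\<^sup>2"
          using pos \<open>0 < M\<close> by (simp add: power_divide)
        also have "\<dots> \<le> (gnorm G (u x - uh x))\<^sup>2 / (gnorm G (u x))\<^sup>2"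
          using far[OF True] g \<open>0 < M\<close> pos by (intro frac_le power_mono) auto
        finally show ?thesis using True by (simp add: ennreal_leI)
      qed simp
    qed
  qed
  finally have "\<not> rel_error \<Theta> \<Theta>' T G u uh < ennreal \<epsilon>"
    unfolding \<Omega>_def using \<open>\<epsilon> < 1\<close> by (rule rel_error_not_less)
  then show ?thesis unfolding uh_def F_def by blast
qed

lemma sample_measure_prob:
  assumes "compact \<Theta>'" "0 < measure lborel (\<Theta>' :: (real^'q) set)"
  shows "prob_space (uniform_measure lborel \<Theta>')" "prob_space (sample_measure \<Theta>' n)"
    and "B \<in> sets lborel \<Longrightarrow> measure (uniform_measure lborel \<Theta>') B = measure lborel (B \<inter> \<Theta>') / measure lborel \<Theta>'"
    and "measure (sample_measure \<Theta>' n) ({..<n} \<rightarrow>\<^sub>E \<Theta>') = 1"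
    and "{..<n} \<rightarrow>\<^sub>E \<Theta>' \<in> sets (sample_measure \<Theta>' n)"
proof -
  have f: "\<Theta>' \<in> fmeasurable lborel" using assms(1) by (rule fmeasurable_compact)
  have em: "emeasure lborel \<Theta>' \<noteq> 0" "emeasure lborel \<Theta>' \<noteq> \<infinity>"
    using assms(2) f by (auto simp: measure_def fmeasurable_def)
  show U: "prob_space (uniform_measure lborel \<Theta>')" by (rule prob_space_uniform_measure[OF em])
  then show S: "prob_space (sample_measure \<Theta>' n)" unfolding sample_measure_def by (intro prob_space_PiM)
  show "measure (uniform_measure lborel \<Theta>') B = measure lborel (B \<inter> \<Theta>') / measure lborel \<Theta>'"
    if "B \<in> sets lborel"
    using measure_uniform_measure[OF em that] by (simp add: Int_commute)
  show sets: "{..<n} \<rightarrow>\<^sub>E \<Theta>' \<in> sets (sample_measure \<Theta>' n)"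
    unfolding sample_measure_def using f by (intro sets_PiM_I_finite) (auto simp: fmeasurable_def)
  interpret prob_space "sample_measure \<Theta>' n" by (rule S)
  interpret product_prob_space "\<lambda>_. uniform_measure lborel \<Theta>'" "{..<n}"
    by unfold_locales (use U in \<open>auto simp: prob_space_def prob_space_axioms_def finite_measure_def sigma_finite_measure_def\<close>)
  have "emeasure (uniform_measure lborel \<Theta>') \<Theta>' = 1"
    using f em by (simp add: emeasure_uniform_measure ennreal_divide_self fmeasurable_def less_top)
  moreover have "emeasure (sample_measure \<Theta>' n) ({..<n} \<rightarrow>\<^sub>E \<Theta>') = (\<Prod>j<n. emeasure (uniform_measure lborel \<Theta>') \<Theta>')"
    unfolding sample_measure_def using f by (intro emeasure_PiM) (auto simp: fmeasurable_def)
  ultimately show "measure (sample_measure \<Theta>' n) ({..<n} \<rightarrow>\<^sub>E \<Theta>') = 1" by (simp add: measure_def)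
qed

section \<open>Complexity and conclusion\<close>

lemma inner_architecture_seed_root:
  "inner_architecture d n k (seed_arch d K) (\<lambda>_. root_arch K n)"
  using well_shaped_seed_arch[of d K] well_shaped_root_arch[of K n] by (auto simp: inner_architecture_def)

lemma inner_layers_seed_root:
  assumes "1 \<le> k"
  shows "inner_layers k (seed_arch d K) (\<lambda>_. root_arch K n) = 4"
proof -
  have "length ` set (inner_branches k (seed_arch d K) (\<lambda>_. root_arch K n)) = {4}"
    using assms by (auto simp: inner_branches_def length_concat_root_seed image_image intro!: image_eqI[of _ _ 0])
  then show ?thesis by (simp add: inner_layers_def)
qed

lemma inner_weights_seed_root:
  assumes "1 \<le> K" "1 \<le> n"
  shows "inner_weights k (seed_arch d K) (\<lambda>_. root_arch K n) \<le> k * ((2 * d\<^sup>2 + 5 * d + 5) * (n * K))"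
proof -
  have "inner_weights k (seed_arch d K) (\<lambda>_. root_arch K n)
      = k * active_weights (arch_concat (root_arch K n) (seed_arch d K))"
    by (simp add: inner_weights_def inner_branches_def o_def sum_list_triv)
  then show ?thesis using active_weights_concat_root_seed[OF assms, of d] by simp
qed

text \<open>Turns the linear count of weights into the bound of the theorem: a power of \<open>1/\<epsilon>\<close> bounds
  the number of boxes, and \<open>ln(1/\<epsilon>)\<close> is bounded below.\<close>
lemma scaled_weight_bound:
  fixes c0 C \<epsilon> \<epsilon>0 x :: real
  assumes "0 < \<epsilon>" "\<epsilon> \<le> \<epsilon>0" "\<epsilon>0 < 1" "0 \<le> x" "0 \<le> D" "K \<le> C * (1 / \<epsilon>) ^ d" "0 \<le> c"
    "D * C / ln (1 / \<epsilon>0) \<le> c"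
  shows "D * (x * K) \<le> c * x * (1 / \<epsilon>) ^ d * ln (1 / \<epsilon>)"
proof -
  have l0: "0 < ln (1 / \<epsilon>0)" using assms by (intro ln_gt_zero) auto
  have l: "ln (1 / \<epsilon>0) \<le> ln (1 / \<epsilon>)" using assms by (intro iffD2[OF ln_le_cancel_iff]) (auto simp: field_simps)
  have "D * (x * K) \<le> D * (x * (C * (1 / \<epsilon>) ^ d))" using assms by (intro mult_left_mono) auto
  also have "\<dots> = (D * C) * (x * (1 / \<epsilon>) ^ d)" by simp
  also have "\<dots> \<le> (c * ln (1 / \<epsilon>0)) * (x * (1 / \<epsilon>) ^ d)"
    using assms l0 by (intro mult_right_mono) (auto simp: pos_divide_le_eq)
  also have "\<dots> \<le> (c * ln (1 / \<epsilon>)) * (x * (1 / \<epsilon>) ^ d)"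
    using assms l by (intro mult_right_mono mult_left_mono) auto
  finally show ?thesis by (simp add: mult_ac)
qed

text \<open>The four sources of error, namely the eigenvalue tail, the diameter of the cells, the deficit of the
  empirical frequencies and the set outside the cells, contribute at most \<open>m\<^sup>2 \<epsilon>\<^sup>2 / 8\<close> each.\<close>
lemma error_budget:
  fixes y t m M L \<epsilon> c0 \<eta> \<kappa> \<gamma> K' :: real
  assumes "0 < y" "0 < t" "0 < m" "0 < M" "0 < L" "0 < \<epsilon>" "0 < K'"
    and c0: "0 < c0" "c0 \<le> m / (12 * L * sqrt (y * t))"
    and "\<eta> = c0 * \<epsilon>" "\<kappa> = m\<^sup>2 * \<epsilon>\<^sup>2 / (32 * M\<^sup>2 * (y + t))" "\<gamma> = m\<^sup>2 * \<epsilon>\<^sup>2 / (32 * K' * M\<^sup>2 * (y * t))"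
  shows "y * (2 * (m\<^sup>2 / (16 * y) * \<epsilon>\<^sup>2) + t * (18 * L\<^sup>2 * \<eta>\<^sup>2 + K' * \<gamma> * (4 * M\<^sup>2)))
         + 4 * M\<^sup>2 * (\<kappa> * (y + t)) < m\<^sup>2 * \<epsilon>\<^sup>2"
proof -
  have q: "0 < m\<^sup>2 * \<epsilon>\<^sup>2" using assms by simp
  have "(c0 * (12 * L * sqrt (y * t)))\<^sup>2 \<le> m\<^sup>2"
    using assms by (intro power_mono) (auto simp: pos_le_divide_eq)
  then have "144 * (c0\<^sup>2 * L\<^sup>2 * (y * t)) \<le> m\<^sup>2"
    using assms by (simp add: power_mult_distrib mult_ac)
  then have "144 * (c0\<^sup>2 * L\<^sup>2 * (y * t)) * \<epsilon>\<^sup>2 \<le> m\<^sup>2 * \<epsilon>\<^sup>2" by (intro mult_right_mono) auto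
  then have 1: "y * t * (18 * L\<^sup>2 * \<eta>\<^sup>2) \<le> m\<^sup>2 * \<epsilon>\<^sup>2 / 8"
    using assms by (simp add: power_mult_distrib mult_ac)
  have 2: "y * (2 * (m\<^sup>2 / (16 * y) * \<epsilon>\<^sup>2)) = m\<^sup>2 * \<epsilon>\<^sup>2 / 8" using assms by simp
  have 3: "y * t * (K' * \<gamma> * (4 * M\<^sup>2)) = m\<^sup>2 * \<epsilon>\<^sup>2 / 8" using assms by simp
  have 4: "4 * M\<^sup>2 * (\<kappa> * (y + t)) = m\<^sup>2 * \<epsilon>\<^sup>2 / 8" using assms by simp
  have "y * (2 * (m\<^sup>2 / (16 * y) * \<epsilon>\<^sup>2) + t * (18 * L\<^sup>2 * \<eta>\<^sup>2 + K' * \<gamma> * (4 * M\<^sup>2))) + 4 * M\<^sup>2 * (\<kappa> * (y + t))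
     = y * (2 * (m\<^sup>2 / (16 * y) * \<epsilon>\<^sup>2)) + y * t * (18 * L\<^sup>2 * \<eta>\<^sup>2) + y * t * (K' * \<gamma> * (4 * M\<^sup>2)) + 4 * M\<^sup>2 * (\<kappa> * (y + t))"
    by (simp only: distrib_left mult.assoc)
  also have "\<dots> \<le> m\<^sup>2 * \<epsilon>\<^sup>2 / 8 + m\<^sup>2 * \<epsilon>\<^sup>2 / 8 + m\<^sup>2 * \<epsilon>\<^sup>2 / 8 + m\<^sup>2 * \<epsilon>\<^sup>2 / 8"
    using 1 unfolding 2 3 4 by linarith
  also have "\<dots> < m\<^sup>2 * \<epsilon>\<^sup>2" using q by linarith
  finally show ?thesis .
qed

theorem theorem6:
  fixes \<Theta> :: "(real^'p) set" and \<Theta>' :: "(real^'q) set"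
    and T L Lh m \<epsilon>0 :: real
  assumes "compact \<Theta>" "compact \<Theta>'" "measure lborel \<Theta> > 0" "measure lborel \<Theta>' > 0"
    and "T > 0" "L > 0" "Lh \<ge> 0" "m > 0" "0 < \<epsilon>0" "\<epsilon>0 < 1"
  shows "\<exists>c :: nat \<Rightarrow> real. \<forall>\<epsilon> \<delta>. 0 < \<epsilon> \<and> \<epsilon> \<le> \<epsilon>0 \<and> 0 < \<delta> \<and> \<delta> < 1 \<longrightarrow>
    (\<exists>Ns2 \<ge> 1. \<forall>Nh NA G u Ns1 \<mu>s Nt A.
      solution_map \<Theta> \<Theta>' T L m Nh G u \<and> NA = Nh \<and>
      Ns1 \<ge> 1 \<and> Ns1 * Ns2 \<ge> 2 \<and> Nt \<ge> 2 \<and> (\<forall>i<Ns1. \<mu>s i \<in> \<Theta>) \<and>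
      (\<forall>\<nu>s \<in> {..<Ns2} \<rightarrow>\<^sub>E \<Theta>'. is_POD \<Theta> \<Theta>' T Nh G u Ns1 \<mu>s Ns2 \<nu>s Nt NA (A \<nu>s)) \<and>
      (AE \<nu>s in sample_measure \<Theta>' Ns2.
         let N' = reduced_dim \<Theta> \<Theta>' T G u Ns2 \<nu>s (A \<nu>s) m \<epsilon>
         in N' < NA \<and>
            (\<exists>s. optimal_DOD \<Theta> \<Theta>' T G u Ns2 \<nu>s (A \<nu>s) N' s \<and>
                 frobenius_lipschitz Lh (\<Theta> \<times> {0..T}) s))
      \<longrightarrow>
      (\<exists>(S :: nat \<Rightarrow> architecture) (R :: nat \<Rightarrow> nat \<Rightarrow> architecture) (F :: nat \<Rightarrow> architecture).
        (\<forall>N'. 1 \<le> N' \<and> N' < NA \<longrightarrow>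
           inner_architecture (CARD('p) + 1) NA N' (S N') (R N') \<and>
           well_shaped (CARD('p) + CARD('q) + 1) N' (F N') \<and>
           real (inner_layers N' (S N') (R N')) \<le> c N' * ln (1 / \<epsilon>) \<and>
           real (inner_weights N' (S N') (R N'))
             \<le> c N' * real NA * real N' * (1 / \<epsilon>) ^ (CARD('p) + 1) * ln (1 / \<epsilon>) \<and>
           real (length (F N')) \<le> c N' * ln (1 / \<epsilon>) \<and>
           real (active_weights (F N'))
             \<le> c N' * real N' * (1 / \<epsilon>) ^ (CARD('p) + CARD('q) + 1) * ln (1 / \<epsilon>)) \<and>
        (\<exists>(wS :: (nat \<Rightarrow> real^'q) \<Rightarrow> network) (wR :: (nat \<Rightarrow> real^'q) \<Rightarrow> nat \<Rightarrow> network)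
            (wF :: (nat \<Rightarrow> real^'q) \<Rightarrow> network).
          (\<forall>\<nu>s \<in> {..<Ns2} \<rightarrow>\<^sub>E \<Theta>'.
             let N' = reduced_dim \<Theta> \<Theta>' T G u Ns2 \<nu>s (A \<nu>s) m \<epsilon>
             in N' < NA \<longrightarrow> fits (S N') (wS \<nu>s) \<and> (\<forall>i<N'. fits (R N' i) (wR \<nu>s i)) \<and>
                fits (F N') (wF \<nu>s)) \<and>
          measure (sample_measure \<Theta>' Ns2)
            {\<nu>s \<in> {..<Ns2} \<rightarrow>\<^sub>E \<Theta>'.
               rel_error \<Theta> \<Theta>' T G u
                 (DOD_DFNN (A \<nu>s) (reduced_dim \<Theta> \<Theta>' T G u Ns2 \<nu>s (A \<nu>s) m \<epsilon>)
                    (wS \<nu>s) (wR \<nu>s) (wF \<nu>s)) < ennreal \<epsilon>}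
            > 1 - \<delta>)))"
proof -
  define Y where "Y = \<Theta> \<times> {0..T}"
  define \<Omega> where "\<Omega> = \<Theta> \<times> \<Theta>' \<times> {0..T}"
  define y0 where "y0 = measure lborel Y"
  define t0 where "t0 = measure lborel \<Theta>'"
  have cY: "compact Y" and c\<Omega>: "compact \<Omega>"
    unfolding Y_def \<Omega>_def using assms(1,2) by (auto intro!: compact_Times)
  have borel: "\<Theta> \<in> sets borel" "\<Theta>' \<in> sets borel" "{0..T} \<in> sets borel"
    using assms(1,2) by (simp_all add: borel_compact)
  have mT: "measure lborel {0..T} = T" using \<open>T > 0\<close> by simp
  have y0: "0 < y0"
    unfolding y0_def Y_def measure_lborel_Times[OF borel(1,3)] mT using assms(3) \<open>T > 0\<close> by simp
  have t0: "0 < t0" using assms(4) by (simp add: t0_def)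
  have \<Omega>pos: "0 < measure lborel \<Omega>"
    unfolding \<Omega>_def measure_lborel_Times[OF borel(1) borel_Times[OF borel(2,3)]]
      measure_lborel_Times[OF borel(2,3)] mT using assms(3,4) \<open>T > 0\<close> by simp
  \<comment> \<open>an upper bound of the norm of the solution that is independent of the solution map\<close>
  define M where "M = m + 1 + L * diameter \<Omega>"
  have M: "0 < M" unfolding M_def using assms diameter_ge_0[OF compact_imp_bounded[OF c\<Omega>]]
    by (intro add_pos_nonneg) auto
  obtain C1 where C1: "1 \<le> C1" and grid1: "\<And>h \<kappa>. 0 < h \<Longrightarrow> h \<le> 1 \<Longrightarrow> 0 < \<kappa> \<Longrightarrow>
      \<exists>K a b. real K \<le> (C1 / h) ^ DIM((real^'p) \<times> real) \<and> box_cover Y h \<kappa> K a b"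
    using grid_boxes[OF cY] by blast
  obtain C2 where C2: "1 \<le> C2" and grid2: "\<And>h \<kappa>. 0 < h \<Longrightarrow> h \<le> 1 \<Longrightarrow> 0 < \<kappa> \<Longrightarrow>
      \<exists>K a b. real K \<le> (C2 / h) ^ DIM(real^'q) \<and> box_cover \<Theta>' h \<kappa> K a b"
    using grid_boxes[OF assms(2)] by blast
  \<comment> \<open>the ratio of the diameter of the boxes to \<open>\<epsilon>\<close>, see \<open>error_budget\<close>; at most 1 so that the diameter is at most 1\<close>
  define c0 where "c0 = min 1 (m / (12 * L * sqrt (y0 * t0)))"
  have c0: "0 < c0" "c0 \<le> 1" "c0 \<le> m / (12 * L * sqrt (y0 * t0))"
    using assms y0 t0 by (auto simp: c0_def)
  define d1 where "d1 = CARD('p) + 1"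
  define d2 where "d2 = CARD('p) + CARD('q) + 1"
  define l0 where "l0 = ln (1 / \<epsilon>0)"
  have l0: "0 < l0" unfolding l0_def using assms by (intro ln_gt_zero) auto
  define D where "D d = real (2 * d\<^sup>2 + 5 * d + 5)" for d :: nat
  define Q1 where "Q1 = (C1 / c0) ^ d1"
  define Q2 where "Q2 = (C1 / c0) ^ d1 * (C2 / c0) ^ CARD('q)"
  have Q: "0 \<le> Q1" "0 \<le> Q2" using C1 C2 c0 by (auto simp: Q1_def Q2_def)
  define cc where "cc = 4 / l0 + D d1 * Q1 / l0 + D d2 * Q2 / l0"
  have cc: "4 / l0 \<le> cc" "D d1 * Q1 / l0 \<le> cc" "D d2 * Q2 / l0 \<le> cc" "0 \<le> cc"
    using l0 Q by (auto simp: cc_def D_def add_nonneg_nonneg)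
  show ?thesis
  proof (intro exI[of _ "\<lambda>_. cc"] allI impI, goal_cases)
    case (1 \<epsilon> \<delta>)
    then have \<epsilon>: "0 < \<epsilon>" "\<epsilon> \<le> \<epsilon>0" "\<epsilon> < 1" and \<delta>: "0 < \<delta>" "\<delta> < 1" using assms by auto
    have l: "l0 \<le> ln (1 / \<epsilon>)" unfolding l0_def using \<epsilon> by (intro iffD2[OF ln_le_cancel_iff]) (auto simp: field_simps)
    define \<eta> where "\<eta> = c0 * \<epsilon>"
    define \<kappa> where "\<kappa> = m\<^sup>2 * \<epsilon>\<^sup>2 / (32 * M\<^sup>2 * (y0 + t0))"
    have \<eta>: "0 < \<eta>" "\<eta> \<le> 1" using c0 \<epsilon> by (auto simp: \<eta>_def intro: mult_le_one)
    have \<kappa>: "0 < \<kappa>" using assms M y0 t0 \<epsilon> by (auto simp: \<kappa>_def)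
    obtain K a b where KC: "real K \<le> (C1 / \<eta>) ^ DIM((real^'p) \<times> real)" and boxes: "box_cover Y \<eta> \<kappa> K a b"
      using grid1[OF \<eta> \<kappa>] by blast
    obtain K' a' b' where KC': "real K' \<le> (C2 / \<eta>) ^ DIM(real^'q)" and boxes': "box_cover \<Theta>' \<eta> \<kappa> K' a' b'"
      using grid2[OF \<eta> \<kappa>] by blast
    note K = box_coverD(1)[OF boxes] and ne = box_coverD(2)[OF boxes] and disj = box_coverD(3)[OF boxes]
    note K' = box_coverD(1)[OF boxes'] and ne' = box_coverD(2)[OF boxes'] and disj' = box_coverD(3)[OF boxes']
    define \<gamma> where "\<gamma> = m\<^sup>2 * \<epsilon>\<^sup>2 / (32 * real K' * M\<^sup>2 * (y0 * t0))"
    have \<gamma>: "0 < \<gamma>" using assms M y0 t0 \<epsilon> K' by (auto simp: \<gamma>_def)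
    have const: "y0 * (2 * (m\<^sup>2 / (16 * y0) * \<epsilon>\<^sup>2) + t0 * (18 * L\<^sup>2 * \<eta>\<^sup>2 + real K' * \<gamma> * (4 * M\<^sup>2)))
         + 4 * M\<^sup>2 * (\<kappa> * (y0 + t0)) < m\<^sup>2 * \<epsilon>\<^sup>2"
      by (rule error_budget[OF y0 t0 \<open>m > 0\<close> M \<open>L > 0\<close> \<epsilon>(1) _ c0(1,3) \<eta>_def \<kappa>_def \<gamma>_def]) (use K' in auto)
    define a2 where "a2 = product_corner K' a a'"
    define b2 where "b2 = product_corner K' b b'"
    note pb = product_boxes[where a = a and b = b and a' = a' and b' = b' and K = K and K' = K', OF ne ne' disj disj',
        folded a2_def b2_def]
    have "\<exists>\<sigma>>0. \<forall>x. \<forall>g<K. \<forall>h<K. g \<noteq> h \<longrightarrow> box_hat \<sigma> (a g) (b g) x = 0 \<or> box_hat \<sigma> (a h) (b h) x = 0"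
      by (rule disjoint_boxes_disjoint_hats[OF ne disj])
    then obtain \<sigma> where \<sigma>: "0 < \<sigma>" "\<And>x g h. g < K \<Longrightarrow> h < K \<Longrightarrow> g \<noteq> h \<Longrightarrow>
        box_hat \<sigma> (a g) (b g) x = 0 \<or> box_hat \<sigma> (a h) (b h) x = 0"
      by blast
    have "\<exists>\<sigma>2>0. \<forall>x. \<forall>k<K * K'. \<forall>l<K * K'. k \<noteq> l \<longrightarrow>
        box_hat \<sigma>2 (a2 k) (b2 k) x = 0 \<or> box_hat \<sigma>2 (a2 l) (b2 l) x = 0"
      by (rule disjoint_boxes_disjoint_hats) (rule pb, assumption+)+
    then obtain \<sigma>2 where \<sigma>2: "0 < \<sigma>2" "\<And>x k l. k < K * K' \<Longrightarrow> l < K * K' \<Longrightarrow> k \<noteq> l \<Longrightarrow>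
        box_hat \<sigma>2 (a2 k) (b2 k) x = 0 \<or> box_hat \<sigma>2 (a2 l) (b2 l) x = 0"
      by blast
    note sm = sample_measure_prob[OF assms(2,4)]
    obtain n E where n: "1 \<le> n" and E: "E \<in> sets (sample_measure \<Theta>' n)" "measure (sample_measure \<Theta>' n) E > 1 - \<delta>"
      and freq: "\<And>\<nu>s g. \<nu>s \<in> E \<Longrightarrow> g < K' \<Longrightarrow> measure lborel (cbox (a' g) (b' g) \<inter> \<Theta>') / measure lborel \<Theta>' - \<gamma>
        < real (card {j. j < n \<and> \<nu>s j \<in> cbox (a' g) (b' g)}) / real n"
    proof -
      have "\<exists>n\<ge>1. \<exists>E\<in>sets (sample_measure \<Theta>' n). measure (sample_measure \<Theta>' n) E > 1 - \<delta> \<and>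
         (\<forall>\<nu>s\<in>E. \<forall>g<K'. measure (uniform_measure lborel \<Theta>') (cbox (a' g) (b' g)) - \<gamma>
           < real (card {j. j < n \<and> \<nu>s j \<in> cbox (a' g) (b' g)}) / real n)"
        unfolding sample_measure_def
        by (rule frequencies_uniformly_large[OF sm(1) _ \<gamma> \<delta>(1)]) simp
      then obtain n E where nE: "1 \<le> n" "E \<in> sets (sample_measure \<Theta>' n)" "measure (sample_measure \<Theta>' n) E > 1 - \<delta>"
        and fr: "\<And>\<nu>s g. \<nu>s \<in> E \<Longrightarrow> g < K' \<Longrightarrow> measure (uniform_measure lborel \<Theta>') (cbox (a' g) (b' g)) - \<gamma>
           < real (card {j. j < n \<and> \<nu>s j \<in> cbox (a' g) (b' g)}) / real n"
        by blast
      have "measure (uniform_measure lborel \<Theta>') (cbox (a' g) (b' g)) = measure lborel (cbox (a' g) (b' g) \<inter> \<Theta>') / measure lborel \<Theta>'" for g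
        by (rule sm(3)) simp
      then show ?thesis using that[OF nE] fr by simp
    qed
    have K_bound: "real K \<le> Q1 * (1 / \<epsilon>) ^ d1"
    proof -
      have "real K \<le> (C1 / c0 * (1 / \<epsilon>)) ^ d1" using KC by (simp add: \<eta>_def d1_def)
      then show ?thesis by (simp only: Q1_def power_mult_distrib)
    qed
    have KK_bound: "real (K * K') \<le> Q2 * (1 / \<epsilon>) ^ d2"
    proof -
      have K'b: "real K' \<le> (C2 / c0) ^ CARD('q) * (1 / \<epsilon>) ^ CARD('q)"
      proof -
        have "real K' \<le> (C2 / c0 * (1 / \<epsilon>)) ^ CARD('q)" using KC' by (simp add: \<eta>_def)
        then show ?thesis by (simp only: power_mult_distrib)
      qed
      have "real (K * K') \<le> (Q1 * (1 / \<epsilon>) ^ d1) * ((C2 / c0) ^ CARD('q) * (1 / \<epsilon>) ^ CARD('q))"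
        unfolding of_nat_mult using K_bound K'b Q \<epsilon> by (intro mult_mono) auto
      also have "\<dots> = Q2 * (1 / \<epsilon>) ^ (d1 + CARD('q))" by (simp only: Q1_def Q2_def power_add mult_ac)
      finally show ?thesis by (simp only: d1_def d2_def ac_simps)
    qed
    show ?case
    proof (intro exI[of _ n] conjI n allI impI, elim conjE, goal_cases)
      case (1 Nh NA G u Ns1 \<mu>s Nt A)
      note sol = 1(1) and NA = 1(2) and POD = 1(7) and ae = 1(8)
      define P where "P = {..<n} \<rightarrow>\<^sub>E \<Theta>'"
      define N' where "N' \<nu>s = reduced_dim \<Theta> \<Theta>' T G u n \<nu>s (A \<nu>s) m \<epsilon>" for \<nu>s
      have spd: "spd Nh G" and uc: "\<And>x. x \<in> \<Omega> \<Longrightarrow> u x \<in> carrier_vec Nh"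
        and lip: "\<And>x y. x \<in> \<Omega> \<Longrightarrow> y \<in> \<Omega> \<Longrightarrow> gnorm G (u x - u y) \<le> L * dist x y"
        using sol by (auto simp: solution_map_def \<Omega>_def)
      have A: "A \<nu>s \<in> carrier_mat Nh Nh" "g_orthonormal G (A \<nu>s)" if "\<nu>s \<in> P" for \<nu>s
        using is_POD_full[of \<Theta> \<Theta>' T Nh G u Ns1 \<mu>s n \<nu>s Nt "A \<nu>s"] POD that NA by (auto simp: P_def)
      interpret S: prob_space "sample_measure \<Theta>' n" by (rule sm(2))
      obtain Z where Z: "Z \<in> null_sets (sample_measure \<Theta>' n)"
        and nice: "\<And>\<nu>s. \<nu>s \<in> space (sample_measure \<Theta>' n) \<Longrightarrow> \<nu>s \<notin> Z \<Longrightarrow>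
          N' \<nu>s < Nh \<and> (\<exists>s. optimal_DOD \<Theta> \<Theta>' T G u n \<nu>s (A \<nu>s) (N' \<nu>s) s)"
        using ae unfolding Let_def NA N'_def[symmetric] by (rule AE_E3) blast
      \<comment> \<open>E fixes the frequencies, P puts the samples into \<open>\<Theta>'\<close>, and outside Z the hypotheses on the sample hold.\<close>
      define Good where "Good = E \<inter> P - Z"
      have Good: "Good \<in> sets (sample_measure \<Theta>' n)"
        using E(1) sm(5) Z by (auto simp: Good_def P_def)
      have "measure (sample_measure \<Theta>' n) Good = measure (sample_measure \<Theta>' n) E"
      proof (rule S.finite_measure_eq_AE[OF _ Good E(1)])
        have "AE \<nu>s in sample_measure \<Theta>' n. \<nu>s \<in> P"
          using sm(4,5) S.prob_eq_1 unfolding P_def by blast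
        moreover have "AE \<nu>s in sample_measure \<Theta>' n. \<nu>s \<notin> Z" using Z by (rule AE_not_in)
        ultimately show "AE \<nu>s in sample_measure \<Theta>' n. \<nu>s \<in> Good \<longleftrightarrow> \<nu>s \<in> E"
          by eventually_elim (auto simp: Good_def)
      qed
      then have prob: "measure (sample_measure \<Theta>' n) Good > 1 - \<delta>" using E(2) by simp
      have Good_nice: "\<nu>s \<in> P" "\<nu>s \<in> E" "N' \<nu>s < Nh" "\<exists>s. optimal_DOD \<Theta> \<Theta>' T G u n \<nu>s (A \<nu>s) (N' \<nu>s) s"
        if "\<nu>s \<in> Good" for \<nu>s
        using that nice[of \<nu>s] sets.sets_into_space[OF E(1)] by (auto simp: Good_def)
      have "Good \<noteq> {}" using prob \<delta> by auto
      then obtain \<nu>0 where \<nu>0: "\<nu>0 \<in> Good" by blast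
      have Nh: "1 \<le> Nh" using Good_nice(3)[OF \<nu>0] by simp
      have bound: "gnorm G (u x) \<le> M" if x: "x \<in> \<Omega>" for x
      proof -
        obtain x0 where x0: "x0 \<in> \<Omega>" "gnorm G (u x0) < m + 1"
          using solution_map_lower_bound(2)[OF sol assms(1,2)] unfolding \<Omega>_def by blast
        have "gnorm G (u x) \<le> gnorm G (u x0) + gnorm G (u x - u x0)"
          by (rule gnorm_triangle[OF spd A[OF Good_nice(1)[OF \<nu>0]] uc[OF x] uc[OF x0(1)]])
        also have "gnorm G (u x - u x0) \<le> L * diameter \<Omega>"
          using lip[OF x x0(1)] diameter_bounded_bound[OF compact_imp_bounded[OF c\<Omega>] x x0(1)] \<open>L > 0\<close>
          by (meson less_imp_le mult_left_mono order_trans)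
        finally show ?thesis using x0(2) by (simp add: M_def)
      qed
      have N'1: "1 \<le> N' \<nu>s" if "\<nu>s \<in> P" for \<nu>s
        unfolding N'_def by (rule reduced_dim_spec(1)[OF spd A[OF that]]) simp
      define S0 where "S0 = (\<lambda>_::nat. seed_arch d1 K)"
      define R0 where "R0 = (\<lambda>(_::nat) (_::nat). root_arch K Nh)"
      define F0 where "F0 = (\<lambda>k. arch_concat (root_arch (K * K') k) (seed_arch d2 (K * K')))"
      have dims: "DIM((real^'p) \<times> real) = d1" "DIM((real^'p) \<times> (real^'q) \<times> real) = d2"
        by (simp_all add: d1_def d2_def)
      have KK: "1 \<le> K * K'" using K K' by simp
      have fits1: "fits (S0 k) (box_seed K s l h)" for k s and l h :: "nat \<Rightarrow> (real^'p) \<times> real"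
        unfolding S0_def box_seed_def dims by (rule fits_seed)
      have fits2: "fits (R0 k i) (root_net K Nh V)" for k i V
        unfolding R0_def by (rule fits_root)
      have fits3: "fits (F0 k) (net_concat (root_net (K * K') k V) (box_seed (K * K') s l h))"
        for k V s and l h :: "nat \<Rightarrow> (real^'p) \<times> (real^'q) \<times> real"
        unfolding F0_def box_seed_def dims by (rule fits_concat_root_seed)
      \<comment> \<open>The equivalence with membership in Good makes the event of success measurable.\<close>
      define suitable where "suitable \<nu>s w \<longleftrightarrow> fits (S0 (N' \<nu>s)) (fst w) \<and> (\<forall>i. fits (R0 (N' \<nu>s) i) (fst (snd w) i)) \<and>
          fits (F0 (N' \<nu>s)) (snd (snd w)) \<and>
          (rel_error \<Theta> \<Theta>' T G u (DOD_DFNN (A \<nu>s) (N' \<nu>s) (fst w) (fst (snd w)) (snd (snd w))) < ennreal \<epsilon> \<longleftrightarrow> \<nu>s \<in> Good)"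
        for \<nu>s and w :: "network \<times> (nat \<Rightarrow> network) \<times> network"
      have weights: "\<exists>w. \<nu>s \<in> P \<longrightarrow> suitable \<nu>s w" for \<nu>s
      proof (cases "\<nu>s \<in> Good")
        case True
        note nice = Good_nice[OF True]
        obtain s where s: "optimal_DOD \<Theta> \<Theta>' T G u n \<nu>s (A \<nu>s) (N' \<nu>s) s" using nice(4) by blast
        have in_\<Theta>': "\<nu>s j \<in> \<Theta>'" if "j < n" for j using nice(1) that by (auto simp: P_def PiE_def Pi_def)
        have n0: "0 < n" using n by simp
        obtain V VF where "rel_error \<Theta> \<Theta>' T G u (DOD_DFNN (A \<nu>s) (N' \<nu>s) (box_seed K \<sigma> a b) (\<lambda>j. root_net K Nh (\<lambda>g. col (V g) j))
            (net_concat (root_net (K * K') (N' \<nu>s) VF) (box_seed (K * K') \<sigma>2 a2 b2))) < ennreal \<epsilon>"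
          using DOD_DFNN_error_representative_sample[OF assms(1,2) y0[unfolded y0_def Y_def] t0[unfolded t0_def] \<open>m > 0\<close> \<open>L > 0\<close> \<epsilon>(1)
            less_imp_le[OF M] less_imp_le[OF \<eta>(1)] less_imp_le[OF \<kappa>] less_imp_le[OF \<gamma>] sol A[OF nice(1)]
            bound[unfolded \<Omega>_def] boxes[unfolded Y_def] boxes'
            less_imp_le[OF \<sigma>(1)] \<sigma>(2) less_imp_le[OF \<sigma>2(1)] \<sigma>2(2)[unfolded a2_def b2_def] n0 in_\<Theta>'
            freq[OF nice(2)] N'_def nice(3) s const[unfolded y0_def t0_def Y_def]]
          unfolding a2_def b2_def by blast
        then show ?thesis
          unfolding suitable_def using True fits1 fits2 fits3
          by (intro exI[of _ "(box_seed K \<sigma> a b, \<lambda>j. root_net K Nh (\<lambda>g. col (V g) j),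
              net_concat (root_net (K * K') (N' \<nu>s) VF) (box_seed (K * K') \<sigma>2 a2 b2))"]) simp
      next
        case bad: False
        show ?thesis
        proof (cases "\<nu>s \<in> P")
          case True
          obtain V VF where "\<not> rel_error \<Theta> \<Theta>' T G u (DOD_DFNN (A \<nu>s) (N' \<nu>s) (box_seed K 0 (\<lambda>_. 0 :: (real^'p) \<times> real) (\<lambda>_. 0))
              (\<lambda>j. root_net K Nh (\<lambda>g. col (V g) j))
              (net_concat (root_net (K * K') (N' \<nu>s) VF) (box_seed (K * K') 0 (\<lambda>_. 0 :: (real^'p) \<times> (real^'q) \<times> real) (\<lambda>_. 0)))) < ennreal \<epsilon>"
            using DOD_DFNN_large_error_weights[OF assms(1,2) \<Omega>pos[unfolded \<Omega>_def] \<open>m > 0\<close> M \<epsilon>(3) N'1[OF True] Nh K KK sol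
              A[OF True] bound[unfolded \<Omega>_def]] by blast
          then show ?thesis
            unfolding suitable_def using bad fits1 fits2 fits3
            by (intro exI[of _ "(box_seed K 0 (\<lambda>_. 0 :: (real^'p) \<times> real) (\<lambda>_. 0), \<lambda>j. root_net K Nh (\<lambda>g. col (V g) j),
                net_concat (root_net (K * K') (N' \<nu>s) VF) (box_seed (K * K') 0 (\<lambda>_. 0 :: (real^'p) \<times> (real^'q) \<times> real) (\<lambda>_. 0)))"]) simp
        qed simp
      qed
      obtain w where "\<forall>\<nu>s. \<nu>s \<in> P \<longrightarrow> suitable \<nu>s (w \<nu>s)"
        using choice[of "\<lambda>\<nu>s w. \<nu>s \<in> P \<longrightarrow> suitable \<nu>s w"] weights by blast
      then have w: "suitable \<nu>s (w \<nu>s)" if "\<nu>s \<in> P" for \<nu>s using that by blast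
      have set_eq: "{\<nu>s \<in> P. rel_error \<Theta> \<Theta>' T G u (DOD_DFNN (A \<nu>s) (N' \<nu>s) (fst (w \<nu>s)) (fst (snd (w \<nu>s))) (snd (snd (w \<nu>s)))) < ennreal \<epsilon>} = Good"
        using w Good_nice(1) unfolding suitable_def by blast
      have four: "4 \<le> cc * ln (1 / \<epsilon>)"
      proof -
        have "4 = 4 / l0 * l0" using l0 by simp
        also have "\<dots> \<le> cc * ln (1 / \<epsilon>)" using cc l l0 by (intro mult_mono) auto
        finally show ?thesis .
      qed
      have complexity: "inner_architecture (CARD('p) + 1) NA k (S0 k) (R0 k) \<and>
           well_shaped (CARD('p) + CARD('q) + 1) k (F0 k) \<and>
           real (inner_layers k (S0 k) (R0 k)) \<le> cc * ln (1 / \<epsilon>) \<and>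
           real (inner_weights k (S0 k) (R0 k))
             \<le> cc * real NA * real k * (1 / \<epsilon>) ^ (CARD('p) + 1) * ln (1 / \<epsilon>) \<and>
           real (length (F0 k)) \<le> cc * ln (1 / \<epsilon>) \<and>
           real (active_weights (F0 k))
             \<le> cc * real k * (1 / \<epsilon>) ^ (CARD('p) + CARD('q) + 1) * ln (1 / \<epsilon>)"
        if k: "1 \<le> k \<and> k < NA" for k
      proof (intro conjI)
        have k1: "1 \<le> k" using k by simp
        show "inner_architecture (CARD('p) + 1) NA k (S0 k) (R0 k)"
          unfolding S0_def R0_def d1_def NA by (rule inner_architecture_seed_root)
        show "well_shaped (CARD('p) + CARD('q) + 1) k (F0 k)"
          unfolding F0_def d2_def by (rule well_shaped_concat_root_seed)
        show "real (inner_layers k (S0 k) (R0 k)) \<le> cc * ln (1 / \<epsilon>)"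
          unfolding S0_def R0_def inner_layers_seed_root[OF k1] using four by simp
        show "real (length (F0 k)) \<le> cc * ln (1 / \<epsilon>)"
          unfolding F0_def length_concat_root_seed using four by simp
        have "real (inner_weights k (S0 k) (R0 k)) \<le> real (k * ((2 * d1\<^sup>2 + 5 * d1 + 5) * (Nh * K)))"
          unfolding S0_def R0_def of_nat_le_iff by (rule inner_weights_seed_root[OF K Nh])
        also have "\<dots> = D d1 * (real Nh * real k * real K)" by (simp add: D_def)
        also have "\<dots> \<le> cc * (real Nh * real k) * (1 / \<epsilon>) ^ d1 * ln (1 / \<epsilon>)"
          by (rule scaled_weight_bound[OF \<epsilon>(1,2) \<open>\<epsilon>0 < 1\<close> _ _ K_bound cc(4) cc(2)[unfolded l0_def]]) (auto simp: D_def)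
        finally show "real (inner_weights k (S0 k) (R0 k))
             \<le> cc * real NA * real k * (1 / \<epsilon>) ^ (CARD('p) + 1) * ln (1 / \<epsilon>)"
          by (simp only: NA d1_def mult.assoc)
        have "real (active_weights (F0 k)) \<le> real ((2 * d2\<^sup>2 + 5 * d2 + 5) * (k * (K * K')))"
          unfolding F0_def of_nat_le_iff by (rule active_weights_concat_root_seed[OF KK k1])
        also have "\<dots> = D d2 * (real k * real (K * K'))" by (simp add: D_def)
        also have "\<dots> \<le> cc * real k * (1 / \<epsilon>) ^ d2 * ln (1 / \<epsilon>)"
          by (rule scaled_weight_bound[OF \<epsilon>(1,2) \<open>\<epsilon>0 < 1\<close> _ _ KK_bound cc(4) cc(3)[unfolded l0_def]]) (auto simp: D_def)
        finally show "real (active_weights (F0 k))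
             \<le> cc * real k * (1 / \<epsilon>) ^ (CARD('p) + CARD('q) + 1) * ln (1 / \<epsilon>)"
          by (simp only: d2_def)
      qed
      show ?case
        unfolding P_def[symmetric] N'_def[symmetric] Let_def
      proof (rule exI[of _ S0], rule exI[of _ R0], rule exI[of _ F0], rule conjI)
        show "\<exists>wS wR wF. (\<forall>\<nu>s\<in>P. N' \<nu>s < NA \<longrightarrow> fits (S0 (N' \<nu>s)) (wS \<nu>s) \<and>
            (\<forall>i<N' \<nu>s. fits (R0 (N' \<nu>s) i) (wR \<nu>s i)) \<and> fits (F0 (N' \<nu>s)) (wF \<nu>s)) \<and>
          measure (sample_measure \<Theta>' n) {\<nu>s \<in> P. rel_error \<Theta> \<Theta>' T G u
             (DOD_DFNN (A \<nu>s) (N' \<nu>s) (wS \<nu>s) (wR \<nu>s) (wF \<nu>s)) < ennreal \<epsilon>} > 1 - \<delta>"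
        proof (rule exI[of _ "\<lambda>\<nu>s. fst (w \<nu>s)"], rule exI[of _ "\<lambda>\<nu>s. fst (snd (w \<nu>s))"],
            rule exI[of _ "\<lambda>\<nu>s. snd (snd (w \<nu>s))"], rule conjI)
          show "\<forall>\<nu>s\<in>P. N' \<nu>s < NA \<longrightarrow> fits (S0 (N' \<nu>s)) (fst (w \<nu>s)) \<and>
              (\<forall>i<N' \<nu>s. fits (R0 (N' \<nu>s) i) (fst (snd (w \<nu>s)) i)) \<and> fits (F0 (N' \<nu>s)) (snd (snd (w \<nu>s)))"
            using w unfolding suitable_def by simp
          show "measure (sample_measure \<Theta>' n) {\<nu>s \<in> P. rel_error \<Theta> \<Theta>' T G u
               (DOD_DFNN (A \<nu>s) (N' \<nu>s) (fst (w \<nu>s)) (fst (snd (w \<nu>s))) (snd (snd (w \<nu>s)))) < ennreal \<epsilon>} > 1 - \<delta>"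
            unfolding set_eq by (rule prob)
        qed
      qed (intro allI impI, rule complexity)
    qed
  qed
qed

end
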